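(* There is a universal constant $c_0\in(0,1)$ with the following property. Let the fixed data $N,p,\gamma,\Lambda,\delta,R,a_1,\dots,a_N,\bar Y_1,\dots,\bar Y_N$ be as in the context and suppose $R\le c_0\delta$. Then there exist $\varepsilon_0\in(0,1]$, a time $T>0$ and a constant $C>0$, all depending only on the fixed data (in particular $T$ and $C$ do not depend on $\varepsilon$ or on the solution), such that the solution $(Y_1,\dots,Y_N)$ of the point vortex system exists on $[0,T]$ and, for every $\varepsilon\in(0,\varepsilon_0]$, every $\varepsilon$-admissible solution $(\omega,\omega_1,\dots,\omega_N)$ and every $i\in\{1,\dots,N\}$, the vorticity centers $X_i(t)=\frac1{a_i}\int_{\mathbb{R}^2}x\,\omega_i(t,x)\,dx$ satisfy $$|X_i(t)-Y_i(t)|\le C e^{Ct}\varepsilon\quad\text{and}\quad\left|\frac{d}{dt}X_i(t)-\frac{d}{dt}Y_i(t)\right|\le C e^{Ct}\varepsilon\qquad\text{for all } t\in[0,T].$$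
   Context: Fixed data (independent of $\varepsilon$): $N\in\mathbb{N}$, $p\in(2,\infty)$, $\gamma>0$, $\Lambda>0$, $0<R<\delta$, nonzero real numbers $a_1,\dots,a_N$ (intensities), and distinct points $\bar Y_1,\dots,\bar Y_N\in\mathbb{R}^2$. Biot--Savart kernel: $K(z)=\frac{1}{2\pi}\frac{z^\perp}{|z|^2}$ with $z^\perp=(-z_2,z_1)$. Wasserstein distance to an atom: if $f$ is integrable of one sign, $a=\int f\,dx\neq0$ and $Y\in\mathbb{R}^2$, then $W_2\left(\frac{f}{a},\delta_Y\right)=\sqrt{\frac1a\int_{\mathbb{R}^2}|x-Y|^2f(x)\,dx}$ (here $\delta_Y$ is the Dirac measure, not to be confused with the number $\delta$). $\varepsilon$-admissible solution. For $\varepsilon\in(0,1]$, an $\varepsilon$-admissible solution $(\omega,\omega_1,\dots,\omega_N)$ consists of the following. (i) Initial data $\bar\omega=\sum_{i=1}^N\bar\omega_i$ with each $\bar\omega_i\in L^p(\mathbb{R}^2)$ compactly supported, either $\bar\omega_i\ge0$ or $\bar\omega_i\le0$, $\int\bar\omega_i\,dx=a_i$, and $\min_{i\ne j}\operatorname{dist}(\operatorname{spt}\bar\omega_i,\operatorname{spt}\bar\omega_j)\ge\delta$. (ii) $W_2\left(\bar\omega_i/a_i,\delta_{\bar Y_i}\right)\le\varepsilon$ for all $i$. (iii) $\|\bar\omega\|_{L^p}\le\Lambda\varepsilon^{-\gamma}$. (iv) $\operatorname{spt}\bar\omega_i\subset B_R(\bar X_i)$ for all $i$, where $\bar X_i=\frac1{a_i}\int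 x\,\bar\omega_i(x)\,dx$ and $B_R$ denotes the open ball. (v) $\omega\in C^0([0,\infty);L^p(\mathbb{R}^2))$ is a distributional solution of the Euler vorticity equation $\partial_t\omega+u\cdot\nabla\omega=0$, $\omega(0,\cdot)=\bar\omega$, where $u(t,\cdot)=K*\omega(t,\cdot)$ (so $\nabla\cdot u=0$), and $\omega_i\in C^0([0,\infty);L^p(\mathbb{R}^2))$ is the solution of the linear transport equation $\partial_t\omega_i+u\cdot\nabla\omega_i=0$, $\omega_i(0,\cdot)=\bar\omega_i$. These solutions are understood to be renormalized (DiPerna--Lions) and Lagrangian, i.e. transported by the flow of $u$; in particular they are compactly supported at each time, $\omega=\sum_i\omega_i$, the sign of $\omega_i$ is preserved, $\int\omega_i(t,x)\,dx=a_i$, and $\|\omega_i(t)\|_{L^p}=\|\bar\omega_i\|_{L^p}$. Point vortex system: $(Y_1,\dots,Y_N)$ is the solution of $\frac{d}{dt}Y_i(t)=\sum_{j\ne i}a_jK(Y_i(t)-Y_j(t))$, $Y_i(0)=\bar Y_i$, $i=1,\dots,N$. *)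

theory Defs
  imports "HOL-Analysis.Analysis"
begin

type_synonym plane = "real^2"

section \<open>Lebesgue spaces on the plane\<close>

text \<open>
  Elements of \<open>L\<^sup>p\<close> are represented by Borel functions; all notions below are invariant under
  changing a function on a null set at each time.
\<close>

definition Lp_space :: "real \<Rightarrow> (plane \<Rightarrow> real) set" where
  "Lp_space p = {f \<in> borel_measurable lborel. integrable lborel (\<lambda>x. \<bar>f x\<bar> powr p)}"

definition Lp_norm :: "real \<Rightarrow> (plane \<Rightarrow> real) \<Rightarrow> real" where
  "Lp_norm p f = (LINT x|lborel. \<bar>f x\<bar> powr p) powr (1 / p)"

definition Lp_continuous :: "real \<Rightarrow> (real \<Rightarrow> plane \<Rightarrow> real) \<Rightarrow> bool" where
  "Lp_continuous p f \<longleftrightarrow>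
     (\<forall>t\<ge>0. f t \<in> Lp_space p) \<and>
     (\<forall>t\<ge>0. ((\<lambda>s. Lp_norm p (\<lambda>x. f s x - f t x)) \<longlongrightarrow> 0) (at t within {0..}))"

text \<open>The support of an almost-everywhere class: the complement of the largest open set
  on which the function vanishes almost everywhere.\<close>

definition spt :: "(plane \<Rightarrow> real) \<Rightarrow> plane set" where
  "spt f = {x. \<forall>r>0. \<not> (AE y in lborel. y \<in> ball x r \<longrightarrow> f y = 0)}"

section \<open>Centers and distance to an atom\<close>

definition center :: "real \<Rightarrow> (plane \<Rightarrow> real) \<Rightarrow> plane" where
  "center a f = (1 / a) *\<^sub>R (LINT x|lborel. f x *\<^sub>R x)"

text \<open>\<open>W2_atom f Y\<close> is the 2-Wasserstein distance between \<open>f / a\<close> and the Dirac mass at \<open>Y\<close>,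
  where \<open>a = \<integral> f \<noteq> 0\<close> and \<open>f\<close> has one sign.  The product measure is the only coupling with a
  Dirac mass, so the distance is given by a second moment.\<close>

definition W2_atom :: "(plane \<Rightarrow> real) \<Rightarrow> plane \<Rightarrow> real" where
  "W2_atom f Y =
     sqrt (1 / (LINT x|lborel. f x) * (LINT x|lborel. (norm (x - Y))\<^sup>2 * f x))"

section \<open>Biot-Savart law\<close>

definition perp :: "plane \<Rightarrow> plane" where
  "perp z = vector [- z $ 2, z $ 1]"

definition BS_kernel :: "plane \<Rightarrow> plane" where
  "BS_kernel z = (1 / (2 * pi)) *\<^sub>R (perp z /\<^sub>R (norm z)\<^sup>2)"

definition BS_velocity :: "(real \<Rightarrow> plane \<Rightarrow> real) \<Rightarrow> real \<Rightarrow> plane \<Rightarrow> plane" where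
  "BS_velocity \<omega> t x = (LINT y|lborel. \<omega> t y *\<^sub>R BS_kernel (x - y))"

section \<open>Transport by a divergence-free velocity field\<close>

primrec C_k :: "nat \<Rightarrow> ('a::euclidean_space \<Rightarrow> real) \<Rightarrow> bool" where
  "C_k 0 f \<longleftrightarrow> continuous_on UNIV f"
| "C_k (Suc k) f \<longleftrightarrow>
     (\<forall>x. f differentiable (at x)) \<and>
     (\<forall>b\<in>Basis. C_k k (\<lambda>x. frechet_derivative f (at x) b))"

definition test_function :: "(real \<times> plane \<Rightarrow> real) \<Rightarrow> bool" where
  "test_function \<phi> \<longleftrightarrow> (\<forall>k. C_k k \<phi>) \<and> compact (closure (support_on UNIV \<phi>))"

text \<open>
  Distributional solutions on \<open>[0,\<infinity>) \<times> \<real>\<^sup>2\<close> of \<open>\<partial>\<^sub>t f + u \<cdot> \<nabla>f = 0\<close> with \<open>f(0,\<cdot>) = f0\<close>, for \<open>u\<close> with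
  zero divergence, so that \<open>u \<cdot> \<nabla>f = div (u f)\<close>.  The derivative of a test function in the
  direction \<open>(1, u)\<close> is \<open>\<partial>\<^sub>t \<phi> + u \<cdot> \<nabla>\<phi>\<close>.  Test functions need not vanish at time 0.
\<close>

definition distributional_solution ::
    "(real \<Rightarrow> plane \<Rightarrow> plane) \<Rightarrow> (real \<Rightarrow> plane \<Rightarrow> real) \<Rightarrow> (plane \<Rightarrow> real) \<Rightarrow> bool" where
  "distributional_solution u f f0 \<longleftrightarrow>
     (AE x in lborel. f 0 x = f0 x) \<and>
     (\<forall>\<phi>. test_function \<phi> \<longrightarrow>
        (LINT t:{0..}|lborel. LINT x|lborel.
            f t x * frechet_derivative \<phi> (at (t, x)) (1, u t x))
        + (LINT x|lborel. f0 x * \<phi> (0, x)) = 0)"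

definition renormalized_solution ::
    "(real \<Rightarrow> plane \<Rightarrow> plane) \<Rightarrow> (real \<Rightarrow> plane \<Rightarrow> real) \<Rightarrow> (plane \<Rightarrow> real) \<Rightarrow> bool" where
  "renormalized_solution u f f0 \<longleftrightarrow>
     (\<forall>\<beta>::real \<Rightarrow> real. C_k 1 \<beta> \<and> bounded (range \<beta>) \<longrightarrow>
        distributional_solution u (\<lambda>t x. \<beta> (f t x)) (\<lambda>x. \<beta> (f0 x)))"

text \<open>The DiPerna--Lions (regular Lagrangian) flow: almost every trajectory is an integral curve,
  and each time map preserves Lebesgue measure, as \<open>u\<close> has zero divergence.\<close>

definition lagrangian_flow ::
    "(real \<Rightarrow> plane \<Rightarrow> plane) \<Rightarrow> (real \<Rightarrow> plane \<Rightarrow> plane) \<Rightarrow> bool" where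
  "lagrangian_flow u \<Phi> \<longleftrightarrow>
     (\<forall>t\<ge>0. \<Phi> t \<in> measurable lborel lborel \<and> distr lborel lborel (\<Phi> t) = lborel) \<and>
     (AE x in lborel. \<forall>t\<ge>0.
        set_integrable lborel {0..t} (\<lambda>s. u s (\<Phi> s x)) \<and>
        \<Phi> t x = x + (LINT s:{0..t}|lborel. u s (\<Phi> s x)))"

definition transported_by ::
    "(real \<Rightarrow> plane \<Rightarrow> plane) \<Rightarrow> (real \<Rightarrow> plane \<Rightarrow> real) \<Rightarrow> (plane \<Rightarrow> real) \<Rightarrow> bool" where
  "transported_by \<Phi> f f0 \<longleftrightarrow> (\<forall>t\<ge>0. AE x in lborel. f t (\<Phi> t x) = f0 x)"

section \<open>Admissible solutions\<close>

definition admissible_initial_data ::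
    "nat \<Rightarrow> real \<Rightarrow> real \<Rightarrow> real \<Rightarrow> real \<Rightarrow> real \<Rightarrow> (nat \<Rightarrow> real) \<Rightarrow> (nat \<Rightarrow> plane) \<Rightarrow> real
      \<Rightarrow> (nat \<Rightarrow> plane \<Rightarrow> real) \<Rightarrow> bool" where
  "admissible_initial_data N p \<gamma> \<Lambda> \<delta> R a Y0 \<epsilon> \<omega>0 \<longleftrightarrow>
     (\<forall>i\<in>{1..N}.
        \<omega>0 i \<in> Lp_space p \<and> compact (spt (\<omega>0 i)) \<and>
        ((AE x in lborel. 0 \<le> \<omega>0 i x) \<or> (AE x in lborel. \<omega>0 i x \<le> 0)) \<and>
        (LINT x|lborel. \<omega>0 i x) = a i) \<and>
     (\<forall>i\<in>{1..N}. \<forall>j\<in>{1..N}. i \<noteq> j \<longrightarrow> \<delta> \<le> setdist (spt (\<omega>0 i)) (spt (\<omega>0 j))) \<and>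
     (\<forall>i\<in>{1..N}. W2_atom (\<omega>0 i) (Y0 i) \<le> \<epsilon>) \<and>
     Lp_norm p (\<lambda>x. \<Sum>i=1..N. \<omega>0 i x) \<le> \<Lambda> * \<epsilon> powr (- \<gamma>) \<and>
     (\<forall>i\<in>{1..N}. spt (\<omega>0 i) \<subseteq> ball (center (a i) (\<omega>0 i)) R)"

text \<open>The last conjunct records the standard consequences of being transported by the flow.\<close>

definition euler_solution ::
    "nat \<Rightarrow> real \<Rightarrow> (nat \<Rightarrow> real) \<Rightarrow> (nat \<Rightarrow> plane \<Rightarrow> real)
      \<Rightarrow> (real \<Rightarrow> plane \<Rightarrow> real) \<Rightarrow> (nat \<Rightarrow> real \<Rightarrow> plane \<Rightarrow> real) \<Rightarrow> bool" where
  "euler_solution N p a \<omega>0 \<omega> \<omega>i \<longleftrightarrow>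
     (let u = BS_velocity \<omega>; \<omega>0_total = (\<lambda>x. \<Sum>i=1..N. \<omega>0 i x) in
       Lp_continuous p \<omega> \<and>
       distributional_solution u \<omega> \<omega>0_total \<and>
       renormalized_solution u \<omega> \<omega>0_total \<and>
       (\<forall>i\<in>{1..N}.
          Lp_continuous p (\<omega>i i) \<and>
          distributional_solution u (\<omega>i i) (\<omega>0 i) \<and>
          renormalized_solution u (\<omega>i i) (\<omega>0 i)) \<and>
       (\<exists>\<Phi>. lagrangian_flow u \<Phi> \<and> transported_by \<Phi> \<omega> \<omega>0_total \<and>
          (\<forall>i\<in>{1..N}. transported_by \<Phi> (\<omega>i i) (\<omega>0 i))) \<and>
       (\<forall>t\<ge>0.
          compact (spt (\<omega> t)) \<and>
          (AE x in lborel. \<omega> t x = (\<Sum>i=1..N. \<omega>i i t x)) \<and>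
          (\<forall>i\<in>{1..N}.
             compact (spt (\<omega>i i t)) \<and>
             ((AE x in lborel. 0 \<le> \<omega>0 i x) \<longrightarrow> (AE x in lborel. 0 \<le> \<omega>i i t x)) \<and>
             ((AE x in lborel. \<omega>0 i x \<le> 0) \<longrightarrow> (AE x in lborel. \<omega>i i t x \<le> 0)) \<and>
             (LINT x|lborel. \<omega>i i t x) = a i \<and>
             Lp_norm p (\<omega>i i t) = Lp_norm p (\<omega>0 i))))"

definition admissible_solution ::
    "nat \<Rightarrow> real \<Rightarrow> real \<Rightarrow> real \<Rightarrow> real \<Rightarrow> real \<Rightarrow> (nat \<Rightarrow> real) \<Rightarrow> (nat \<Rightarrow> plane) \<Rightarrow> real
      \<Rightarrow> (real \<Rightarrow> plane \<Rightarrow> real) \<Rightarrow> (nat \<Rightarrow> real \<Rightarrow> plane \<Rightarrow> real) \<Rightarrow> bool" where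
  "admissible_solution N p \<gamma> \<Lambda> \<delta> R a Y0 \<epsilon> \<omega> \<omega>i \<longleftrightarrow>
     (\<exists>\<omega>0. admissible_initial_data N p \<gamma> \<Lambda> \<delta> R a Y0 \<epsilon> \<omega>0 \<and> euler_solution N p a \<omega>0 \<omega> \<omega>i)"

section \<open>Point vortex system\<close>

text \<open>Solutions are collision-free; this must be required because \<open>BS_kernel 0 = 0\<close> here.\<close>

definition point_vortex_solution ::
    "nat \<Rightarrow> (nat \<Rightarrow> real) \<Rightarrow> (nat \<Rightarrow> plane) \<Rightarrow> real \<Rightarrow> (nat \<Rightarrow> real \<Rightarrow> plane) \<Rightarrow> bool" where
  "point_vortex_solution N a Y0 T Y \<longleftrightarrow>
     (\<forall>i\<in>{1..N}. Y i 0 = Y0 i) \<and>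
     (\<forall>t\<in>{0..T}. inj_on (\<lambda>i. Y i t) {1..N}) \<and>
     (\<forall>i\<in>{1..N}. \<forall>t\<in>{0..T}.
        (Y i has_vector_derivative
           (\<Sum>j\<in>{1..N} - {i}. a j *\<^sub>R BS_kernel (Y i t - Y j t))) (at t within {0..T}))"

end

theory Submission
  imports Defs
begin

text \<open>
  The proof is Lagrangian.  By measure preservation and transport, the velocity is
  \<open>u t z = \<Sum>j. \<integral>y. \<omega>0 j y *\<^sub>R BS_kernel (z - \<Phi> t y)\<close>, an integral over the initial positions of the
  particles, and \<open>X i t\<close> is the average of \<open>\<Phi> t\<close> with respect to \<open>\<omega>0 i\<close>.  The \<open>L\<^sup>p\<close> bound with
  \<open>p > 2\<close> makes the near part of the potential uniformly small (\<open>near_potential_small\<close>), so that the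
  velocity is continuous along paths and the trajectories are differentiable everywhere
  (\<open>vortex_flow\<close>).  From there on only particles and finite measures occur.

  Suppose that each vortex stays in a disc of radius \<open>2 R\<close> about the initial point vortex \<open>Y0 i\<close>.
  Different vortices then interact by a kernel with Lipschitz constant of order \<open>1 / R\<^sup>2\<close>, and a
  vortex has no effect on its own center and second moment, as the kernel is odd.  Comparing with the
  point vortices, one finds a linear differential inequality for the sum of the second moments
  \<open>\<integral>x. |\<Phi> t x - Y i t|\<^sup>2 \<partial>|\<omega>0 i|\<close>, which are of order \<open>\<epsilon>\<^sup>2\<close> initially by the \<open>W\<^sub>2\<close> bound
  (\<open>dispersion_le\<close>).  Both claims follow, since \<open>X i - Y i\<close> and the difference of the velocities
  are bounded by first moments.

  It remains to confine all particles to these discs up to a time that does not depend on \<open>\<epsilon>\<close>.  The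
  difficulty is the velocity of a vortex near itself, which may be of the order of a negative power
  of \<open>\<epsilon>\<close>.  At a distance from the bulk, however, it is of order one as soon as the mass that is not
  in the bulk is smaller than a certain power \<open>\<epsilon> powr k\<close> (\<open>norm_velocity_le_split\<close>), where \<open>k\<close>
  depends on \<open>p\<close> and \<open>\<gamma>\<close> and may be large, so that second moments are not sufficient.  Instead,
  exponential moments \<open>\<integral>x. exp (\<theta> |\<Phi> t x - Y0 i|\<^sup>2) \<partial>|\<omega>0 i|\<close> with \<open>\<theta>\<close> of order \<open>ln (1 / \<epsilon>)\<close>
  are used.  Their relative growth rate is only of order \<open>\<theta>\<close>: symmetrization in the two particles
  removes the singularity of the self-interaction and leaves a term with \<open>\<theta>\<^sup>2\<close>, which is small since
  it comes with the mass outside of the bulk, of order \<open>\<epsilon>\<^sup>2\<close> (\<open>exp_moment_deriv_le\<close>).  As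
  \<open>\<theta>\<close> appears in the same way in the growth rate and in the exponent, there is a time independent of
  \<open>\<theta>\<close> until which the mass at distance \<open>3 R / 2\<close> is at most of order \<open>exp (- \<theta> R\<^sup>2 / 4)\<close>, a power
  of \<open>\<epsilon>\<close> at our disposal (\<open>far_mass_le_exp\<close>).  Hence particles that have left the bulk are slow,
  the disc of radius \<open>2 R\<close> improves to radius \<open>7 R / 4\<close> (\<open>trapped\<close>), and a bootstrap in finitely many
  steps closes the argument (\<open>confined_vortex_flowI\<close>).

  The point vortex system itself is solved for a short time by contraction
  (\<open>point_vortex_solution_exists\<close>), and each of its solutions stays close to its initial positions
  (\<open>point_vortex_solution_near\<close>).
\<close>

section \<open>The Biot--Savart kernel\<close>

lemma perp_nth [simp]: "perp z $ 1 = - z $ 2" "perp z $ 2 = z $ 1"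
  by (simp_all add: perp_def)

lemma inner_plane: "(x :: plane) \<bullet> y = x $ 1 * y $ 1 + x $ 2 * y $ 2"
  by (simp add: inner_vec_def sum_2)

lemma linear_perp: "linear perp"
  by (rule linearI) (simp_all add: vec_eq_iff forall_2)

lemma bounded_linear_perp: "bounded_linear perp"
  by (rule linear_conv_bounded_linear[THEN iffD1, OF linear_perp])

lemmas perp_diff = linear_diff[OF linear_perp]
  and perp_scale = linear_scale[OF linear_perp]
  and perp_minus = linear_neg[OF linear_perp]
  and perp_zero = linear_0[OF linear_perp]

lemma inner_perp_perp: "perp x \<bullet> perp y = x \<bullet> y"
  by (simp add: inner_plane)

lemma norm_perp [simp]: "norm (perp z) = norm z"
  by (simp add: norm_eq_sqrt_inner inner_perp_perp)

lemma inner_perp_self [simp]: "x \<bullet> perp x = 0"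
  by (simp add: inner_plane)

lemma inner_perp_flip: "x \<bullet> perp y = - (y \<bullet> perp x)"
  by (simp add: inner_plane)

lemma perp_measurable [measurable]: "perp \<in> borel_measurable borel"
  by (intro borel_measurable_continuous_onI linear_continuous_on bounded_linear_perp)

lemma BS_kernel_measurable [measurable]: "BS_kernel \<in> borel_measurable borel"
  unfolding BS_kernel_def by measurable

lemma norm_BS_kernel: "norm (BS_kernel z) = 1 / (2 * pi * norm z)"
proof -
  have "norm (BS_kernel z) = 1 / (2 * pi) * (inverse (norm z) * inverse (norm z) * norm z)"
    by (simp add: BS_kernel_def power2_eq_square)
  also have "inverse (norm z) * inverse (norm z) * norm z = inverse (norm z)"
    by (cases "z = 0") auto
  finally show ?thesis
    by (simp only: divide_inverse inverse_mult_distrib mult_1_left mult_ac)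
qed

lemma BS_kernel_minus: "BS_kernel (- z) = - BS_kernel z"
  by (simp add: BS_kernel_def perp_minus)

lemma inner_BS_kernel_self: "z \<bullet> BS_kernel z = 0"
  by (simp add: BS_kernel_def)

lemma inner_BS_kernel_diff:
  "x \<bullet> BS_kernel (x - y) = - (x \<bullet> perp y) / (2 * pi * (norm (x - y))\<^sup>2)"
proof -
  have "x \<bullet> BS_kernel (x - y) = (1 / (2 * pi)) * (inverse ((norm (x - y))\<^sup>2) * (x \<bullet> perp (x - y)))"
    by (simp only: BS_kernel_def inner_scaleR_right)
  also have "x \<bullet> perp (x - y) = - (x \<bullet> perp y)"
    by (simp only: perp_diff inner_diff_right inner_perp_self)
  finally show ?thesis
    by (simp only: divide_inverse inverse_mult_distrib mult_minus_left mult_minus_right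
        mult_1_left mult_ac)
qed

lemma norm_inversion_diff:
  fixes z w :: "'a::real_inner"
  assumes "z \<noteq> 0" "w \<noteq> 0"
  shows "norm (z /\<^sub>R (norm z)\<^sup>2 - w /\<^sub>R (norm w)\<^sup>2) = norm (z - w) / (norm z * norm w)"
proof -
  have "(norm (z /\<^sub>R (norm z)\<^sup>2 - w /\<^sub>R (norm w)\<^sup>2))\<^sup>2 = (norm (z - w) / (norm z * norm w))\<^sup>2"
  proof -
    define a b c where "a = z \<bullet> z" and "b = w \<bullet> w" and "c = z \<bullet> w"
    have pos: "a > 0" "b > 0" using assms by (auto simp: a_def b_def)
    have "(norm (z /\<^sub>R (norm z)\<^sup>2 - w /\<^sub>R (norm w)\<^sup>2))\<^sup>2
        = inverse a * inverse a * a - 2 * (inverse a * inverse b * c) + inverse b * inverse b * b"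
      unfolding power2_norm_eq_inner a_def b_def c_def
      by (simp only: inner_diff_left inner_diff_right inner_commute[of w z] inner_scaleR_left
          inner_scaleR_right) (simp add: algebra_simps)
    also have "\<dots> = (a - 2 * c + b) / (a * b)"
      using pos by (simp add: field_simps)
    also have "a - 2 * c + b = (norm (z - w))\<^sup>2"
      unfolding power2_norm_eq_inner a_def b_def c_def
      by (simp add: inner_diff_left inner_diff_right inner_commute[of w z])
    also have "(norm (z - w))\<^sup>2 / (a * b) = (norm (z - w) / (norm z * norm w))\<^sup>2"
      by (simp add: power_divide power_mult_distrib power2_norm_eq_inner a_def b_def)
    finally show ?thesis .
  qed
  then show ?thesis by (simp add: power2_eq_iff_nonneg)
qed

text \<open>Up to a rotation and a factor, \<^term>\<open>BS_kernel\<close> is the inversion in the unit circle, which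
  distorts distances by an explicit factor.  This gives a Lipschitz bound away from the origin
  without any argument along the segment that joins the points.\<close>

lemma norm_BS_kernel_diff:
  assumes "z \<noteq> 0" "w \<noteq> 0"
  shows "norm (BS_kernel z - BS_kernel w) = norm (z - w) / (2 * pi * (norm z * norm w))"
proof -
  have "BS_kernel z - BS_kernel w = (1 / (2 * pi)) *\<^sub>R perp (z /\<^sub>R (norm z)\<^sup>2 - w /\<^sub>R (norm w)\<^sup>2)"
    by (simp add: BS_kernel_def perp_diff perp_scale scaleR_diff_right)
  then show ?thesis
    using norm_inversion_diff[OF assms] by simp
qed

lemma norm_BS_kernel_diff_le:
  assumes "0 < d" "d \<le> norm z" "d \<le> norm w"
  shows "norm (BS_kernel z - BS_kernel w) \<le> norm (z - w) / d\<^sup>2"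
proof -
  have "norm (BS_kernel z - BS_kernel w) = norm (z - w) / (2 * pi * (norm z * norm w))"
    using assms by (intro norm_BS_kernel_diff) auto
  also have "\<dots> \<le> norm (z - w) / (1 * (d * d))"
    using assms pi_gt3 by (intro divide_left_mono mult_mono mult_pos_pos) auto
  finally show ?thesis by (simp add: power2_eq_square)
qed

lemma norm_BS_kernel_le:
  assumes "0 < d" "d \<le> norm z"
  shows "norm (BS_kernel z) \<le> 1 / (6 * d)"
  unfolding norm_BS_kernel using assms pi_gt3
  by (intro divide_left_mono mult_mono mult_pos_pos) auto

lemma norm_BS_kernel_le_inverse: "norm (BS_kernel z) \<le> 1 / norm z"
  unfolding norm_BS_kernel using pi_gt3
  by (cases "z = 0") (auto intro!: divide_left_mono mult_pos_pos)

section \<open>Calculus along trajectories\<close>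

lemma has_real_derivative_nonpos_antimono:
  fixes f :: "real \<Rightarrow> real"
  assumes "\<And>t. t \<in> {0..T} \<Longrightarrow> (f has_vector_derivative f' t) (at t within {0..T})"
    and "\<And>t. t \<in> {0..T} \<Longrightarrow> f' t \<le> 0" and "t \<in> {0..T}"
  shows "f t \<le> f 0"
proof -
  have "\<exists>x\<in>{0..t}. f t - f 0 = (\<lambda>h. h *\<^sub>R f' x) (t - 0)"
    using assms(3)
    using has_derivative_subset[OF assms(1)[unfolded has_vector_derivative_def], of _ "{0..t}"]
    by (intro mvt_very_simple) auto
  then obtain x where "x \<in> {0..t}" "f t - f 0 = t * f' x"
    by auto
  moreover have "t * f' x \<le> 0"
    using assms(2)[of x] assms(3) calculation(1) by (intro mult_nonneg_nonpos) auto
  ultimately show ?thesis by simp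
qed

lemma gronwall:
  fixes f :: "real \<Rightarrow> real"
  assumes deriv: "\<And>t. t \<in> {0..T} \<Longrightarrow> (f has_vector_derivative f' t) (at t within {0..T})"
    and le: "\<And>t. t \<in> {0..T} \<Longrightarrow> f' t \<le> A * f t" and t: "t \<in> {0..T}"
  shows "f t \<le> f 0 * exp (A * t)"
proof -
  have "f t * exp (- A * t) \<le> f 0 * exp (- A * 0)"
  proof (rule has_real_derivative_nonpos_antimono[OF _ _ t])
    fix s assume s: "s \<in> {0..T}"
    have "((\<lambda>t. exp (- A * t)) has_real_derivative (- A * exp (- A * s))) (at s within {0..T})"
      by (auto intro!: derivative_eq_intros)
    then show "((\<lambda>t. f t * exp (- A * t)) has_vector_derivative
        (f s * (- A * exp (- A * s)) + f' s * exp (- A * s))) (at s within {0..T})"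
      unfolding has_real_derivative_iff_has_vector_derivative
      by (intro has_vector_derivative_mult deriv[OF s])
    have "(f' s - A * f s) * exp (- A * s) \<le> 0"
      using le[OF s] by (intro mult_nonpos_nonneg) auto
    then show "f s * (- A * exp (- A * s)) + f' s * exp (- A * s) \<le> 0"
      by (simp add: algebra_simps)
  qed
  then have "f t * exp (- A * t) * exp (A * t) \<le> f 0 * exp (A * t)"
    by (intro mult_right_mono) auto
  then show ?thesis by (simp add: mult.assoc flip: exp_add)
qed

lemma has_vector_derivative_iff_tendsto:
  "(f has_vector_derivative v) (at t within S) \<longleftrightarrow>
    ((\<lambda>s. (f s - f t) /\<^sub>R (s - t)) \<longlongrightarrow> v) (at t within S)"
proof -
  have "norm ((f s - f t) /\<^sub>R (s - t) - v) = norm ((1 / norm (s - t)) *\<^sub>R (f s - (f t + (s - t) *\<^sub>R v)))"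
    if "s \<noteq> t" for s
  proof -
    have "(f s - f t) /\<^sub>R (s - t) - v = (f s - (f t + (s - t) *\<^sub>R v)) /\<^sub>R (s - t)"
      using that by (simp add: scaleR_diff_right diff_add_eq_diff_diff_swap)
    then show ?thesis by (simp only: norm_scaleR norm_inverse real_norm_def abs_divide abs_one abs_idempotent inverse_eq_divide abs_inverse)
  qed
  then have "((\<lambda>s. norm ((f s - f t) /\<^sub>R (s - t) - v)) \<longlongrightarrow> 0) (at t within S) \<longleftrightarrow>
    ((\<lambda>s. norm ((1 / norm (s - t)) *\<^sub>R (f s - (f t + (s - t) *\<^sub>R v)))) \<longlongrightarrow> 0) (at t within S)"
    by (intro Lim_cong_within) auto
  then have "((\<lambda>s. (f s - f t) /\<^sub>R (s - t)) \<longlongrightarrow> v) (at t within S) \<longleftrightarrow>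
    ((\<lambda>s. (1 / norm (s - t)) *\<^sub>R (f s - (f t + (s - t) *\<^sub>R v))) \<longlongrightarrow> 0) (at t within S)"
    by (simp only: tendsto_norm_zero_iff LIM_zero_iff)
  then show ?thesis
    by (simp only: has_vector_derivative_def has_derivative_within bounded_linear_scaleR_left simp_thms)
qed

lemma norm_diff_le_of_vector_derivative_le:
  fixes f :: "real \<Rightarrow> 'a::real_normed_vector"
  assumes "convex S" "\<And>t. t \<in> S \<Longrightarrow> (f has_vector_derivative f' t) (at t within S)"
    and "\<And>t. t \<in> S \<Longrightarrow> norm (f' t) \<le> B" and "s \<in> S" "t \<in> S"
  shows "norm (f t - f s) \<le> B * \<bar>t - s\<bar>"
proof -
  have "norm (f t - f s) \<le> B * norm (t - s)"
  proof (rule differentiable_bound[OF assms(1)])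
    show "(f has_derivative (\<lambda>h. h *\<^sub>R f' u)) (at u within S)" if "u \<in> S" for u
      using assms(2)[OF that] by (simp add: has_vector_derivative_def)
    show "onorm (\<lambda>h. h *\<^sub>R f' u) \<le> B" if "u \<in> S" for u
      using assms(3)[OF that] by (intro onorm_le) (simp add: mult.commute[of _ "norm (f' u)"] mult_right_mono)
  qed (use assms in auto)
  then show ?thesis by simp
qed

text \<open>Dominated convergence for the difference quotients, which inherit the bound on the derivative by
  the mean value inequality.\<close>

lemma has_vector_derivative_integral:
  fixes f :: "real \<Rightarrow> 'a \<Rightarrow> 'b::{banach, second_countable_topology}"
  assumes "finite_measure M" and S: "convex S" and t: "t \<in> S"
    and int: "\<And>s. s \<in> S \<Longrightarrow> integrable M (f s)"
    and meas: "f' t \<in> borel_measurable M"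
    and deriv: "AE x in M. \<forall>s\<in>S. ((\<lambda>s. f s x) has_vector_derivative f' s x) (at s within S)"
    and bound: "AE x in M. \<forall>s\<in>S. norm (f' s x) \<le> B"
  shows "((\<lambda>s. \<integral>x. f s x \<partial>M) has_vector_derivative (\<integral>x. f' t x \<partial>M)) (at t within S)"
proof -
  interpret finite_measure M by fact
  have "((\<lambda>s. ((\<integral>x. f s x \<partial>M) - (\<integral>x. f t x \<partial>M)) /\<^sub>R (s - t)) \<longlongrightarrow> (\<integral>x. f' t x \<partial>M)) (at t within S)"
    unfolding tendsto_at_iff_sequentially o_def
  proof (intro allI impI)
    fix X :: "nat \<Rightarrow> real" assume X: "\<forall>i. X i \<in> S - {t}" and lim: "X \<longlonglongrightarrow> t"
    have XS: "X i \<in> S" "X i \<noteq> t" for i using X by auto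
    have "(\<lambda>i. \<integral>x. (f (X i) x - f t x) /\<^sub>R (X i - t) \<partial>M) \<longlonglongrightarrow> (\<integral>x. f' t x \<partial>M)"
    proof (rule integral_dominated_convergence[where w = "\<lambda>_. B"])
      show "(\<lambda>x. (f (X i) x - f t x) /\<^sub>R (X i - t)) \<in> borel_measurable M" for i
        using int[OF XS(1)] int[OF t] by (auto intro!: borel_measurable_scaleR borel_measurable_diff
            dest: borel_measurable_integrable)
      show "AE x in M. (\<lambda>i. (f (X i) x - f t x) /\<^sub>R (X i - t)) \<longlonglongrightarrow> f' t x"
        using deriv
      proof eventually_elim
        case (elim x)
        then have "((\<lambda>s. f s x) has_vector_derivative f' t x) (at t within S)"
          using t by blast
        then have "((\<lambda>s. (f s x - f t x) /\<^sub>R (s - t)) \<longlongrightarrow> f' t x) (at t within S)"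
          by (rule has_vector_derivative_iff_tendsto[THEN iffD1])
        then show ?case
          using X lim by (auto simp: tendsto_at_iff_sequentially o_def)
      qed
      show "AE x in M. norm ((f (X i) x - f t x) /\<^sub>R (X i - t)) \<le> B" for i
        using deriv bound
      proof eventually_elim
        case (elim x)
        have "norm (f (X i) x - f t x) \<le> B * \<bar>X i - t\<bar>"
          by (rule norm_diff_le_of_vector_derivative_le[OF S])
            (use elim XS t in auto)
        then show ?case
          using XS(2)[of i] by (simp add: divide_simps)
      qed
    qed (use meas in auto)
    moreover have "(\<integral>x. (f (X i) x - f t x) /\<^sub>R (X i - t) \<partial>M) =
        ((\<integral>x. f (X i) x \<partial>M) - (\<integral>x. f t x \<partial>M)) /\<^sub>R (X i - t)" for i
      using int[OF XS(1)] int[OF t] by simp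
    ultimately show "(\<lambda>i. ((\<integral>x. f (X i) x \<partial>M) - (\<integral>x. f t x \<partial>M)) /\<^sub>R (X i - t)) \<longlonglongrightarrow> (\<integral>x. f' t x \<partial>M)"
      by (simp only:)
  qed
  then show ?thesis
    by (simp add: has_vector_derivative_iff_tendsto)
qed

section \<open>The singular kernel and \<open>L\<^sup>p\<close> vorticities\<close>

text \<open>A bound for the integral of \<open>norm z powr - q\<close> over the unit disc: the sum over the dyadic rings, each of
  which is enlarged to a full disc in the estimate of its area.\<close>

definition riesz_const :: "real \<Rightarrow> real" where
  "riesz_const q = pi * 2 powr q / (1 - 2 powr (q - 2))"

lemma riesz_const_nonneg: "q < 2 \<Longrightarrow> 0 \<le> riesz_const q"
  using powr_less_mono[of "q - 2" 0 "2::real"] by (simp add: riesz_const_def)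

lemma ball_sets [measurable]: "ball (c :: plane) s \<in> sets borel"
  by simp

lemma nn_integral_riesz_ball:
  assumes "0 < q" "q < 2" "0 < r"
  shows "(\<integral>\<^sup>+ (z::plane). indicator (ball 0 r) z * ennreal (norm z powr - q) \<partial>lborel)
    \<le> ennreal (riesz_const q * r powr (2 - q))"
proof -
  let ?c = "\<lambda>k::nat. (r / 2 ^ Suc k) powr - q"
  define \<rho> where "\<rho> = (2::real) powr (q - 2)"
  have \<rho>: "0 < \<rho>" "\<rho> < 1"
    using assms powr_less_mono[of "q - 2" 0 "2::real"] by (auto simp: \<rho>_def)
  have pt: "indicator (ball 0 r) z * ennreal (norm z powr - q)
      \<le> (\<Sum>k. ennreal (?c k) * indicator (ball 0 (r / 2 ^ k)) z)" for z :: plane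
  proof (cases "z \<in> ball 0 r \<and> z \<noteq> 0")
    case True
    then have z: "0 < norm z" "norm z < r" by auto
    have "\<exists>k. r / 2 ^ k \<le> norm z"
    proof -
      obtain k where "r / norm z < 2 ^ k"
        using real_arch_pow[of 2 "r / norm z"] by auto
      then show ?thesis using z by (intro exI[of _ k]) (simp add: field_simps)
    qed
    then obtain k where k: "r / 2 ^ k \<le> norm z" "\<And>j. j < k \<Longrightarrow> \<not> r / 2 ^ j \<le> norm z"
      by (meson exists_least_iff)
    then obtain j where j: "k = Suc j"
      using z by (cases k) auto
    have "norm z powr - q \<le> ?c j"
      using k(1) z assms by (intro powr_mono2') (auto simp: j)
    then have "indicator (ball 0 r) z * ennreal (norm z powr - q)
        \<le> (\<Sum>k\<in>{j}. ennreal (?c k) * indicator (ball 0 (r / 2 ^ k)) z)"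
      using True k(2)[of j] by (simp add: j ennreal_leI)
    also have "\<dots> \<le> (\<Sum>k. ennreal (?c k) * indicator (ball 0 (r / 2 ^ k)) z)"
      by (intro sum_le_suminf) auto
    finally show ?thesis .
  qed auto
  have "(\<integral>\<^sup>+ (z::plane). indicator (ball 0 r) z * ennreal (norm z powr - q) \<partial>lborel)
      \<le> (\<integral>\<^sup>+ (z::plane). (\<Sum>k. ennreal (?c k) * indicator (ball 0 (r / 2 ^ k)) z) \<partial>lborel)"
    by (intro nn_integral_mono pt)
  also have "\<dots> = (\<Sum>k. \<integral>\<^sup>+ (z::plane). ennreal (?c k) * indicator (ball 0 (r / 2 ^ k)) z \<partial>lborel)"
    by (rule nn_integral_suminf) measurable
  also have "\<dots> = (\<Sum>k. ennreal (?c k) * emeasure lborel (ball (0::plane) (r / 2 ^ k)))"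
    by (simp add: nn_integral_cmult)
  also have "\<dots> = (\<Sum>k. ennreal (pi * 2 powr q * r powr (2 - q) * \<rho> ^ k))"
  proof (intro suminf_cong)
    fix k :: nat
    have "emeasure lborel (ball (0::plane) (r / 2 ^ k)) = ennreal (pi * (r / 2 ^ k)\<^sup>2)"
      using circle_area[of "r / 2 ^ k" 0] emeasure_lborel_ball_finite[of "0::plane" "r / 2 ^ k"]
        emeasure_eq_ennreal_measure[of lborel "ball (0::plane) (r / 2 ^ k)"] assms
      by (simp add: mult.commute)
    moreover have "?c k * (pi * (r / 2 ^ k)\<^sup>2) = pi * 2 powr q * r powr (2 - q) * \<rho> ^ k"
    proof -
      have "?c k = r powr - q * (2 ^ Suc k) powr q"
        using assms by (simp add: powr_divide powr_minus_divide)
      also have "((2::real) ^ m) powr q = (2 powr q) ^ m" for m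
        by (induction m) (auto simp: powr_mult)
      also have "(2 powr q) ^ Suc k = 2 powr q * (2 powr q) ^ k"
        by simp
      finally have c: "?c k = r powr - q * (2 powr q * (2 powr q) ^ k)" .
      have r2: "(r / 2 ^ k)\<^sup>2 = r powr 2 * (2 powr - 2) ^ k"
      proof -
        have "((2::real) ^ k)\<^sup>2 = 4 ^ k"
          by (simp add: power2_eq_square power_mult_distrib[symmetric])
        moreover have "(2::real) powr - 2 = 1 / 4"
          by (simp add: powr_minus powr_numeral)
        ultimately show ?thesis
          using assms by (simp only: power_divide) (simp add: powr_numeral power_divide)
      qed
      have \<rho>k: "\<rho> ^ k = (2 powr q) ^ k * (2 powr - 2) ^ k"
        by (simp add: \<rho>_def power_mult_distrib[symmetric] powr_add[symmetric])
      have "r powr (2 - q) = r powr - q * r powr 2"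
        by (simp add: powr_add[symmetric])
      then show ?thesis
        unfolding c r2 \<rho>k by (simp only: mult_ac)
    qed
    ultimately show "ennreal (?c k) * emeasure lborel (ball (0::plane) (r / 2 ^ k))
        = ennreal (pi * 2 powr q * r powr (2 - q) * \<rho> ^ k)"
      by (metis ennreal_mult'' pi_ge_zero mult_nonneg_nonneg zero_le_power2)
  qed
  also have "\<dots> = ennreal (\<Sum>k. pi * 2 powr q * r powr (2 - q) * \<rho> ^ k)"
    using \<rho> by (intro suminf_ennreal2) (auto intro!: summable_mult summable_geometric)
  also have "(\<Sum>k. pi * 2 powr q * r powr (2 - q) * \<rho> ^ k) = riesz_const q * r powr (2 - q)"
    using \<rho> by (simp add: suminf_mult summable_geometric suminf_geometric riesz_const_def
        \<rho>_def[symmetric])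
  finally show ?thesis .
qed

text \<open>Young's inequality separates the vorticity from the kernel, whose power \<open>q < 2\<close> is locally
  integrable; as \<open>\<Psi>\<close> preserves the Lebesgue measure, the kernel can be integrated at the points \<open>\<Psi> y\<close>.
  The parameter \<open>\<kappa>\<close> balances the two parts: the vorticity part does not improve with \<open>r\<close>, so that
  \<open>\<kappa>\<close> must be chosen first.\<close>

lemma nn_integral_near_potential:
  fixes \<Psi> :: "plane \<Rightarrow> plane" and w :: "plane \<Rightarrow> real"
  assumes p: "2 < p" and q: "q = p / (p - 1)" and "0 < \<kappa>" "0 < r"
    and \<Psi>: "\<Psi> \<in> measurable lborel lborel" "distr lborel lborel \<Psi> = lborel"
    and w: "w \<in> borel_measurable lborel"
    and P: "(\<integral>\<^sup>+ y. ennreal (\<bar>w y\<bar> powr p) \<partial>lborel) \<le> ennreal P"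
  shows "(\<integral>\<^sup>+ y. ennreal \<bar>w y\<bar> * (indicator (ball z r) (\<Psi> y) * ennreal (1 / norm (z - \<Psi> y))) \<partial>lborel)
    \<le> ennreal (riesz_const q * \<kappa> powr - q * r powr (2 - q)) + ennreal (\<kappa> powr p) * ennreal P"
proof -
  have q': "1 < q" "q < 2" "1 / p + 1 / q = 1" "1 < p"
    using p unfolding q by (simp_all add: field_simps)
  have [measurable]: "\<Psi> \<in> borel_measurable borel" "w \<in> borel_measurable borel"
    using \<Psi> w by auto
  have young: "\<bar>w y\<bar> * (1 / d) \<le> \<kappa> powr p * \<bar>w y\<bar> powr p + \<kappa> powr - q * d powr - q"
    if "0 \<le> d" for y d
  proof -
    have "\<bar>w y\<bar> * (1 / d) = (\<kappa> * \<bar>w y\<bar>) * (1 / (\<kappa> * d))"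
      using \<open>0 < \<kappa>\<close> by simp
    also have "\<dots> \<le> (\<kappa> * \<bar>w y\<bar>) powr p / p + (1 / (\<kappa> * d)) powr q / q"
      using q' that \<open>0 < \<kappa>\<close> by (intro Youngs_inequality) auto
    also have "\<dots> \<le> (\<kappa> * \<bar>w y\<bar>) powr p + (1 / (\<kappa> * d)) powr q"
      using q' by (intro add_mono) (auto simp: divide_le_eq mult_le_cancel_left1 not_less)
    also have "(1 / (\<kappa> * d)) powr q = \<kappa> powr - q * d powr - q"
      using that \<open>0 < \<kappa>\<close> by (simp add: powr_divide powr_mult powr_minus divide_simps)
    finally show ?thesis
      using \<open>0 < \<kappa>\<close> by (simp add: powr_mult)
  qed
  have "(\<integral>\<^sup>+ y. ennreal \<bar>w y\<bar> * (indicator (ball z r) (\<Psi> y) * ennreal (1 / norm (z - \<Psi> y))) \<partial>lborel)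
     \<le> (\<integral>\<^sup>+ y. ennreal (\<kappa> powr - q) * (indicator (ball z r) (\<Psi> y) * ennreal (norm (z - \<Psi> y) powr - q))
          + ennreal (\<kappa> powr p) * ennreal (\<bar>w y\<bar> powr p) \<partial>lborel)"
  proof (intro nn_integral_mono)
    fix y
    have "ennreal \<bar>w y\<bar> * ennreal (1 / norm (z - \<Psi> y)) = ennreal (\<bar>w y\<bar> * (1 / norm (z - \<Psi> y)))"
      by (simp add: ennreal_mult[symmetric])
    also have "\<dots> \<le> ennreal (\<kappa> powr - q * norm (z - \<Psi> y) powr - q + \<kappa> powr p * \<bar>w y\<bar> powr p)"
      using young[of "norm (z - \<Psi> y)" y] by (intro ennreal_leI) simp
    finally show "ennreal \<bar>w y\<bar> * (indicator (ball z r) (\<Psi> y) * ennreal (1 / norm (z - \<Psi> y)))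
        \<le> ennreal (\<kappa> powr - q) * (indicator (ball z r) (\<Psi> y) * ennreal (norm (z - \<Psi> y) powr - q))
          + ennreal (\<kappa> powr p) * ennreal (\<bar>w y\<bar> powr p)"
      by (simp add: ennreal_mult indicator_def)
  qed
  also have "\<dots> = ennreal (\<kappa> powr - q)
        * (\<integral>\<^sup>+ y. indicator (ball z r) (\<Psi> y) * ennreal (norm (z - \<Psi> y) powr - q) \<partial>lborel)
      + ennreal (\<kappa> powr p) * (\<integral>\<^sup>+ y. ennreal (\<bar>w y\<bar> powr p) \<partial>lborel)"
    by (simp add: nn_integral_add nn_integral_cmult)
  also have "(\<integral>\<^sup>+ y. indicator (ball z r) (\<Psi> y) * ennreal (norm (z - \<Psi> y) powr - q) \<partial>lborel)
      = (\<integral>\<^sup>+ y. indicator (ball z r) y * ennreal (norm (z - y) powr - q) \<partial>distr lborel lborel \<Psi>)"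
    using \<Psi>(1) by (intro nn_integral_distr[symmetric]) auto
  also have "\<dots> = (\<integral>\<^sup>+ y. indicator (ball z r) y * ennreal (norm (z - y) powr - q)
      \<partial>distr lborel borel ((+) z))"
    unfolding \<Psi>(2) lborel_distr_plus by simp
  also have "\<dots> = (\<integral>\<^sup>+ (y::plane). indicator (ball 0 r) y * ennreal (norm y powr - q) \<partial>lborel)"
    by (subst nn_integral_distr) (auto intro!: nn_integral_cong simp: indicator_def dist_norm)
  also have "ennreal (\<kappa> powr - q) * \<dots> \<le> ennreal (\<kappa> powr - q) * ennreal (riesz_const q * r powr (2 - q))"
    using q' assms by (intro mult_left_mono nn_integral_riesz_ball) auto
  also have "\<dots> = ennreal (riesz_const q * \<kappa> powr - q * r powr (2 - q))"
    by (simp add: ennreal_mult'[symmetric] mult_ac)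
  finally show ?thesis
    using mult_left_mono[OF P, of "ennreal (\<kappa> powr p)"] by (auto intro: add_mono order_trans)
qed

section \<open>Vorticity at a fixed time\<close>

lemma (in finite_measure) integral_square_le:
  fixes f :: "'a \<Rightarrow> real"
  assumes "integrable M f" "integrable M (\<lambda>x. (f x)\<^sup>2)"
  shows "(\<integral>x. f x \<partial>M)\<^sup>2 \<le> measure M (space M) * (\<integral>x. (f x)\<^sup>2 \<partial>M)"
proof (cases "measure M (space M) = 0")
  case True
  then have "emeasure M (space M) = 0"
    by (simp add: emeasure_eq_measure)
  then have "AE x in M. f x = 0"
    by (intro AE_I[of _ _ "space M"]) auto
  then have "(\<integral>x. f x \<partial>M) = (\<integral>x. 0 \<partial>M)"
    using assms by (intro integral_cong_AE) auto
  then show ?thesis by (simp add: True)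
next
  case False
  then have m: "0 < measure M (space M)" by (simp add: less_le)
  define c where "c = (\<integral>x. f x \<partial>M) / measure M (space M)"
  have "0 \<le> (\<integral>x. (f x - c)\<^sup>2 \<partial>M)"
    by simp
  also have "\<dots> = (\<integral>x. (f x)\<^sup>2 - 2 * c * f x + c\<^sup>2 \<partial>M)"
    by (simp add: power2_diff algebra_simps)
  also have "\<dots> = (\<integral>x. (f x)\<^sup>2 \<partial>M) - 2 * c * (\<integral>x. f x \<partial>M) + c\<^sup>2 * measure M (space M)"
    using assms by simp
  also have "\<dots> = (\<integral>x. (f x)\<^sup>2 \<partial>M) - (\<integral>x. f x \<partial>M)\<^sup>2 / measure M (space M)"
    using m by (simp add: c_def power2_eq_square field_simps)
  finally show ?thesis
    using m by (simp add: field_simps)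
qed

lemma finite_measure_integrable_bound:
  fixes f :: "'a \<Rightarrow> 'b::{banach, second_countable_topology}"
  assumes "finite_measure M" "f \<in> borel_measurable M" "AE x in M. norm (f x) \<le> B"
  shows "integrable M f"
  using assms by (intro finite_measure.integrable_const_bound)

abbreviation weight :: "real \<Rightarrow> plane \<Rightarrow> real" where
  "weight \<theta> z \<equiv> exp (\<theta> * (norm z)\<^sup>2)"

abbreviation weight_grad :: "real \<Rightarrow> plane \<Rightarrow> plane" where
  "weight_grad \<theta> z \<equiv> (2 * \<theta> * weight \<theta> z) *\<^sub>R z"

locale vorticity = finite_measure \<nu> for \<nu> :: "plane measure" +
  fixes P :: real
  assumes sets_eq [measurable_cong]: "sets \<nu> = sets borel"
    and potential_le: "(\<integral>\<^sup>+ y. ennreal (1 / norm (x - y)) \<partial>\<nu>) \<le> ennreal P"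
begin

abbreviation velocity :: "plane \<Rightarrow> plane" where
  "velocity x \<equiv> \<integral>y. BS_kernel (x - y) \<partial>\<nu>"

lemma space_eq [simp]: "space \<nu> = UNIV"
  using sets_eq_imp_space_eq[OF sets_eq] by simp

lemma nn_integral_BS_kernel_le: "(\<integral>\<^sup>+ y. ennreal (norm (BS_kernel (x - y))) \<partial>\<nu>) \<le> ennreal P"
  by (rule order_trans[OF nn_integral_mono potential_le[of x]])
    (auto intro: ennreal_leI norm_BS_kernel_le_inverse)

lemma integrable_BS_kernel: "integrable \<nu> (\<lambda>y. BS_kernel (x - y))"
proof (rule integrableI_bounded)
  show "(\<integral>\<^sup>+ y. ennreal (norm (BS_kernel (x - y))) \<partial>\<nu>) < \<infinity>"
    using le_less_trans[OF nn_integral_BS_kernel_le[of x] ennreal_less_top] by simp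
qed measurable

lemma norm_velocity_le: "norm (velocity x) \<le> max 0 P"
proof -
  have "ennreal (norm (velocity x)) \<le> ennreal P"
    by (rule order_trans[OF integral_norm_bound_ennreal[OF integrable_BS_kernel] nn_integral_BS_kernel_le])
  then have "norm (velocity x) \<le> max 0 P"
    by (metis ennreal_le_iff2 max.coboundedI1 max.coboundedI2)
  then show ?thesis .
qed

lemma velocity_measurable [measurable]: "velocity \<in> borel_measurable borel"
proof -
  have "(\<lambda>x. \<integral>y. BS_kernel (x - y) \<partial>\<nu>) \<in> borel_measurable borel"
    by (rule borel_measurable_lebesgue_integral) measurable
  then show ?thesis .
qed

text \<open>Since the kernel is odd, an integral of the velocity against a vector field only involves
  the differences of the field, which compensate the singularity.\<close>

lemma integral_inner_velocity_le:
  fixes g :: "plane \<Rightarrow> plane" and b :: "plane \<Rightarrow> plane \<Rightarrow> real"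
  assumes [measurable]: "g \<in> borel_measurable borel"
    and g: "AE x in \<nu>. norm (g x) \<le> B"
    and A: "AE x in \<nu>. x \<in> A"
    and b: "\<And>x y. x \<in> A \<Longrightarrow> y \<in> A \<Longrightarrow> (g x - g y) \<bullet> BS_kernel (x - y) \<le> b x y"
    and int: "\<And>x. x \<in> A \<Longrightarrow> integrable \<nu> (b x)" "integrable \<nu> (\<lambda>x. \<integral>y. b x y \<partial>\<nu>)"
  shows "(\<integral>x. g x \<bullet> velocity x \<partial>\<nu>) \<le> (\<integral>x. (\<integral>y. b x y \<partial>\<nu>) \<partial>\<nu>) / 2"
proof -
  note sf = sigma_finite_measure_axioms
  interpret pair_sigma_finite \<nu> \<nu> ..
  define h where "h = (\<lambda>x y. g x \<bullet> BS_kernel (x - y))"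
  have h_meas [measurable]: "case_prod h \<in> borel_measurable (\<nu> \<Otimes>\<^sub>M \<nu>)"
    unfolding h_def by measurable
  have h_le: "norm (h x y) \<le> norm (g x) * norm (BS_kernel (x - y))" for x y
    unfolding h_def by (simp add: Cauchy_Schwarz_ineq2)
  have h_int: "integrable (\<nu> \<Otimes>\<^sub>M \<nu>) (case_prod h)"
  proof (rule integrableI_bounded[OF h_meas])
    have "(\<integral>\<^sup>+ z. ennreal (norm (case_prod h z)) \<partial>(\<nu> \<Otimes>\<^sub>M \<nu>)) = (\<integral>\<^sup>+ x. \<integral>\<^sup>+ y. ennreal (norm (h x y)) \<partial>\<nu> \<partial>\<nu>)"
      using sigma_finite_measure.nn_integral_fst[OF sf, of "\<lambda>z. ennreal (norm (case_prod h z))" \<nu>] by simp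
    also have "\<dots> \<le> (\<integral>\<^sup>+ x. ennreal B * ennreal P \<partial>\<nu>)"
    proof (rule nn_integral_mono_AE, use g in eventually_elim)
      case (elim x)
      have "(\<integral>\<^sup>+ y. ennreal (norm (h x y)) \<partial>\<nu>)
          \<le> (\<integral>\<^sup>+ y. ennreal B * ennreal (norm (BS_kernel (x - y))) \<partial>\<nu>)"
      proof (rule nn_integral_mono)
        fix y
        have "0 \<le> B" using elim norm_ge_zero[of "g x"] by linarith
        have "norm (h x y) \<le> B * norm (BS_kernel (x - y))"
          using h_le[of x y] mult_right_mono[OF elim, of "norm (BS_kernel (x - y))"] by simp
        then show "ennreal (norm (h x y)) \<le> ennreal B * ennreal (norm (BS_kernel (x - y)))"
          using \<open>0 \<le> B\<close> by (simp add: ennreal_mult[symmetric] ennreal_leI)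
      qed
      also have "\<dots> \<le> ennreal B * ennreal P"
        by (simp add: nn_integral_cmult mult_left_mono nn_integral_BS_kernel_le)
      finally show ?case .
    qed
    also have "\<dots> < \<infinity>"
      by (simp add: ennreal_mult_less_top emeasure_eq_measure)
    finally show "(\<integral>\<^sup>+ z. ennreal (norm (case_prod h z)) \<partial>(\<nu> \<Otimes>\<^sub>M \<nu>)) < \<infinity>" .
  qed
  have inner1: "integrable \<nu> (h x)" for x
    unfolding h_def by (intro integrable_inner_right integrable_BS_kernel)
  have inner2: "integrable \<nu> (\<lambda>y. h y x)" for x
  proof (rule Bochner_Integration.integrable_bound)
    show "integrable \<nu> (\<lambda>y. B * norm (BS_kernel (x - y)))"
      by (intro integrable_mult_right integrable_norm integrable_BS_kernel)
    show "AE y in \<nu>. norm (h y x) \<le> norm (B * norm (BS_kernel (x - y)))"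
      using g
    proof eventually_elim
      case (elim y)
      have "norm (h y x) \<le> B * norm (BS_kernel (y - x))"
        using h_le[of y x] mult_right_mono[OF elim, of "norm (BS_kernel (y - x))"] by simp
      also have "\<dots> \<le> norm (B * norm (BS_kernel (x - y)))"
        by (auto simp: norm_BS_kernel norm_minus_commute intro!: divide_right_mono)
      finally show ?case .
    qed
    show "(\<lambda>y. h y x) \<in> borel_measurable \<nu>"
      unfolding h_def by measurable
  qed
  have eq1: "(\<integral>x. g x \<bullet> velocity x \<partial>\<nu>) = (\<integral>x. \<integral>y. h x y \<partial>\<nu> \<partial>\<nu>)"
    unfolding h_def by (intro Bochner_Integration.integral_cong refl integral_inner_right[symmetric]
        integrable_BS_kernel)
  have "(\<integral>x. \<integral>y. h x y \<partial>\<nu> \<partial>\<nu>) = (\<integral>x. \<integral>y. h y x \<partial>\<nu> \<partial>\<nu>)"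
    using Fubini_integral[OF h_int] by simp
  then have "2 * (\<integral>x. g x \<bullet> velocity x \<partial>\<nu>) = (\<integral>x. \<integral>y. h x y \<partial>\<nu> \<partial>\<nu>) + (\<integral>x. \<integral>y. h y x \<partial>\<nu> \<partial>\<nu>)"
    using eq1 by simp
  also have "\<dots> = (\<integral>x. (\<integral>y. h x y \<partial>\<nu>) + (\<integral>y. h y x \<partial>\<nu>) \<partial>\<nu>)"
    using integrable_fst[OF h_int] integrable_snd[OF h_int]
    by (intro Bochner_Integration.integral_add[symmetric]) auto
  also have "\<dots> = (\<integral>x. (\<integral>y. h x y + h y x \<partial>\<nu>) \<partial>\<nu>)"
    by (intro Bochner_Integration.integral_cong refl Bochner_Integration.integral_add[symmetric] inner1 inner2)
  also have "\<dots> \<le> (\<integral>x. (\<integral>y. b x y \<partial>\<nu>) \<partial>\<nu>)"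
  proof (rule integral_mono_AE)
    show "integrable \<nu> (\<lambda>x. \<integral>y. h x y + h y x \<partial>\<nu>)"
      using Bochner_Integration.integrable_add[OF integrable_fst[OF h_int] integrable_snd[OF h_int]]
      by (simp add: Bochner_Integration.integral_add[OF inner1 inner2])
    show "AE x in \<nu>. (\<integral>y. h x y + h y x \<partial>\<nu>) \<le> (\<integral>y. b x y \<partial>\<nu>)"
      using A
    proof eventually_elim
      case (elim x)
      have "AE y in \<nu>. h x y + h y x \<le> b x y"
        using A
      proof eventually_elim
        case (elim y)
        have "h y x = - (g y \<bullet> BS_kernel (x - y))"
          using BS_kernel_minus[of "x - y"] by (simp add: h_def)
        then have "h x y + h y x = (g x - g y) \<bullet> BS_kernel (x - y)"
          by (simp add: h_def inner_diff_left)
        then show ?case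
          using b[OF \<open>x \<in> A\<close> elim] by simp
      qed
      then show ?case
        by (intro integral_mono_AE int \<open>x \<in> A\<close> Bochner_Integration.integrable_add inner1 inner2)
    qed
  qed (rule int)
  finally show ?thesis by simp
qed

lemma abs_integral_inner_velocity_le:
  fixes g :: "plane \<Rightarrow> plane" and b :: "plane \<Rightarrow> plane \<Rightarrow> real"
  assumes g: "g \<in> borel_measurable borel" "AE x in \<nu>. norm (g x) \<le> B"
    and A: "AE x in \<nu>. x \<in> A"
    and b: "\<And>x y. x \<in> A \<Longrightarrow> y \<in> A \<Longrightarrow> \<bar>(g x - g y) \<bullet> BS_kernel (x - y)\<bar> \<le> b x y"
    and int: "\<And>x. x \<in> A \<Longrightarrow> integrable \<nu> (b x)" "integrable \<nu> (\<lambda>x. \<integral>y. b x y \<partial>\<nu>)"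
  shows "\<bar>\<integral>x. g x \<bullet> velocity x \<partial>\<nu>\<bar> \<le> (\<integral>x. (\<integral>y. b x y \<partial>\<nu>) \<partial>\<nu>) / 2"
proof -
  have "(\<integral>x. g x \<bullet> velocity x \<partial>\<nu>) \<le> (\<integral>x. (\<integral>y. b x y \<partial>\<nu>) \<partial>\<nu>) / 2"
    using b by (intro integral_inner_velocity_le[OF g A _ int]) (auto simp: abs_le_iff)
  moreover have "(\<integral>x. - g x \<bullet> velocity x \<partial>\<nu>) \<le> (\<integral>x. (\<integral>y. b x y \<partial>\<nu>) \<partial>\<nu>) / 2"
  proof (rule integral_inner_velocity_le[OF _ _ A _ int])
    show "(- g x - - g y) \<bullet> BS_kernel (x - y) \<le> b x y" if "x \<in> A" "y \<in> A" for x y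
    proof -
      have "(- g x - - g y) \<bullet> BS_kernel (x - y) = - ((g x - g y) \<bullet> BS_kernel (x - y))"
        by (simp add: inner_diff_left)
      then show ?thesis using b[OF that] by linarith
    qed
  qed (use g in auto)
  ultimately show ?thesis by simp
qed

text \<open>A vorticity does not move its own center, nor does it change its own second moment about
  any point.\<close>

lemma integral_inner_shift_velocity:
  assumes "AE x in \<nu>. norm x \<le> B"
  shows "(\<integral>x. (x - c) \<bullet> velocity x \<partial>\<nu>) = 0"
proof -
  have "\<bar>\<integral>x. (x - c) \<bullet> velocity x \<partial>\<nu>\<bar> \<le> (\<integral>x. (\<integral>(y::plane). (0::real) \<partial>\<nu>) \<partial>\<nu>) / 2"
  proof (rule abs_integral_inner_velocity_le[where A = UNIV and b = "\<lambda>_ _. 0"])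
    show "AE x in \<nu>. norm (x - c) \<le> B + norm c"
      using assms by eventually_elim (rule order_trans[OF norm_triangle_ineq4], simp)
  qed (simp_all add: inner_BS_kernel_self)
  then show ?thesis by simp
qed

lemma integrable_velocity: "integrable \<nu> velocity"
  by (rule finite_measure_integrable_bound[where B = "max 0 P"])
    (unfold_locales, measurable, simp add: norm_velocity_le)

lemma integral_velocity_eq_0: "(\<integral>x. velocity x \<partial>\<nu>) = 0"
proof -
  have "\<bar>e \<bullet> (\<integral>x. velocity x \<partial>\<nu>)\<bar> \<le> 0" for e
  proof -
    have "\<bar>\<integral>x. e \<bullet> velocity x \<partial>\<nu>\<bar> \<le> (\<integral>x. (\<integral>(y::plane). (0::real) \<partial>\<nu>) \<partial>\<nu>) / 2"
      by (rule abs_integral_inner_velocity_le[where A = UNIV and b = "\<lambda>_ _. 0" and B = "norm e"]) simp_all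
    then show ?thesis
      using integral_inner_right[OF integrable_velocity, of e] by simp
  qed
  then show ?thesis
    by (metis abs_le_zero_iff inner_eq_zero_iff)
qed

text \<open>The symmetrized integrand for the gradient of \<^const>\<open>weight\<close> in a disc of radius \<open>2 R\<close>.  As
  \<open>x \<bullet> perp y\<close> vanishes on the diagonal, it cancels one factor of the squared distance in the
  denominator.  For close points the other factor is cancelled by the difference of the weights,
  at the price of a second factor \<open>\<theta>\<close>; for points at distance at least \<open>R / 4\<close> one factor \<open>\<theta>\<close>
  suffices.\<close>

lemma exp_weight_kernel_le:
  fixes x y :: plane
  assumes "0 \<le> \<theta>" "0 < R" "norm x \<le> 2 * R" "norm y \<le> 2 * R"
  defines "W \<equiv> \<lambda>z::plane. exp (\<theta> * (norm z)\<^sup>2)"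
  defines "I \<equiv> ((2 * \<theta> * W x) *\<^sub>R x - (2 * \<theta> * W y) *\<^sub>R y) \<bullet> BS_kernel (x - y)"
  shows "\<bar>I\<bar> \<le> 3 * \<theta>\<^sup>2 * R\<^sup>2 * max (W x) (W y)"
    and "R / 4 \<le> norm (x - y) \<Longrightarrow> \<bar>I\<bar> \<le> 3 * \<theta> * max (W x) (W y)"
proof -
  define d where "d = norm (x - y)"
  have Wpos: "0 < W z" for z by (simp add: W_def)
  have mx: "0 < max (W x) (W y)" using Wpos[of x] by (simp add: less_max_iff_disj)
  have "x \<bullet> BS_kernel (x - y) = - (x \<bullet> perp y) / (2 * pi * d\<^sup>2)"
    by (simp add: inner_BS_kernel_diff d_def)
  moreover have "y \<bullet> BS_kernel (x - y) = - (x \<bullet> perp y) / (2 * pi * d\<^sup>2)"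
    using inner_BS_kernel_diff[of y x] BS_kernel_minus[of "x - y"] inner_perp_flip[of y x]
    by (simp add: d_def norm_minus_commute)
  ultimately have I: "I = (2 * \<theta> * (W x - W y)) * (- (x \<bullet> perp y) / (2 * pi * d\<^sup>2))"
    unfolding I_def inner_diff_left inner_scaleR_left by (simp only: left_diff_distrib right_diff_distrib)
  have "x \<bullet> perp y = (x - y) \<bullet> perp y"
    by (simp add: inner_diff_left)
  then have xy: "\<bar>x \<bullet> perp y\<bar> \<le> d * (2 * R)"
    using Cauchy_Schwarz_ineq2[of "x - y" "perp y"] assms(4) mult_left_mono[of "norm y" "2 * R" d]
    by (simp add: d_def)
  have "\<bar>I\<bar> = 2 * \<theta> * \<bar>W x - W y\<bar> * (\<bar>x \<bullet> perp y\<bar> / (2 * pi * d\<^sup>2))"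
    using assms(1) pi_gt_zero by (simp add: I abs_mult)
  also have "\<dots> \<le> 2 * \<theta> * \<bar>W x - W y\<bar> * (d * (2 * R) / (2 * pi * d\<^sup>2))"
    using xy assms(1) pi_gt_zero by (intro mult_left_mono divide_right_mono) auto
  also have "\<dots> = 2 * \<theta> * R * (\<bar>W x - W y\<bar> / d) / pi"
    by (cases "d = 0") (simp_all add: power2_eq_square field_simps)
  finally have key: "\<bar>I\<bar> \<le> 2 * \<theta> * R * (\<bar>W x - W y\<bar> / d) / pi"
    by simp
  have finish: "2 * \<theta> * R * c / pi \<le> t" if "2 * \<theta> * R * c \<le> 3 * t" "0 \<le> t" for c t
    using that pi_gt3 mult_right_mono[of 3 pi t] by (simp add: divide_le_eq mult.commute)
  show "\<bar>I\<bar> \<le> 3 * \<theta> * max (W x) (W y)" if "R / 4 \<le> norm (x - y)"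
  proof -
    have d: "R / 4 \<le> d" "0 < d" using that assms(2) by (auto simp: d_def)
    have "\<bar>W x - W y\<bar> \<le> max (W x) (W y)"
      using Wpos[of x] Wpos[of y] by auto
    then have "\<bar>W x - W y\<bar> / d \<le> max (W x) (W y) / (R / 4)"
      using d assms(2) mx by (intro frac_le) auto
    then have "2 * \<theta> * R * (\<bar>W x - W y\<bar> / d) \<le> 2 * \<theta> * R * (max (W x) (W y) / (R / 4))"
      using assms(1,2) by (intro mult_left_mono) auto
    also have "\<dots> = 8 * \<theta> * max (W x) (W y)"
      using assms(2) by (simp add: field_simps)
    also have "\<dots> \<le> 3 * (3 * \<theta> * max (W x) (W y))"
      using assms(1) mx by (simp add: mult_right_mono)
    finally show ?thesis
      using key finish assms(1) mx by (meson less_imp_le mult_nonneg_nonneg order_trans zero_le_numeral)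
  qed
  have mean: "exp a - exp b \<le> (a - b) * exp a" for a b :: real
    using mult_right_mono[OF exp_ge_add_one_self[of "b - a"], of "exp a"]
    by (simp add: algebra_simps flip: exp_add)
  have norms: "\<bar>(norm x)\<^sup>2 - (norm y)\<^sup>2\<bar> \<le> d * (4 * R)"
  proof -
    have "\<bar>(norm x)\<^sup>2 - (norm y)\<^sup>2\<bar> = \<bar>norm x - norm y\<bar> * (norm x + norm y)"
      by (simp add: power2_eq_square square_diff_square_factored abs_mult mult.commute)
    also have "\<dots> \<le> d * (4 * R)"
      using norm_triangle_ineq3[of x y] assms(3,4) by (intro mult_mono) (auto simp: d_def)
    finally show ?thesis .
  qed
  have "\<bar>W x - W y\<bar> \<le> \<theta> * (d * (4 * R)) * max (W x) (W y)"
  proof -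
    have one: "W u - W v \<le> \<theta> * (d * (4 * R)) * max (W x) (W y)"
      if "(u, v) = (x, y) \<or> (u, v) = (y, x)" for u v
    proof -
      have "W u - W v \<le> (\<theta> * ((norm u)\<^sup>2 - (norm v)\<^sup>2)) * W u"
        using mean[of "\<theta> * (norm u)\<^sup>2" "\<theta> * (norm v)\<^sup>2"] by (simp add: W_def right_diff_distrib)
      also have "\<dots> \<le> (\<theta> * (d * (4 * R))) * max (W x) (W y)"
        using norms that assms(1,2) Wpos[of u] by (intro mult_mono mult_left_mono) (auto simp: d_def)
      finally show ?thesis .
    qed
    show ?thesis
      using one[of x y] one[of y x] by (simp add: abs_le_iff)
  qed
  then have "\<bar>W x - W y\<bar> / d \<le> \<theta> * (4 * R) * max (W x) (W y)"
    using assms(1,2) mx by (cases "d = 0") (auto simp: d_def divide_le_eq algebra_simps)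
  then have "2 * \<theta> * R * (\<bar>W x - W y\<bar> / d) \<le> 2 * \<theta> * R * (\<theta> * (4 * R) * max (W x) (W y))"
    using assms(1,2) by (intro mult_left_mono) auto
  also have "\<dots> = 8 * (\<theta>\<^sup>2 * R\<^sup>2 * max (W x) (W y))"
    by (simp add: power2_eq_square)
  also have "\<dots> \<le> 3 * (3 * \<theta>\<^sup>2 * R\<^sup>2 * max (W x) (W y))"
    using mx by simp
  finally show "\<bar>I\<bar> \<le> 3 * \<theta>\<^sup>2 * R\<^sup>2 * max (W x) (W y)"
    using key finish mx by (meson less_imp_le mult_nonneg_nonneg order_trans zero_le_numeral zero_le_power2)
qed

text \<open>Large \<open>\<theta>\<close> is harmless if each of the terms with \<open>\<theta>\<^sup>2\<close> is compensated: pairs in the inner disc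
  of radius \<open>R / 2\<close> carry a weight that is exponentially smaller than the weights further out, and
  for pairs outside of the disc of radius \<open>R / 4\<close> there is the small factor \<open>m\<close>.  All other pairs
  are distant.\<close>

lemma abs_integral_exp_weight_velocity_le:
  assumes "0 \<le> \<theta>" "0 < R" and supp: "AE x in \<nu>. norm x \<le> 2 * R"
  defines "W \<equiv> \<lambda>z::plane. exp (\<theta> * (norm z)\<^sup>2)"
  defines "M \<equiv> measure \<nu> UNIV" and "E \<equiv> (\<integral>x. W x \<partial>\<nu>)" and "m \<equiv> measure \<nu> {x. R / 4 \<le> norm x}"
  shows "\<bar>\<integral>x. ((2 * \<theta> * W x) *\<^sub>R x) \<bullet> velocity x \<partial>\<nu>\<bar>
    \<le> 3 * \<theta>\<^sup>2 * R\<^sup>2 * exp (\<theta> * R\<^sup>2 / 4) * M\<^sup>2 + 3 * \<theta>\<^sup>2 * R\<^sup>2 * m * E + 3 * \<theta> * M * E"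
proof -
  define S where "S = {x::plane. R / 4 \<le> norm x}"
  define J where "J = (\<lambda>x. indicator S x :: real)"
  define c0 c1 c2 where "c0 = 3 * \<theta>\<^sup>2 * R\<^sup>2 * exp (\<theta> * R\<^sup>2 / 4)" and "c1 = 3 * \<theta>\<^sup>2 * R\<^sup>2" and "c2 = 3 * \<theta>"
  define b where "b = (\<lambda>x y. c0 + c1 * (J y * W x + J x * W y) + c2 * (W x + W y))"
  have c: "0 \<le> c0" "0 \<le> c1" "0 \<le> c2"
    using assms(1) by (auto simp: c0_def c1_def c2_def)
  have [measurable]: "W \<in> borel_measurable borel"
    unfolding W_def by measurable
  have S [measurable]: "S \<in> sets borel"
    unfolding S_def by measurable
  have WI: "integrable \<nu> W"
  proof (rule finite_measure_integrable_bound[where B = "exp (\<theta> * (2 * R)\<^sup>2)"])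
    show "AE x in \<nu>. norm (W x) \<le> exp (\<theta> * (2 * R)\<^sup>2)"
      using supp
      by eventually_elim (use power_mono[of "norm _" "2 * R" 2] in \<open>auto simp: W_def intro!: mult_left_mono assms(1)\<close>)
  qed (unfold_locales, measurable)
  have JI: "integrable \<nu> J"
    unfolding J_def by (intro integrable_real_indicator) (auto simp: S emeasure_eq_measure sets_eq)
  have intJ: "(\<integral>x. J x \<partial>\<nu>) = m"
    unfolding J_def m_def S_def by simp
  have Wpos: "0 < W z" for z by (simp add: W_def)
  have bx: "(\<integral>y. b x y \<partial>\<nu>) = c0 * M + c1 * (m * W x + J x * E) + c2 * (M * W x + E)" for x
    unfolding b_def using WI JI by (simp add: intJ M_def E_def)
  have "\<bar>\<integral>x. ((2 * \<theta> * W x) *\<^sub>R x) \<bullet> velocity x \<partial>\<nu>\<bar> \<le> (\<integral>x. (\<integral>y. b x y \<partial>\<nu>) \<partial>\<nu>) / 2"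
  proof (rule abs_integral_inner_velocity_le[where A = "{x. norm x \<le> 2 * R}"])
    show "AE x in \<nu>. norm ((2 * \<theta> * W x) *\<^sub>R x) \<le> 2 * \<theta> * exp (\<theta> * (2 * R)\<^sup>2) * (2 * R)"
      using supp
    proof eventually_elim
      case (elim x)
      have "W x \<le> exp (\<theta> * (2 * R)\<^sup>2)"
        using power_mono[OF elim, of 2] by (auto simp: W_def intro!: mult_left_mono assms(1))
      then have "2 * \<theta> * W x * norm x \<le> 2 * \<theta> * exp (\<theta> * (2 * R)\<^sup>2) * (2 * R)"
        using elim assms(1,2) Wpos[of x] by (intro mult_mono mult_left_mono) auto
      then show ?case
        using assms(1) Wpos[of x] by simp
    qed
    show "AE x in \<nu>. x \<in> {x. norm x \<le> 2 * R}"
      using supp by simp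
    show "integrable \<nu> (b x)" for x
      unfolding b_def using WI JI by simp
    show "integrable \<nu> (\<lambda>x. \<integral>y. b x y \<partial>\<nu>)"
      unfolding bx using WI JI by simp
    fix x y :: plane assume xy: "x \<in> {x. norm x \<le> 2 * R}" "y \<in> {x. norm x \<le> 2 * R}"
    let ?I = "\<bar>((2 * \<theta> * W x) *\<^sub>R x - (2 * \<theta> * W y) *\<^sub>R y) \<bullet> BS_kernel (x - y)\<bar>"
    have le: "?I \<le> 3 * \<theta>\<^sup>2 * R\<^sup>2 * max (W x) (W y)"
      "R / 4 \<le> norm (x - y) \<Longrightarrow> ?I \<le> 3 * \<theta> * max (W x) (W y)"
      using exp_weight_kernel_le[OF assms(1,2), of x y] xy by (simp_all only: W_def mem_Collect_eq)
    have nonneg: "0 \<le> c1 * (J y * W x + J x * W y)" "0 \<le> c2 * (W x + W y)"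
      using c Wpos by (auto simp: J_def intro!: mult_nonneg_nonneg add_nonneg_nonneg less_imp_le[OF Wpos])
    consider "norm x < R / 2 \<and> norm y < R / 2" | "R / 4 \<le> norm x \<and> R / 4 \<le> norm y" | "R / 4 \<le> norm (x - y)"
    proof -
      have "R / 4 \<le> norm (x - y)" if "R / 2 \<le> norm x" "norm y < R / 4"
        using norm_triangle_ineq2[of x y] that by linarith
      moreover have "R / 4 \<le> norm (x - y)" if "R / 2 \<le> norm y" "norm x < R / 4"
        using norm_triangle_ineq3[of x y] that by linarith
      ultimately show ?thesis using that \<open>0 < R\<close> by linarith
    qed
    then show "?I \<le> b x y"
    proof cases
      case 1
      have "W z \<le> exp (\<theta> * R\<^sup>2 / 4)" if "norm z < R / 2" for z
      proof -
        have "(norm z)\<^sup>2 \<le> (R / 2)\<^sup>2" using that by (intro power_mono) auto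
        then show ?thesis
          using mult_left_mono[OF _ assms(1), of "(norm z)\<^sup>2" "R\<^sup>2 / 4"] by (simp add: W_def power_divide)
      qed
      then have "3 * \<theta>\<^sup>2 * R\<^sup>2 * max (W x) (W y) \<le> c0"
        unfolding c0_def using 1 by (intro mult_left_mono) auto
      then show ?thesis
        using le(1) nonneg by (simp add: b_def)
    next
      case 2
      have "3 * \<theta>\<^sup>2 * R\<^sup>2 * max (W x) (W y) \<le> c1 * (W x + W y)"
        unfolding c1_def using Wpos[of x] Wpos[of y] by (intro mult_left_mono) auto
      also have "W x + W y = J y * W x + J x * W y"
        using 2 by (simp add: J_def S_def)
      finally show ?thesis
        using le(1) nonneg c by (simp add: b_def)
    next
      case 3
      have "3 * \<theta> * max (W x) (W y) \<le> c2 * (W x + W y)"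
        unfolding c2_def using Wpos[of x] Wpos[of y] assms(1) by (intro mult_left_mono) auto
      then show ?thesis
        using le(2) 3 nonneg c by (simp add: b_def)
    qed
  qed measurable
  also have "(\<integral>x. (\<integral>y. b x y \<partial>\<nu>) \<partial>\<nu>) = c0 * M\<^sup>2 + 2 * c1 * m * E + 2 * c2 * M * E"
    unfolding bx using WI JI
    by (simp add: intJ M_def[symmetric] E_def[symmetric] power2_eq_square algebra_simps)
  also have "(c0 * M\<^sup>2 + 2 * c1 * m * E + 2 * c2 * M * E) / 2 \<le> c0 * M\<^sup>2 + c1 * m * E + c2 * M * E"
    using c by (simp add: add_divide_distrib)
  finally show ?thesis
    by (simp add: c0_def c1_def c2_def)
qed

text \<open>The vorticity is split into the bulk, which has distance \<open>d\<close> from \<open>x\<close>, the small remaining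
  mass on \<open>S\<close>, as far as it has distance \<open>r\<close> from \<open>x\<close>, and the part within distance \<open>r\<close>.\<close>

lemma norm_velocity_le_split:
  assumes "0 < d" "0 < r" "0 \<le> H" and [measurable]: "S \<in> sets borel"
    and S: "\<And>y. y \<notin> S \<Longrightarrow> d \<le> norm (x - y)"
    and near: "(\<integral>\<^sup>+ y. indicator (ball x r) y * ennreal (1 / norm (x - y)) \<partial>\<nu>) \<le> ennreal H"
  shows "norm (velocity x) \<le> measure \<nu> UNIV / (6 * d) + measure \<nu> S / r + H"
proof -
  have "ennreal (norm (velocity x)) \<le> (\<integral>\<^sup>+ y. ennreal (norm (BS_kernel (x - y))) \<partial>\<nu>)"
    by (rule integral_norm_bound_ennreal[OF integrable_BS_kernel])
  also have "\<dots> \<le> (\<integral>\<^sup>+ y. ennreal (1 / (6 * d)) + (ennreal (1 / r) * indicator S y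
      + indicator (ball x r) y * ennreal (1 / norm (x - y))) \<partial>\<nu>)"
  proof (rule nn_integral_mono)
    fix y
    consider "y \<notin> S" | "y \<in> S" "y \<notin> ball x r" | "y \<in> ball x r"
      by blast
    then show "ennreal (norm (BS_kernel (x - y))) \<le> ennreal (1 / (6 * d)) + (ennreal (1 / r) * indicator S y
      + indicator (ball x r) y * ennreal (1 / norm (x - y)))"
    proof cases
      case 1
      then have "ennreal (norm (BS_kernel (x - y))) \<le> ennreal (1 / (6 * d))"
        using S assms(1) by (intro ennreal_leI norm_BS_kernel_le) auto
      then show ?thesis by (rule order_trans) simp
    next
      case 2
      then have "norm (BS_kernel (x - y)) \<le> 1 / r"
        using norm_BS_kernel_le[of r "x - y"] assms(2)
        by (auto simp: dist_norm intro: order_trans[OF _ frac_le[of 1 1 r "6 * r"]])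
      then have "ennreal (norm (BS_kernel (x - y))) \<le> ennreal (1 / r) * indicator S y"
        using 2 by (simp add: ennreal_leI)
      also have "\<dots> \<le> ennreal (1 / (6 * d)) + (ennreal (1 / r) * indicator S y
          + indicator (ball x r) y * ennreal (1 / norm (x - y)))"
        by (rule add_increasing[OF zero_le add_increasing2[OF zero_le order_refl]])
      finally show ?thesis .
    next
      case 3
      then have "ennreal (norm (BS_kernel (x - y))) \<le> indicator (ball x r) y * ennreal (1 / norm (x - y))"
        using norm_BS_kernel_le_inverse[of "x - y"] by (simp add: ennreal_leI)
      also have "\<dots> \<le> ennreal (1 / (6 * d)) + (ennreal (1 / r) * indicator S y
          + indicator (ball x r) y * ennreal (1 / norm (x - y)))"
        by (rule add_increasing[OF zero_le add_increasing[OF zero_le order_refl]])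
      finally show ?thesis .
    qed
  qed
  also have "\<dots> = ennreal (1 / (6 * d)) * emeasure \<nu> UNIV + (ennreal (1 / r) * emeasure \<nu> S
      + (\<integral>\<^sup>+ y. indicator (ball x r) y * ennreal (1 / norm (x - y)) \<partial>\<nu>))"
  proof -
    have m1: "(\<lambda>y. ennreal (1 / r) * indicator S y) \<in> borel_measurable \<nu>"
      by measurable
    have m2: "(\<lambda>y. indicator (ball x r) y * ennreal (1 / norm (x - y))) \<in> borel_measurable \<nu>"
      by measurable
    have "S \<in> sets \<nu>" by (simp add: sets_eq)
    then show ?thesis
      using nn_integral_add[OF m1 m2] nn_integral_add[OF borel_measurable_const borel_measurable_add[OF m1 m2],
          of "ennreal (1 / (6 * d))"] nn_integral_cmult_indicator[of S \<nu> "ennreal (1 / r)"]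
      by (simp only: nn_integral_const space_eq)
  qed
  also have "\<dots> \<le> ennreal (1 / (6 * d)) * emeasure \<nu> UNIV + (ennreal (1 / r) * emeasure \<nu> S + ennreal H)"
    by (intro add_mono order_refl near)
  also have "\<dots> = ennreal (measure \<nu> UNIV / (6 * d) + measure \<nu> S / r + H)"
    using assms(1-3) by (simp add: emeasure_eq_measure ennreal_mult[symmetric] ennreal_plus[symmetric]
        del: ennreal_plus)
  finally show ?thesis
    using assms(1-3) by (subst (asm) ennreal_le_iff) auto
qed

end

section \<open>Vortices transported by their own flow\<close>

lemma has_vector_derivative_norm_square:
  fixes f :: "real \<Rightarrow> 'a::real_inner"
  assumes "(f has_vector_derivative f') (at t within S)"
  shows "((\<lambda>t. (norm (f t))\<^sup>2) has_vector_derivative 2 * (f t \<bullet> f')) (at t within S)"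
proof -
  have "((\<lambda>t. f t \<bullet> f t) has_derivative (\<lambda>h. f t \<bullet> (h *\<^sub>R f') + (h *\<^sub>R f') \<bullet> f t)) (at t within S)"
    using assms unfolding has_vector_derivative_def by (rule has_derivative_inner) (use assms in \<open>simp add: has_vector_derivative_def\<close>)
  then show ?thesis
    by (simp add: has_vector_derivative_def power2_norm_eq_inner inner_commute algebra_simps)
qed

lemma has_vector_derivative_exp_norm_square:
  fixes f :: "real \<Rightarrow> 'a::real_inner"
  assumes "(f has_vector_derivative f') (at t within S)"
  shows "((\<lambda>t. exp (\<theta> * (norm (f t))\<^sup>2)) has_vector_derivative
    ((2 * \<theta> * exp (\<theta> * (norm (f t))\<^sup>2)) *\<^sub>R f t) \<bullet> f') (at t within S)"
proof -
  have "((\<lambda>t. \<theta> * (norm (f t))\<^sup>2) has_real_derivative (\<theta> * (2 * (f t \<bullet> f')))) (at t within S)"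
    using has_vector_derivative_norm_square[OF assms]
    by (intro DERIV_cmult) (simp add: has_real_derivative_iff_has_vector_derivative)
  from DERIV_chain'[OF this DERIV_exp] show ?thesis
    by (simp add: has_real_derivative_iff_has_vector_derivative mult_ac)
qed

text \<open>If the curve ends outside of the ball of radius \<open>r\<close>, then its speed is at most \<open>V\<close> after the last
  time at which it meets the sphere.\<close>

lemma norm_le_of_outer_speed_le:
  fixes f :: "real \<Rightarrow> 'a::real_normed_vector"
  assumes deriv: "\<And>s. s \<in> {0..t} \<Longrightarrow> (f has_vector_derivative f' s) (at s within {0..t})"
    and 0: "norm (f 0 - c) \<le> r" "0 \<le> t" "0 \<le> V"
    and speed: "\<And>s. s \<in> {0..t} \<Longrightarrow> r \<le> norm (f s - c) \<Longrightarrow> norm (f' s) \<le> V"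
  shows "norm (f t - c) \<le> r + V * t"
proof (cases "norm (f t - c) \<le> r")
  case True
  then show ?thesis using 0 by (simp add: add_increasing2)
next
  case False
  let ?g = "\<lambda>s. norm (f s - c)"
  have cont: "continuous_on {0..t} ?g"
    using continuous_on_vector_derivative[of "{0..t}" f f'] deriv by (intro continuous_intros) auto
  have ivt: "\<exists>s'\<ge>s. s' \<le> t \<and> ?g s' = r" if "s \<in> {0..t}" "?g s \<le> r" for s
    using IVT'[of ?g s r t] False that continuous_on_subset[OF cont, of "{s..t}"] by auto
  define S where "S = {s \<in> {0..t}. ?g s = r}"
  have "compact S"
  proof -
    have "S = {0..t} \<inter> ?g -` {r}"
      by (auto simp: S_def)
    then show ?thesis
      using continuous_closed_preimage[OF cont, of "{r}"] bounded_subset[of "{0..t}" S]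
      by (auto simp: compact_eq_bounded_closed)
  qed
  moreover have "S \<noteq> {}"
    using ivt[of 0] 0 by (auto simp: S_def)
  ultimately obtain s where s: "s \<in> S" "\<And>u. u \<in> S \<Longrightarrow> u \<le> s"
    using compact_attains_sup by metis
  then have s': "0 \<le> s" "s \<le> t" "?g s = r" by (auto simp: S_def)
  have outer: "r \<le> ?g u" if "u \<in> {s..t}" for u
  proof (rule ccontr)
    assume less: "\<not> r \<le> ?g u"
    have "u \<in> {0..t}" using that s' by auto
    then obtain u' where "u \<le> u'" "u' \<le> t" "?g u' = r"
      using ivt[of u] less by force
    then have "u' \<le> s"
      using s(2)[of u'] that s' by (auto simp: S_def)
    then have "u = s"
      using \<open>u \<le> u'\<close> that by auto
    then show False
      using less s' by simp
  qed
  have "norm (f t - f s) \<le> V * \<bar>t - s\<bar>"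
  proof (rule norm_diff_le_of_vector_derivative_le[of "{s..t}"])
    show "(f has_vector_derivative f' u) (at u within {s..t})" if "u \<in> {s..t}" for u
      by (rule has_vector_derivative_within_subset[OF deriv]) (use that s' in auto)
    show "norm (f' u) \<le> V" if "u \<in> {s..t}" for u
      using speed[OF _ outer[OF that]] that s' by auto
  qed (use s' in auto)
  also have "\<dots> \<le> V * t"
    using s' 0 by (intro mult_left_mono) auto
  finally show ?thesis
    using norm_triangle_ineq[of "f t - f s" "f s - c"] s' by simp
qed

text \<open>The part of the potential of the image of \<open>M\<close> under \<open>f\<close> that comes from distances below \<open>r\<close>.\<close>

abbreviation near_potential :: "plane measure \<Rightarrow> (plane \<Rightarrow> plane) \<Rightarrow> plane \<Rightarrow> real \<Rightarrow> ennreal" where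
  "near_potential M f z r \<equiv>
    (\<integral>\<^sup>+ y. indicator (ball z r) (f y) * ennreal (1 / norm (z - f y)) \<partial>M)"

text \<open>The Lagrangian picture.  Particles are labelled by their initial positions: \<open>\<mu> i\<close> is the absolute
  value of the initial vorticity of index \<open>i\<close>, \<open>\<sigma> i\<close> is its sign, and \<open>G i\<close> contains labels
  whose trajectories are differentiable at all times.  The bound \<open>P\<close> on the potentials makes
  integrals finite and speeds bounded; it is huge for concentrated vorticity.\<close>

locale vortex_flow =
  fixes N :: nat and \<mu> :: "nat \<Rightarrow> plane measure" and \<sigma> :: "nat \<Rightarrow> real"
    and \<Phi> :: "real \<Rightarrow> plane \<Rightarrow> plane" and G :: "nat \<Rightarrow> plane set" and P :: real
  assumes finite: "i \<in> {1..N} \<Longrightarrow> finite_measure (\<mu> i)"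
    and sets_\<mu>: "sets (\<mu> i) = sets borel"
    and sign: "\<bar>\<sigma> i\<bar> = 1"
    and \<Phi>_measurable [measurable]: "0 \<le> t \<Longrightarrow> \<Phi> t \<in> borel_measurable borel"
    and P_nonneg: "0 \<le> P"
    and potential: "i \<in> {1..N} \<Longrightarrow> 0 \<le> t \<Longrightarrow> (\<integral>\<^sup>+ y. ennreal (1 / norm (z - \<Phi> t y)) \<partial>\<mu> i) \<le> ennreal P"
    and AE_G: "i \<in> {1..N} \<Longrightarrow> AE x in \<mu> i. x \<in> G i"
    and trajectory: "i \<in> {1..N} \<Longrightarrow> x \<in> G i \<Longrightarrow> 0 \<le> t \<Longrightarrow>
      ((\<lambda>t. \<Phi> t x) has_vector_derivative
        (\<Sum>j=1..N. \<sigma> j *\<^sub>R (\<integral>y. BS_kernel (\<Phi> t x - \<Phi> t y) \<partial>\<mu> j))) (at t within {0..})"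
begin

declare sets_\<mu> [measurable_cong]

definition V :: "nat \<Rightarrow> real \<Rightarrow> plane \<Rightarrow> plane" where
  "V i t z = (\<integral>y. BS_kernel (z - \<Phi> t y) \<partial>\<mu> i)"

definition u :: "real \<Rightarrow> plane \<Rightarrow> plane" where
  "u t z = (\<Sum>j=1..N. \<sigma> j *\<^sub>R V j t z)"

definition mass :: "nat \<Rightarrow> real" where
  "mass i = measure (\<mu> i) UNIV"

text \<open>The vorticity of index \<open>i\<close> at time \<open>t\<close>, up to its sign, in coordinates centered at \<open>c\<close>.\<close>

definition \<nu> :: "nat \<Rightarrow> real \<Rightarrow> plane \<Rightarrow> plane measure" where
  "\<nu> i t c = distr (\<mu> i) borel (\<lambda>x. \<Phi> t x - c)"

lemma space_\<mu> [simp]: "space (\<mu> i) = UNIV"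
  using sets_eq_imp_space_eq[OF sets_\<mu>] by simp

lemma mass_nonneg [simp]: "0 \<le> mass i"
  by (simp add: mass_def)

lemma \<Phi>_measurable_\<mu> [measurable]: "0 \<le> t \<Longrightarrow> \<Phi> t \<in> borel_measurable (\<mu> i)"
  using \<Phi>_measurable[of t] by (simp add: measurable_cong_sets[OF sets_\<mu> refl])

lemma \<Phi>_shift_measurable: "0 \<le> t \<Longrightarrow> (\<lambda>x. \<Phi> t x - c) \<in> measurable (\<mu> i) borel"
  by measurable

lemma vorticity_\<nu>:
  assumes "i \<in> {1..N}" "0 \<le> t"
  shows "vorticity (\<nu> i t c) P"
proof -
  interpret finite_measure "\<mu> i" by (rule finite[OF assms(1)])
  interpret \<nu>: finite_measure "\<nu> i t c"
    unfolding \<nu>_def by (rule finite_measure_distr[OF \<Phi>_shift_measurable[OF assms(2)]])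
  show ?thesis
  proof
    show "sets (\<nu> i t c) = sets borel" by (simp add: \<nu>_def)
    fix x
    have "(\<integral>\<^sup>+ y. ennreal (1 / norm (x - y)) \<partial>\<nu> i t c) = (\<integral>\<^sup>+ y. ennreal (1 / norm ((x + c) - \<Phi> t y)) \<partial>\<mu> i)"
      unfolding \<nu>_def
      by (subst nn_integral_distr[OF \<Phi>_shift_measurable[OF assms(2)]]) (simp_all add: algebra_simps)
    then show "(\<integral>\<^sup>+ y. ennreal (1 / norm (x - y)) \<partial>\<nu> i t c) \<le> ennreal P"
      using potential[OF assms, of "x + c"] by simp
  qed
qed

lemma integral_\<nu>:
  fixes f :: "plane \<Rightarrow> 'b::{banach, second_countable_topology}"
  assumes "0 \<le> t" "f \<in> borel_measurable borel"
  shows "(\<integral>z. f z \<partial>\<nu> i t c) = (\<integral>x. f (\<Phi> t x - c) \<partial>\<mu> i)"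
  unfolding \<nu>_def by (rule integral_distr[OF \<Phi>_shift_measurable[OF assms(1)] assms(2)])

lemma measure_\<nu>:
  assumes "0 \<le> t" "A \<in> sets borel"
  shows "measure (\<nu> i t c) A = measure (\<mu> i) {x. \<Phi> t x - c \<in> A}"
  unfolding \<nu>_def using assms by (subst measure_distr[OF \<Phi>_shift_measurable]) (auto simp: vimage_def)

lemma measure_\<nu>_UNIV: "0 \<le> t \<Longrightarrow> measure (\<nu> i t c) UNIV = mass i"
  by (simp add: measure_\<nu> mass_def)

lemma AE_\<nu>:
  assumes "0 \<le> t" "{z. Q z} \<in> sets borel" "AE x in \<mu> i. Q (\<Phi> t x - c)"
  shows "AE z in \<nu> i t c. Q z"
  unfolding \<nu>_def using assms by (subst AE_distr_iff[OF \<Phi>_shift_measurable]) auto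

lemma velocity_\<nu>:
  assumes "0 \<le> t"
  shows "(\<integral>y. BS_kernel (z - y) \<partial>\<nu> i t c) = V i t (z + c)"
  by (subst integral_\<nu>[OF assms]) (simp_all add: V_def algebra_simps)

lemma V_measurable [measurable]:
  assumes "i \<in> {1..N}" "0 \<le> t"
  shows "V i t \<in> borel_measurable borel"
  using vorticity.velocity_measurable[OF vorticity_\<nu>[OF assms, of 0]]
  by (simp add: velocity_\<nu>[OF assms(2)])

lemma norm_V_le: "i \<in> {1..N} \<Longrightarrow> 0 \<le> t \<Longrightarrow> norm (V i t z) \<le> P"
  using vorticity.norm_velocity_le[OF vorticity_\<nu>, of i t 0 z] P_nonneg
  by (simp add: velocity_\<nu>)

lemma integrable_V_kernel:
  assumes "i \<in> {1..N}" "0 \<le> t"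
  shows "integrable (\<mu> i) (\<lambda>y. BS_kernel (z - \<Phi> t y))"
proof -
  have "integrable (\<nu> i t 0) (\<lambda>y. BS_kernel (z - y))"
    by (rule vorticity.integrable_BS_kernel[OF vorticity_\<nu>[OF assms]])
  then show ?thesis
    unfolding \<nu>_def by (subst (asm) integrable_distr_eq[OF \<Phi>_shift_measurable[OF assms(2)]]) auto
qed

lemma u_measurable [measurable]: "0 \<le> t \<Longrightarrow> u t \<in> borel_measurable borel"
  unfolding u_def by measurable

lemma norm_u_le: "0 \<le> t \<Longrightarrow> norm (u t z) \<le> real N * P"
  unfolding u_def using sum_norm_bound[of "{1..N}" "\<lambda>j. \<sigma> j *\<^sub>R V j t z" P]
  by (auto simp: sign norm_V_le)

lemma trajectory':
  assumes "i \<in> {1..N}" "x \<in> G i" "t \<in> S" "S \<subseteq> {0..}"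
  shows "((\<lambda>t. \<Phi> t x) has_vector_derivative u t (\<Phi> t x)) (at t within S)"
proof -
  have "((\<lambda>t. \<Phi> t x) has_vector_derivative u t (\<Phi> t x)) (at t within {0..})"
    unfolding u_def V_def using assms by (intro trajectory) auto
  then show ?thesis
    by (rule has_vector_derivative_within_subset) (use assms in auto)
qed

lemma trajectory_lipschitz:
  assumes "i \<in> {1..N}" "x \<in> G i" "0 \<le> s" "0 \<le> t"
  shows "norm (\<Phi> t x - \<Phi> s x) \<le> real N * P * \<bar>t - s\<bar>"
  by (rule norm_diff_le_of_vector_derivative_le[of "{0..}"])
    (use assms in \<open>auto intro!: norm_u_le trajectory'\<close>)

lemma integrable_bounded:
  fixes f :: "plane \<Rightarrow> 'b::{banach, second_countable_topology}"
  assumes "i \<in> {1..N}" "f \<in> borel_measurable (\<mu> i)" "\<And>x. x \<in> G i \<Longrightarrow> norm (f x) \<le> B"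
  shows "integrable (\<mu> i) f"
  using AE_G[OF assms(1)] assms(2,3)
  by (intro finite_measure_integrable_bound[OF finite[OF assms(1)], where B = B]) auto

lemma integral_mono_G:
  fixes f :: "plane \<Rightarrow> real"
  assumes "i \<in> {1..N}" "integrable (\<mu> i) f" "integrable (\<mu> i) g" "\<And>x. x \<in> G i \<Longrightarrow> f x \<le> g x"
  shows "(\<integral>x. f x \<partial>\<mu> i) \<le> (\<integral>x. g x \<partial>\<mu> i)"
  using assms AE_G[OF assms(1)] by (intro integral_mono_AE) auto

lemma integral_inner_V:
  assumes "i \<in> {1..N}" "0 \<le> t" and [measurable]: "g \<in> borel_measurable borel"
  shows "(\<integral>x. g (\<Phi> t x - c) \<bullet> V i t (\<Phi> t x) \<partial>\<mu> i) = (\<integral>z. g z \<bullet> (\<integral>y. BS_kernel (z - y) \<partial>\<nu> i t c) \<partial>\<nu> i t c)"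
proof -
  have [measurable]: "(\<lambda>z. V i t (z + c)) \<in> borel_measurable borel"
    using V_measurable[OF assms(1,2)] by measurable
  show ?thesis
    unfolding velocity_\<nu>[OF assms(2)] by (subst integral_\<nu>[OF assms(2)]) auto
qed

end

section \<open>Concentration of confined vortices\<close>

lemma two_mult_le_of_square_le:
  fixes b1 b2 m1 m2 q1 q2 :: real
  assumes "b1\<^sup>2 \<le> m1 * q1" "b2\<^sup>2 \<le> m2 * q2" "0 \<le> m1" "0 \<le> m2" "0 \<le> q1" "0 \<le> q2"
  shows "2 * (b1 * b2) \<le> m2 * q1 + m1 * q2"
proof (rule power2_le_imp_le)
  have "b1\<^sup>2 * b2\<^sup>2 \<le> (m1 * q1) * (m2 * q2)"
    using assms by (intro mult_mono) auto
  then have "(2 * (b1 * b2))\<^sup>2 \<le> 4 * ((m1 * q1) * (m2 * q2))"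
    by (simp add: power_mult_distrib)
  also have "\<dots> = (m2 * q1 + m1 * q2)\<^sup>2 - (m2 * q1 - m1 * q2)\<^sup>2"
    by (simp add: power2_eq_square algebra_simps)
  also have "\<dots> \<le> (m2 * q1 + m1 * q2)\<^sup>2"
    by simp
  finally show "(2 * (b1 * b2))\<^sup>2 \<le> (m2 * q1 + m1 * q2)\<^sup>2" .
qed (use assms in auto)

lemma norm_add_diff_le:
  fixes a b c :: "'a::real_normed_vector"
  shows "norm (a + b - c) \<le> norm a + norm b + norm c"
  using norm_triangle_ineq4[of "a + b" c] norm_triangle_ineq[of a b] by linarith

text \<open>A vortex flow on a time interval during which each vortex stays in a disc about the initial
  position \<open>Y0 i\<close> of its point vortex, together with a solution \<open>Y\<close> of the point vortex system.  The
  discs are so far from each other that the interaction of different vortices is smooth.\<close>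

locale confined_vortex_flow = vortex_flow +
  fixes Y0 :: "nat \<Rightarrow> plane" and Y :: "nat \<Rightarrow> real \<Rightarrow> plane" and R T Mt :: real
  assumes R: "0 < R" and T: "0 \<le> T"
    and confined: "i \<in> {1..N} \<Longrightarrow> x \<in> G i \<Longrightarrow> t \<in> {0..T} \<Longrightarrow> norm (\<Phi> t x - Y0 i) \<le> 2 * R"
    and separated: "i \<in> {1..N} \<Longrightarrow> j \<in> {1..N} \<Longrightarrow> i \<noteq> j \<Longrightarrow> 6 * R \<le> norm (Y0 i - Y0 j)"
    and Y_near: "i \<in> {1..N} \<Longrightarrow> t \<in> {0..T} \<Longrightarrow> norm (Y i t - Y0 i) \<le> R / 8"
    and Y_deriv: "i \<in> {1..N} \<Longrightarrow> t \<in> {0..T} \<Longrightarrow> (Y i has_vector_derivative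
      (\<Sum>j\<in>{1..N} - {i}. (\<sigma> j * mass j) *\<^sub>R BS_kernel (Y i t - Y j t))) (at t within {0..T})"
    and total_mass: "(\<Sum>i=1..N. mass i) \<le> Mt"
begin

definition Y' :: "nat \<Rightarrow> real \<Rightarrow> plane" where
  "Y' i t = (\<Sum>j\<in>{1..N} - {i}. (\<sigma> j * mass j) *\<^sub>R BS_kernel (Y i t - Y j t))"

definition ext :: "nat \<Rightarrow> real \<Rightarrow> plane \<Rightarrow> plane" where
  "ext i t z = (\<Sum>j\<in>{1..N} - {i}. \<sigma> j *\<^sub>R V j t z)"

definition first_moment :: "nat \<Rightarrow> real \<Rightarrow> real" where
  "first_moment i t = (\<integral>x. norm (\<Phi> t x - Y i t) \<partial>\<mu> i)"

definition second_moment :: "nat \<Rightarrow> real \<Rightarrow> real" where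
  "second_moment i t = (\<integral>x. (norm (\<Phi> t x - Y i t))\<^sup>2 \<partial>\<mu> i)"

definition dispersion :: "real \<Rightarrow> real" where
  "dispersion t = (\<Sum>i=1..N. second_moment i t)"

lemma u_split: "i \<in> {1..N} \<Longrightarrow> u t z = \<sigma> i *\<^sub>R V i t z + ext i t z"
  unfolding u_def ext_def by (rule sum.remove) auto

lemma ext_measurable [measurable]: "0 \<le> t \<Longrightarrow> ext i t \<in> borel_measurable borel"
  unfolding ext_def by measurable

lemma Mt_nonneg: "0 \<le> Mt"
  using total_mass sum_nonneg[of "{1..N}" mass] by simp

lemma mass_le: "i \<in> {1..N} \<Longrightarrow> mass i \<le> Mt"
  using total_mass member_le_sum[of i "{1..N}" mass] by auto

lemma sum_others_mass_le: "(\<Sum>j\<in>{1..N} - {i}. mass j) \<le> Mt"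
  by (rule order_trans[OF sum_mono2 total_mass]) auto

lemma confined_Y:
  assumes "i \<in> {1..N}" "x \<in> G i" "t \<in> {0..T}"
  shows "norm (\<Phi> t x - Y i t) \<le> 3 * R"
  using norm_triangle_ineq4[of "\<Phi> t x - Y0 i" "Y i t - Y0 i"] confined[OF assms] Y_near[OF assms(1,3)] R
  by simp

lemma blobs_distant:
  assumes "i \<in> {1..N}" "j \<in> {1..N}" "i \<noteq> j" "x \<in> G i" "y \<in> G j" "t \<in> {0..T}"
  shows "2 * R \<le> norm (\<Phi> t x - \<Phi> t y)"
proof -
  have "Y0 i - Y0 j = (\<Phi> t x - \<Phi> t y) + (\<Phi> t y - Y0 j) - (\<Phi> t x - Y0 i)"
    by simp
  then have "norm (Y0 i - Y0 j) \<le> norm (\<Phi> t x - \<Phi> t y) + norm (\<Phi> t y - Y0 j) + norm (\<Phi> t x - Y0 i)"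
    by (metis norm_add_diff_le)
  then show ?thesis
    using confined[of i x t] confined[of j y t] separated[of i j] assms by linarith
qed

lemma vortices_distant:
  assumes "i \<in> {1..N}" "j \<in> {1..N}" "i \<noteq> j" "t \<in> {0..T}"
  shows "R \<le> norm (Y i t - Y j t)"
proof -
  have "Y0 i - Y0 j = (Y i t - Y j t) + (Y j t - Y0 j) - (Y i t - Y0 i)"
    by simp
  then have "norm (Y0 i - Y0 j) \<le> norm (Y i t - Y j t) + norm (Y j t - Y0 j) + norm (Y i t - Y0 i)"
    by (metis norm_add_diff_le)
  then show ?thesis
    using Y_near[of i t] Y_near[of j t] separated[of i j] assms R by linarith
qed

lemma integrable_norm_diff:
  assumes "i \<in> {1..N}" "t \<in> {0..T}"
  shows "integrable (\<mu> i) (\<lambda>x. norm (\<Phi> t x - Y i t))"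
    and "integrable (\<mu> i) (\<lambda>x. (norm (\<Phi> t x - Y i t))\<^sup>2)"
proof -
  have [measurable]: "\<Phi> t \<in> borel_measurable (\<mu> i)"
    using assms by (intro \<Phi>_measurable_\<mu>) simp
  show "integrable (\<mu> i) (\<lambda>x. norm (\<Phi> t x - Y i t))"
    using confined_Y[OF assms(1) _ assms(2)]
    by (intro integrable_bounded[OF assms(1), where B = "3 * R"]) auto
  show "integrable (\<mu> i) (\<lambda>x. (norm (\<Phi> t x - Y i t))\<^sup>2)"
    using power_mono[OF confined_Y[OF assms(1) _ assms(2)], of _ 2]
    by (intro integrable_bounded[OF assms(1), where B = "(3 * R)\<^sup>2"]) auto
qed

lemma first_moment_square_le:
  assumes "i \<in> {1..N}" "t \<in> {0..T}"
  shows "(first_moment i t)\<^sup>2 \<le> mass i * second_moment i t"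
  unfolding first_moment_def second_moment_def mass_def
  using finite_measure.integral_square_le[OF finite integrable_norm_diff] assms by simp

lemma moments_nonneg [simp]: "0 \<le> first_moment i t" "0 \<le> second_moment i t"
  by (simp_all add: first_moment_def second_moment_def)

lemma second_moment_le: "i \<in> {1..N} \<Longrightarrow> second_moment i t \<le> dispersion t"
  unfolding dispersion_def by (rule member_le_sum) auto

lemma norm_ext_le:
  assumes "i \<in> {1..N}" "x \<in> G i" "t \<in> {0..T}"
  shows "norm (ext i t (\<Phi> t x)) \<le> Mt / R"
proof -
  have V: "norm (V j t (\<Phi> t x)) \<le> mass j / R" if j: "j \<in> {1..N} - {i}" for j
  proof -
    have "norm (V j t (\<Phi> t x)) \<le> (\<integral>y. norm (BS_kernel (\<Phi> t x - \<Phi> t y)) \<partial>\<mu> j)"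
      unfolding V_def by (rule integral_norm_bound)
    also have "\<dots> \<le> (\<integral>y. 1 / R \<partial>\<mu> j)"
    proof (rule integral_mono_G)
      show "integrable (\<mu> j) (\<lambda>y. norm (BS_kernel (\<Phi> t x - \<Phi> t y)))"
        using j assms by (intro integrable_norm integrable_V_kernel) auto
      show "integrable (\<mu> j) (\<lambda>y. 1 / R)"
        using finite[of j] j by (simp add: finite_measure.integrable_const)
      show "norm (BS_kernel (\<Phi> t x - \<Phi> t y)) \<le> 1 / R" if "y \<in> G j" for y
        using norm_BS_kernel_le[of "2 * R" "\<Phi> t x - \<Phi> t y"] blobs_distant[of i j x y t] j that assms R
        by (force intro: order_trans simp: frac_le)
    qed (use j in auto)
    also have "\<dots> = mass j / R"
      by (simp add: mass_def)
    finally show ?thesis .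
  qed
  have "norm (ext i t (\<Phi> t x)) \<le> (\<Sum>j\<in>{1..N} - {i}. mass j / R)"
    unfolding ext_def using V by (intro order_trans[OF norm_sum sum_mono]) (auto simp: sign)
  also have "\<dots> = (\<Sum>j\<in>{1..N} - {i}. mass j) / R"
    by (simp add: sum_divide_distrib)
  also have "\<dots> \<le> Mt / R"
    using sum_others_mass_le R by (intro divide_right_mono) auto
  finally show ?thesis .
qed

lemma norm_Y'_le:
  assumes "i \<in> {1..N}" "t \<in> {0..T}"
  shows "norm (Y' i t) \<le> Mt / R"
proof -
  have "norm (Y' i t) \<le> (\<Sum>j\<in>{1..N} - {i}. mass j / R)"
    unfolding Y'_def
  proof (intro order_trans[OF norm_sum sum_mono])
    fix j assume j: "j \<in> {1..N} - {i}"
    have "norm (BS_kernel (Y i t - Y j t)) \<le> 1 / (6 * R)"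
      using vortices_distant[of i j t] assms j R by (intro norm_BS_kernel_le) auto
    also have "\<dots> \<le> 1 / R"
      using R by (intro frac_le) auto
    finally show "norm ((\<sigma> j * mass j) *\<^sub>R BS_kernel (Y i t - Y j t)) \<le> mass j / R"
      using mult_left_mono[of "norm (BS_kernel (Y i t - Y j t))" "1 / R" "mass j"]
      by (simp add: sign abs_mult)
  qed
  also have "\<dots> = (\<Sum>j\<in>{1..N} - {i}. mass j) / R"
    by (simp add: sum_divide_distrib)
  also have "\<dots> \<le> Mt / R"
    using sum_others_mass_le R by (intro divide_right_mono) auto
  finally show ?thesis .
qed

text \<open>The kernel is Lipschitz between distinct vortices, so that the velocity induced on a particle
  differs from the point vortex velocity by the distances to the point vortices.\<close>

lemma norm_ext_diff_le:
  assumes "i \<in> {1..N}" "x \<in> G i" "t \<in> {0..T}"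
  shows "norm (ext i t (\<Phi> t x) - Y' i t)
    \<le> (\<Sum>j=1..N. mass j * norm (\<Phi> t x - Y i t) + first_moment j t) / R\<^sup>2"
proof -
  let ?n = "norm (\<Phi> t x - Y i t)"
  have le: "norm (\<sigma> j *\<^sub>R V j t (\<Phi> t x) - (\<sigma> j * mass j) *\<^sub>R BS_kernel (Y i t - Y j t))
      \<le> (mass j * ?n + first_moment j t) / R\<^sup>2" if j: "j \<in> {1..N} - {i}" for j
  proof -
    interpret finite_measure "\<mu> j" using j by (intro finite) auto
    have intK: "integrable (\<mu> j) (\<lambda>y. BS_kernel (\<Phi> t x - \<Phi> t y))"
      using j assms by (intro integrable_V_kernel) auto
    have intn: "integrable (\<mu> j) (\<lambda>y. norm (\<Phi> t y - Y j t))"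
      using j assms by (intro integrable_norm_diff) auto
    have "V j t (\<Phi> t x) - mass j *\<^sub>R BS_kernel (Y i t - Y j t)
        = (\<integral>y. BS_kernel (\<Phi> t x - \<Phi> t y) - BS_kernel (Y i t - Y j t) \<partial>\<mu> j)"
      unfolding V_def mass_def using intK by (subst Bochner_Integration.integral_diff) auto
    also have "norm \<dots> \<le> (\<integral>y. norm (BS_kernel (\<Phi> t x - \<Phi> t y) - BS_kernel (Y i t - Y j t)) \<partial>\<mu> j)"
      by (rule integral_norm_bound)
    also have "\<dots> \<le> (\<integral>y. (?n + norm (\<Phi> t y - Y j t)) / R\<^sup>2 \<partial>\<mu> j)"
    proof (rule integral_mono_G)
      fix y assume y: "y \<in> G j"
      have "norm (BS_kernel (\<Phi> t x - \<Phi> t y) - BS_kernel (Y i t - Y j t))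
          \<le> norm ((\<Phi> t x - \<Phi> t y) - (Y i t - Y j t)) / R\<^sup>2"
        using blobs_distant[of i j x y t] vortices_distant[of i j t] assms j y R
        by (intro norm_BS_kernel_diff_le) auto
      also have "norm ((\<Phi> t x - \<Phi> t y) - (Y i t - Y j t)) \<le> ?n + norm (\<Phi> t y - Y j t)"
        using norm_triangle_ineq4[of "\<Phi> t x - Y i t" "\<Phi> t y - Y j t"] by (simp add: algebra_simps)
      finally show "norm (BS_kernel (\<Phi> t x - \<Phi> t y) - BS_kernel (Y i t - Y j t))
          \<le> (?n + norm (\<Phi> t y - Y j t)) / R\<^sup>2"
        by (simp add: divide_right_mono)
    qed (use j intK intn in auto)
    also have "\<dots> = (mass j * ?n + first_moment j t) / R\<^sup>2"
      using intn by (simp add: mass_def first_moment_def)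
    finally have "norm (V j t (\<Phi> t x) - mass j *\<^sub>R BS_kernel (Y i t - Y j t)) \<le> (mass j * ?n + first_moment j t) / R\<^sup>2" .
    moreover have "\<sigma> j *\<^sub>R V j t (\<Phi> t x) - (\<sigma> j * mass j) *\<^sub>R BS_kernel (Y i t - Y j t)
        = \<sigma> j *\<^sub>R (V j t (\<Phi> t x) - mass j *\<^sub>R BS_kernel (Y i t - Y j t))"
      by (simp add: scaleR_diff_right)
    ultimately show ?thesis
      by (simp add: sign)
  qed
  have "norm (ext i t (\<Phi> t x) - Y' i t)
      \<le> (\<Sum>j\<in>{1..N} - {i}. (mass j * ?n + first_moment j t) / R\<^sup>2)"
    unfolding ext_def Y'_def sum_subtractf[symmetric] using le by (intro order_trans[OF norm_sum sum_mono])
  also have "\<dots> \<le> (\<Sum>j=1..N. (mass j * ?n + first_moment j t) / R\<^sup>2)"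
    by (intro sum_mono2) auto
  finally show ?thesis
    by (simp add: sum_divide_distrib)
qed

lemma integrable_inner_V:
  assumes "i \<in> {1..N}" "j \<in> {1..N}" "0 \<le> t" "g \<in> borel_measurable (\<mu> i)" "\<And>x. x \<in> G i \<Longrightarrow> norm (g x) \<le> B"
  shows "integrable (\<mu> i) (\<lambda>x. g x \<bullet> V j t (\<Phi> t x))"
proof (rule integrable_bounded[OF assms(1), where B = "B * P"])
  have [measurable]: "V j t \<in> borel_measurable borel" "\<Phi> t \<in> borel_measurable (\<mu> i)"
    using assms by auto
  show "(\<lambda>x. g x \<bullet> V j t (\<Phi> t x)) \<in> borel_measurable (\<mu> i)"
    using assms(4) by measurable
  fix x assume "x \<in> G i"
  then have "norm (g x) * norm (V j t (\<Phi> t x)) \<le> B * P"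
    using assms(5)[of x] norm_V_le[OF assms(2,3), of "\<Phi> t x"] order_trans[OF norm_ge_zero assms(5)[of x]]
    by (intro mult_mono) auto
  then show "norm (g x \<bullet> V j t (\<Phi> t x)) \<le> B * P"
    using Cauchy_Schwarz_ineq2[of "g x" "V j t (\<Phi> t x)"] by simp
qed

text \<open>In the derivative of the second moment about the point vortex, the velocity of the vortex itself
  drops out by the oddness of the kernel, and what is left is the difference between the external
  velocity and the velocity of the point vortex.\<close>

lemma second_moment_deriv_le:
  assumes "i \<in> {1..N}" "t \<in> {0..T}"
  defines "Q' \<equiv> (\<integral>x. 2 * ((\<Phi> t x - Y i t) \<bullet> (u t (\<Phi> t x) - Y' i t)) \<partial>\<mu> i)"
  shows "((\<lambda>t. second_moment i t) has_vector_derivative Q') (at t within {0..T})"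
    and "Q' \<le> 2 / R\<^sup>2 * (\<Sum>j=1..N. mass j * second_moment i t + first_moment i t * first_moment j t)"
proof -
  have t: "0 \<le> t" using assms by simp
  have [measurable]: "\<Phi> t \<in> borel_measurable (\<mu> i)" "u t \<in> borel_measurable borel"
    "V i t \<in> borel_measurable borel" "ext i t \<in> borel_measurable borel"
    using assms by auto
  show "((\<lambda>t. second_moment i t) has_vector_derivative Q') (at t within {0..T})"
    unfolding second_moment_def Q'_def
  proof (rule has_vector_derivative_integral[OF finite[OF assms(1)]])
    show "AE x in \<mu> i. \<forall>s\<in>{0..T}. ((\<lambda>s. (norm (\<Phi> s x - Y i s))\<^sup>2) has_vector_derivative
        2 * ((\<Phi> s x - Y i s) \<bullet> (u s (\<Phi> s x) - Y' i s))) (at s within {0..T})"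
      using AE_G[OF assms(1)]
    proof (eventually_elim, safe)
      fix x s assume "x \<in> G i" "s \<in> {0..T}"
      then show "((\<lambda>s. (norm (\<Phi> s x - Y i s))\<^sup>2) has_vector_derivative
        2 * ((\<Phi> s x - Y i s) \<bullet> (u s (\<Phi> s x) - Y' i s))) (at s within {0..T})"
        unfolding Y'_def using assms(1)
        by (intro has_vector_derivative_norm_square has_vector_derivative_diff trajectory' Y_deriv) auto
    qed
    show "AE x in \<mu> i. \<forall>s\<in>{0..T}. norm (2 * ((\<Phi> s x - Y i s) \<bullet> (u s (\<Phi> s x) - Y' i s)))
        \<le> 2 * (3 * R * (real N * P + Mt / R))"
      using AE_G[OF assms(1)]
    proof (eventually_elim, safe)
      fix x s assume x: "x \<in> G i" "s \<in> {0..T}"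
      have "\<bar>(\<Phi> s x - Y i s) \<bullet> (u s (\<Phi> s x) - Y' i s)\<bar>
          \<le> norm (\<Phi> s x - Y i s) * norm (u s (\<Phi> s x) - Y' i s)"
        by (rule Cauchy_Schwarz_ineq2)
      also have "\<dots> \<le> 3 * R * (real N * P + Mt / R)"
        using confined_Y[OF assms(1) x] norm_u_le[of s "\<Phi> s x"] norm_Y'_le[OF assms(1) x(2)] x(2) R
        by (intro mult_mono order_trans[OF norm_triangle_ineq4 add_mono]) auto
      finally show "norm (2 * ((\<Phi> s x - Y i s) \<bullet> (u s (\<Phi> s x) - Y' i s)))
        \<le> 2 * (3 * R * (real N * P + Mt / R))"
        by simp
    qed
  qed (use assms integrable_norm_diff in auto)
  have intV: "integrable (\<mu> i) (\<lambda>x. (\<Phi> t x - Y i t) \<bullet> V i t (\<Phi> t x))"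
    using confined_Y[OF assms(1) _ assms(2)] t assms(1)
    by (intro integrable_inner_V[where B = "3 * R"]) auto
  let ?e = "\<lambda>x. (\<Phi> t x - Y i t) \<bullet> (ext i t (\<Phi> t x) - Y' i t)"
  have inte: "integrable (\<mu> i) ?e"
  proof (rule integrable_bounded[OF assms(1), where B = "3 * R * (Mt / R + Mt / R)"])
    fix x assume x: "x \<in> G i"
    have "norm (?e x) \<le> norm (\<Phi> t x - Y i t) * norm (ext i t (\<Phi> t x) - Y' i t)"
      using Cauchy_Schwarz_ineq2 by simp
    also have "\<dots> \<le> 3 * R * (Mt / R + Mt / R)"
      using confined_Y[OF assms(1) x assms(2)] norm_ext_le[OF assms(1) x assms(2)] norm_Y'_le[OF assms(1,2)] R
      by (intro mult_mono order_trans[OF norm_triangle_ineq4 add_mono]) auto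
    finally show "norm (?e x) \<le> 3 * R * (Mt / R + Mt / R)" .
  qed measurable
  have self: "(\<integral>x. (\<Phi> t x - Y i t) \<bullet> V i t (\<Phi> t x) \<partial>\<mu> i) = 0"
  proof -
    interpret \<nu>: vorticity "\<nu> i t (Y i t)" P by (rule vorticity_\<nu>[OF assms(1) t])
    have "AE z in \<nu> i t (Y i t). norm z \<le> 3 * R"
      using AE_G[OF assms(1)] confined_Y[OF assms(1) _ assms(2)] by (intro AE_\<nu>[OF t]) auto
    then have "(\<integral>z. z \<bullet> (\<integral>y. BS_kernel (z - y) \<partial>\<nu> i t (Y i t)) \<partial>\<nu> i t (Y i t)) = 0"
      using \<nu>.integral_inner_shift_velocity[of "3 * R" 0] by simp
    then show ?thesis
      using integral_inner_V[OF assms(1) t, of "\<lambda>z. z" "Y i t"] by simp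
  qed
  have "Q' = (\<integral>x. 2 * \<sigma> i * ((\<Phi> t x - Y i t) \<bullet> V i t (\<Phi> t x)) + 2 * ?e x \<partial>\<mu> i)"
    unfolding Q'_def u_split[OF assms(1)]
    by (intro Bochner_Integration.integral_cong refl) (simp add: inner_add_right inner_diff_right algebra_simps)
  also have "\<dots> = 2 * (\<integral>x. ?e x \<partial>\<mu> i)"
    using intV inte self by simp
  finally have Q': "Q' = 2 * (\<integral>x. ?e x \<partial>\<mu> i)" .
  have "(\<integral>x. ?e x \<partial>\<mu> i) \<le> (\<integral>x. (\<Sum>j=1..N. mass j * (norm (\<Phi> t x - Y i t))\<^sup>2
      + norm (\<Phi> t x - Y i t) * first_moment j t) / R\<^sup>2 \<partial>\<mu> i)"
  proof (rule integral_mono_G[OF assms(1) inte])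
    show "integrable (\<mu> i) (\<lambda>x. (\<Sum>j=1..N. mass j * (norm (\<Phi> t x - Y i t))\<^sup>2
      + norm (\<Phi> t x - Y i t) * first_moment j t) / R\<^sup>2)"
      using integrable_norm_diff[OF assms(1,2)] by auto
    fix x assume x: "x \<in> G i"
    have "?e x \<le> norm (\<Phi> t x - Y i t) * norm (ext i t (\<Phi> t x) - Y' i t)"
      by (rule norm_cauchy_schwarz)
    also have "\<dots> \<le> norm (\<Phi> t x - Y i t) * ((\<Sum>j=1..N. mass j * norm (\<Phi> t x - Y i t) + first_moment j t) / R\<^sup>2)"
      by (intro mult_left_mono norm_ext_diff_le[OF assms(1) x assms(2)]) auto
    also have "\<dots> = (\<Sum>j=1..N. mass j * (norm (\<Phi> t x - Y i t))\<^sup>2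
      + norm (\<Phi> t x - Y i t) * first_moment j t) / R\<^sup>2"
      unfolding times_divide_eq_right sum_distrib_left
      by (simp add: distrib_left power2_eq_square mult.left_commute)
    finally show "?e x \<le> \<dots>" .
  qed
  also have "(\<integral>x. (\<Sum>j=1..N. mass j * (norm (\<Phi> t x - Y i t))\<^sup>2
      + norm (\<Phi> t x - Y i t) * first_moment j t) / R\<^sup>2 \<partial>\<mu> i)
      = (\<Sum>j=1..N. mass j * second_moment i t + first_moment i t * first_moment j t) / R\<^sup>2"
    using integrable_norm_diff[OF assms(1,2)]
    by (simp add: Bochner_Integration.integral_sum first_moment_def[of i] second_moment_def)
  finally show "Q' \<le> 2 / R\<^sup>2 * (\<Sum>j=1..N. mass j * second_moment i t + first_moment i t * first_moment j t)"
    unfolding Q' by simp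
qed

text \<open>The first moments in the previous bound are controlled by the second moments, so that the sum of
  all second moments about the point vortices satisfies a linear differential inequality.  Its rate
  depends on the masses and distances only.\<close>

lemma dispersion_le:
  assumes "t \<in> {0..T}"
  shows "dispersion t \<le> dispersion 0 * exp (4 * Mt / R\<^sup>2 * t)"
proof -
  let ?Q' = "\<lambda>i t. (\<integral>x. 2 * ((\<Phi> t x - Y i t) \<bullet> (u t (\<Phi> t x) - Y' i t)) \<partial>\<mu> i)"
  show ?thesis
  proof (rule gronwall[where f' = "\<lambda>t. \<Sum>i=1..N. ?Q' i t" and T = T])
    show "(dispersion has_vector_derivative (\<Sum>i=1..N. ?Q' i t)) (at t within {0..T})" if "t \<in> {0..T}" for t
      unfolding dispersion_def using second_moment_deriv_le(1) that by (intro has_vector_derivative_sum) auto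
    fix s assume s: "s \<in> {0..T}"
    have "(\<Sum>i=1..N. ?Q' i s)
        \<le> (\<Sum>i=1..N. 2 / R\<^sup>2 * (\<Sum>j=1..N. mass j * second_moment i s + first_moment i s * first_moment j s))"
      using second_moment_deriv_le(2) s by (intro sum_mono) auto
    also have "\<dots> \<le> (\<Sum>i=1..N. 2 / R\<^sup>2 * (\<Sum>j=1..N. 3 / 2 * (mass j * second_moment i s) + 1 / 2 * (mass i * second_moment j s)))"
    proof (intro sum_mono mult_left_mono)
      fix i j assume "i \<in> {1..N}" "j \<in> {1..N}"
      then show "mass j * second_moment i s + first_moment i s * first_moment j s
        \<le> 3 / 2 * (mass j * second_moment i s) + 1 / 2 * (mass i * second_moment j s)"
        using two_mult_le_of_square_le[OF first_moment_square_le first_moment_square_le, of i s j s] s by simp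
    qed auto
    also have "\<dots> = 4 / R\<^sup>2 * ((\<Sum>i=1..N. mass i) * dispersion s)"
    proof -
      have "(\<Sum>i=1..N. \<Sum>j=1..N. mass j * second_moment i s) = (\<Sum>i=1..N. mass i) * dispersion s"
        unfolding dispersion_def by (subst sum.swap) (simp add: sum_product)
      moreover have "(\<Sum>i=1..N. \<Sum>j=1..N. mass i * second_moment j s) = (\<Sum>i=1..N. mass i) * dispersion s"
        unfolding dispersion_def by (simp add: sum_product)
      moreover have "(\<Sum>i=1..N. 2 / R\<^sup>2 * (\<Sum>j=1..N. 3 / 2 * (mass j * second_moment i s) + 1 / 2 * (mass i * second_moment j s)))
          = 2 / R\<^sup>2 * (3 / 2 * (\<Sum>i=1..N. \<Sum>j=1..N. mass j * second_moment i s)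
            + 1 / 2 * (\<Sum>i=1..N. \<Sum>j=1..N. mass i * second_moment j s))"
        by (simp only: sum.distrib sum_distrib_left distrib_left)
      ultimately show ?thesis
        by simp
    qed
    also have "\<dots> \<le> 4 / R\<^sup>2 * (Mt * dispersion s)"
      using total_mass by (intro mult_left_mono mult_right_mono) (auto simp: dispersion_def intro: sum_nonneg)
    finally show "(\<Sum>i=1..N. ?Q' i s) \<le> 4 * Mt / R\<^sup>2 * dispersion s"
      by simp
  qed (use assms in auto)
qed

lemma first_moment_le:
  assumes "i \<in> {1..N}" "t \<in> {0..T}"
  shows "first_moment i t \<le> sqrt (Mt * dispersion t)"
proof (rule real_le_rsqrt)
  show "(first_moment i t)\<^sup>2 \<le> Mt * dispersion t"
    using mult_mono[OF mass_le[OF assms(1)] second_moment_le[OF assms(1), of t]] Mt_nonneg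
    by (intro order_trans[OF first_moment_square_le[OF assms]]) auto
qed

lemma norm_integral_position_le:
  assumes "i \<in> {1..N}" "t \<in> {0..T}"
  shows "norm ((\<integral>x. \<Phi> t x \<partial>\<mu> i) - mass i *\<^sub>R Y i t) \<le> first_moment i t"
proof -
  interpret finite_measure "\<mu> i" by (rule finite[OF assms(1)])
  have "integrable (\<mu> i) (\<lambda>x. \<Phi> t x - Y i t)"
    using integrable_norm_diff(1)[OF assms] assms by (subst (asm) integrable_norm_iff) auto
  then have "integrable (\<mu> i) (\<lambda>x. (\<Phi> t x - Y i t) + Y i t)"
    by (rule Bochner_Integration.integrable_add) simp
  then have "(\<integral>x. \<Phi> t x \<partial>\<mu> i) - mass i *\<^sub>R Y i t = (\<integral>x. \<Phi> t x - Y i t \<partial>\<mu> i)"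
    by (simp add: mass_def)
  then show ?thesis
    unfolding first_moment_def by (metis integral_norm_bound)
qed

text \<open>A vortex does not act on its own center, so that only the external velocity has to be compared
  with the velocity of the point vortex.\<close>

lemma norm_integral_velocity_le:
  assumes "i \<in> {1..N}" "t \<in> {0..T}"
  shows "norm ((\<integral>x. u t (\<Phi> t x) \<partial>\<mu> i) - mass i *\<^sub>R Y' i t)
    \<le> (\<Sum>j=1..N. mass j * first_moment i t + mass i * first_moment j t) / R\<^sup>2"
proof -
  interpret finite_measure "\<mu> i" by (rule finite[OF assms(1)])
  have t: "0 \<le> t" using assms by simp
  have [measurable]: "\<Phi> t \<in> borel_measurable (\<mu> i)" "V i t \<in> borel_measurable borel" "ext i t \<in> borel_measurable borel"
    using assms by auto
  have intV: "integrable (\<mu> i) (\<lambda>x. V i t (\<Phi> t x))"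
    using norm_V_le[OF assms(1) t] by (intro integrable_bounded[OF assms(1), where B = P]) auto
  have inte: "integrable (\<mu> i) (\<lambda>x. ext i t (\<Phi> t x))"
    using norm_ext_le[OF assms(1) _ assms(2)] by (intro integrable_bounded[OF assms(1), where B = "Mt / R"]) auto
  have self: "(\<integral>x. V i t (\<Phi> t x) \<partial>\<mu> i) = 0"
  proof -
    interpret \<nu>: vorticity "\<nu> i t 0" P by (rule vorticity_\<nu>[OF assms(1) t])
    show ?thesis
      using \<nu>.integral_velocity_eq_0 by (simp add: velocity_\<nu>[OF t] integral_\<nu>[OF t])
  qed
  have "(\<integral>x. u t (\<Phi> t x) \<partial>\<mu> i) - mass i *\<^sub>R Y' i t = (\<integral>x. ext i t (\<Phi> t x) - Y' i t \<partial>\<mu> i)"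
    unfolding u_split[OF assms(1)] using intV inte self by (simp add: mass_def)
  also have "norm \<dots> \<le> (\<integral>x. norm (ext i t (\<Phi> t x) - Y' i t) \<partial>\<mu> i)"
    by (rule integral_norm_bound)
  also have "\<dots> \<le> (\<integral>x. (\<Sum>j=1..N. mass j * norm (\<Phi> t x - Y i t) + first_moment j t) / R\<^sup>2 \<partial>\<mu> i)"
    using inte integrable_norm_diff[OF assms] norm_ext_diff_le[OF assms(1) _ assms(2)]
    by (intro integral_mono_G[OF assms(1)]) auto
  also have "\<dots> = (\<Sum>j=1..N. mass j * first_moment i t + mass i * first_moment j t) / R\<^sup>2"
    using integrable_norm_diff[OF assms]
    by (simp add: Bochner_Integration.integral_sum first_moment_def[of i] mass_def[of i])
  finally show ?thesis .
qed

end

section \<open>Exponential moments and confinement\<close>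

context confined_vortex_flow
begin

definition far_mass :: "nat \<Rightarrow> real \<Rightarrow> real \<Rightarrow> real" where
  "far_mass i r t = measure (\<mu> i) {x. r \<le> norm (\<Phi> t x - Y0 i)}"

definition exp_moment :: "real \<Rightarrow> nat \<Rightarrow> real \<Rightarrow> real" where
  "exp_moment \<theta> i t = (\<integral>x. weight \<theta> (\<Phi> t x - Y0 i) \<partial>\<mu> i)"

lemma far_set_measurable: "0 \<le> t \<Longrightarrow> {x. r \<le> norm (\<Phi> t x - Y0 i)} \<in> sets (\<mu> i)"
  using \<Phi>_measurable_\<mu>[of t i] by measurable

lemma far_mass_eq_integral:
  assumes "i \<in> {1..N}" "0 \<le> t"
  shows "far_mass i r t = (\<integral>x. indicator {x. r \<le> norm (\<Phi> t x - Y0 i)} x \<partial>\<mu> i)"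
    and "integrable (\<mu> i) (\<lambda>x. indicator {x. r \<le> norm (\<Phi> t x - Y0 i)} x :: real)"
proof -
  interpret finite_measure "\<mu> i" by (rule finite[OF assms(1)])
  show "far_mass i r t = (\<integral>x. indicator {x. r \<le> norm (\<Phi> t x - Y0 i)} x \<partial>\<mu> i)"
    by (simp add: far_mass_def)
  show "integrable (\<mu> i) (\<lambda>x. indicator {x. r \<le> norm (\<Phi> t x - Y0 i)} x :: real)"
    using far_set_measurable[OF assms(2)] by (intro integrable_real_indicator) (auto simp: emeasure_eq_measure)
qed

lemma far_mass_le_dispersion:
  assumes "i \<in> {1..N}" "t \<in> {0..T}"
  shows "far_mass i (R / 4) t \<le> 64 / R\<^sup>2 * dispersion t"
proof -
  have "far_mass i (R / 4) t \<le> (\<integral>x. 64 / R\<^sup>2 * (norm (\<Phi> t x - Y i t))\<^sup>2 \<partial>\<mu> i)"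
  proof -
    have t: "0 \<le> t" using assms by simp
    show ?thesis
      unfolding far_mass_eq_integral(1)[OF assms(1) t]
    proof (rule integral_mono_G[OF assms(1)])
      show "integrable (\<mu> i) (\<lambda>x. indicator {x. R / 4 \<le> norm (\<Phi> t x - Y0 i)} x :: real)"
        by (rule far_mass_eq_integral(2)[OF assms(1) t])
      show "integrable (\<mu> i) (\<lambda>x. 64 / R\<^sup>2 * (norm (\<Phi> t x - Y i t))\<^sup>2)"
        using integrable_norm_diff[OF assms] by simp
      fix x assume "x \<in> G i"
      show "indicator {x. R / 4 \<le> norm (\<Phi> t x - Y0 i)} x \<le> 64 / R\<^sup>2 * (norm (\<Phi> t x - Y i t))\<^sup>2"
      proof (cases "R / 4 \<le> norm (\<Phi> t x - Y0 i)")
        case True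
        then have "R / 8 \<le> norm (\<Phi> t x - Y i t)"
          using norm_triangle_ineq[of "\<Phi> t x - Y i t" "Y i t - Y0 i"] Y_near[OF assms] by simp
        then have "(R / 8)\<^sup>2 \<le> (norm (\<Phi> t x - Y i t))\<^sup>2"
          using R by (intro power_mono) auto
        then show ?thesis
          using R True by (simp add: field_simps)
      qed auto
    qed
  qed
  also have "\<dots> = 64 / R\<^sup>2 * second_moment i t"
    by (simp add: second_moment_def)
  also have "\<dots> \<le> 64 / R\<^sup>2 * dispersion t"
    using second_moment_le[OF assms(1)] by (intro mult_left_mono) auto
  finally show ?thesis .
qed

lemma integrable_exp_moment:
  assumes "i \<in> {1..N}" "t \<in> {0..T}" "0 \<le> \<theta>"
  shows "integrable (\<mu> i) (\<lambda>x. weight \<theta> (\<Phi> t x - Y0 i))"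
proof (rule integrable_bounded[OF assms(1), where B = "exp (\<theta> * (2 * R)\<^sup>2)"])
  have [measurable]: "\<Phi> t \<in> borel_measurable (\<mu> i)"
    using assms by auto
  show "(\<lambda>x. weight \<theta> (\<Phi> t x - Y0 i)) \<in> borel_measurable (\<mu> i)"
    by measurable
  fix x assume "x \<in> G i"
  then have "(norm (\<Phi> t x - Y0 i))\<^sup>2 \<le> (2 * R)\<^sup>2"
    using confined[OF assms(1) _ assms(2)] by (intro power_mono) auto
  then have "\<theta> * (norm (\<Phi> t x - Y0 i))\<^sup>2 \<le> \<theta> * (2 * R)\<^sup>2"
    using assms(3) by (rule mult_left_mono)
  then show "norm (weight \<theta> (\<Phi> t x - Y0 i)) \<le> exp (\<theta> * (2 * R)\<^sup>2)"
    by (simp only: exp_le_cancel_iff real_norm_def abs_exp_cancel)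
qed

lemma exp_moment_nonneg [simp]: "0 \<le> exp_moment \<theta> i t"
  by (simp add: exp_moment_def)

lemma exp_moment_deriv:
  assumes "i \<in> {1..N}" "t \<in> {0..T}" "0 \<le> \<theta>"
  shows "((\<lambda>t. exp_moment \<theta> i t) has_vector_derivative
    (\<integral>x. weight_grad \<theta> (\<Phi> t x - Y0 i) \<bullet> u t (\<Phi> t x) \<partial>\<mu> i))
    (at t within {0..T})"
  unfolding exp_moment_def
proof (rule has_vector_derivative_integral[OF finite[OF assms(1)]])
  have [measurable]: "\<Phi> t \<in> borel_measurable (\<mu> i)" "u t \<in> borel_measurable borel"
    using assms by auto
  show "(\<lambda>x. weight_grad \<theta> (\<Phi> t x - Y0 i) \<bullet> u t (\<Phi> t x))
      \<in> borel_measurable (\<mu> i)"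
    by measurable
  show "AE x in \<mu> i. \<forall>s\<in>{0..T}. ((\<lambda>s. weight \<theta> (\<Phi> s x - Y0 i)) has_vector_derivative
      weight_grad \<theta> (\<Phi> s x - Y0 i) \<bullet> u s (\<Phi> s x)) (at s within {0..T})"
    using AE_G[OF assms(1)]
  proof (eventually_elim, intro ballI)
    fix x s assume x: "x \<in> G i" "s \<in> {0..T}"
    have "((\<lambda>s. \<Phi> s x - Y0 i) has_vector_derivative u s (\<Phi> s x)) (at s within {0..T})"
      using trajectory'[OF assms(1) x] has_vector_derivative_diff[OF _ has_vector_derivative_const] by fastforce
    then show "((\<lambda>s. weight \<theta> (\<Phi> s x - Y0 i)) has_vector_derivative
      weight_grad \<theta> (\<Phi> s x - Y0 i) \<bullet> u s (\<Phi> s x)) (at s within {0..T})"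
      by (rule has_vector_derivative_exp_norm_square)
  qed
  show "AE x in \<mu> i. \<forall>s\<in>{0..T}.
      norm (weight_grad \<theta> (\<Phi> s x - Y0 i) \<bullet> u s (\<Phi> s x))
      \<le> (2 * \<theta> * exp (\<theta> * (2 * R)\<^sup>2)) * (2 * R) * (real N * P)"
    using AE_G[OF assms(1)]
  proof (eventually_elim, intro ballI)
    fix x s assume x: "x \<in> G i" "s \<in> {0..T}"
    have "(norm (\<Phi> s x - Y0 i))\<^sup>2 \<le> (2 * R)\<^sup>2"
      using confined[OF assms(1) x] by (intro power_mono) auto
    then have "weight \<theta> (\<Phi> s x - Y0 i) \<le> exp (\<theta> * (2 * R)\<^sup>2)"
      using assms(3) mult_left_mono exp_le_cancel_iff by blast
    then have "(2 * \<theta> * weight \<theta> (\<Phi> s x - Y0 i)) * norm (\<Phi> s x - Y0 i) * norm (u s (\<Phi> s x))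
        \<le> (2 * \<theta> * exp (\<theta> * (2 * R)\<^sup>2)) * (2 * R) * (real N * P)"
      using confined[OF assms(1) x] norm_u_le[of s "\<Phi> s x"] x(2) R assms(3)
      by (intro mult_mono) auto
    moreover have "norm (weight_grad \<theta> (\<Phi> s x - Y0 i) \<bullet> u s (\<Phi> s x))
        \<le> (2 * \<theta> * weight \<theta> (\<Phi> s x - Y0 i)) * norm (\<Phi> s x - Y0 i) * norm (u s (\<Phi> s x))"
      using Cauchy_Schwarz_ineq2[of "weight_grad \<theta> (\<Phi> s x - Y0 i)" "u s (\<Phi> s x)"]
        assms(3) by (simp only: real_norm_def norm_scaleR abs_mult abs_exp_cancel abs_numeral abs_of_nonneg)
    ultimately show "norm (weight_grad \<theta> (\<Phi> s x - Y0 i) \<bullet> u s (\<Phi> s x))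
      \<le> (2 * \<theta> * exp (\<theta> * (2 * R)\<^sup>2)) * (2 * R) * (real N * P)"
      by (rule order_trans[rotated])
  qed
qed (use assms integrable_exp_moment in auto)

text \<open>The relative growth rate is linear in \<open>\<theta>\<close>.  The hypothesis \<open>bulk\<close> on the mass outside of the inner
  disc is what turns the quadratic term of the self-interaction into a linear one; it will follow
  from the second moments.\<close>

lemma exp_moment_deriv_le:
  assumes "i \<in> {1..N}" "t \<in> {0..T}" "0 \<le> \<theta>" and bulk: "\<theta> * R\<^sup>2 * far_mass i (R / 4) t \<le> Mt"
  shows "(\<integral>x. weight_grad \<theta> (\<Phi> t x - Y0 i) \<bullet> u t (\<Phi> t x) \<partial>\<mu> i)
    \<le> 10 * \<theta> * Mt * (exp_moment \<theta> i t + Mt * exp (\<theta> * R\<^sup>2))"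
proof -
  have t: "0 \<le> t" using assms by simp
  define E where "E = exp_moment \<theta> i t"
  have E: "0 \<le> E" by (simp add: E_def)
  define g where "g = (\<lambda>z::plane. (2 * \<theta> * exp (\<theta> * (norm z)\<^sup>2)) *\<^sub>R z)"
  have g_norm: "norm (g z) = 2 * \<theta> * exp (\<theta> * (norm z)\<^sup>2) * norm z" for z
    using assms(3) by (simp add: g_def)
  have [measurable]: "g \<in> borel_measurable borel"
    unfolding g_def by measurable
  have [measurable]: "\<Phi> t \<in> borel_measurable (\<mu> i)" "V i t \<in> borel_measurable borel" "ext i t \<in> borel_measurable borel"
    using assms by auto
  let ?z = "\<lambda>x. \<Phi> t x - Y0 i"
  have g_le: "norm (g (?z x)) \<le> 4 * \<theta> * R * weight \<theta> (?z x)" if "x \<in> G i" for x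
  proof -
    have "2 * \<theta> * weight \<theta> (?z x) * norm (?z x) \<le> 2 * \<theta> * weight \<theta> (?z x) * (2 * R)"
      using confined[OF assms(1) that assms(2)] assms(3) by (intro mult_left_mono) auto
    then show ?thesis
      by (simp add: g_norm algebra_simps)
  qed
  have g_bdd: "norm (g (?z x)) \<le> 4 * \<theta> * R * exp (\<theta> * (2 * R)\<^sup>2)" if x: "x \<in> G i" for x
  proof -
    have "(norm (?z x))\<^sup>2 \<le> (2 * R)\<^sup>2"
      using confined[OF assms(1) x assms(2)] by (intro power_mono) auto
    then have "weight \<theta> (?z x) \<le> exp (\<theta> * (2 * R)\<^sup>2)"
      using assms(3) mult_left_mono exp_le_cancel_iff by blast
    then show ?thesis
      using g_le[OF x] mult_left_mono[of _ _ "4 * \<theta> * R"] assms(3) R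
      by (meson mult_nonneg_nonneg order_trans less_imp_le zero_le_numeral)
  qed
  have intV: "integrable (\<mu> i) (\<lambda>x. g (?z x) \<bullet> V i t (\<Phi> t x))"
    by (rule integrable_inner_V[OF assms(1,1) t]) (use g_bdd in auto)
  have inte: "integrable (\<mu> i) (\<lambda>x. g (?z x) \<bullet> ext i t (\<Phi> t x))"
  proof (rule integrable_bounded[OF assms(1)])
    fix x assume x: "x \<in> G i"
    show "norm (g (?z x) \<bullet> ext i t (\<Phi> t x)) \<le> 4 * \<theta> * R * exp (\<theta> * (2 * R)\<^sup>2) * (Mt / R)"
      unfolding real_norm_def
      by (rule order_trans[OF Cauchy_Schwarz_ineq2 mult_mono[OF g_bdd[OF x] norm_ext_le[OF assms(1) x assms(2)]]])
        (use assms(3) R in auto)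
  qed measurable
  have ext: "(\<integral>x. g (?z x) \<bullet> ext i t (\<Phi> t x) \<partial>\<mu> i) \<le> 4 * \<theta> * Mt * E"
  proof -
    have "(\<integral>x. g (?z x) \<bullet> ext i t (\<Phi> t x) \<partial>\<mu> i) \<le> (\<integral>x. 4 * \<theta> * Mt * weight \<theta> (?z x) \<partial>\<mu> i)"
    proof (rule integral_mono_G[OF assms(1) inte])
      show "integrable (\<mu> i) (\<lambda>x. 4 * \<theta> * Mt * weight \<theta> (?z x))"
        by (intro integrable_mult_right integrable_exp_moment assms)
      fix x assume x: "x \<in> G i"
      have "g (?z x) \<bullet> ext i t (\<Phi> t x) \<le> norm (g (?z x)) * norm (ext i t (\<Phi> t x))"
        by (rule norm_cauchy_schwarz)
      also have "\<dots> \<le> 4 * \<theta> * R * weight \<theta> (?z x) * (Mt / R)"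
        by (rule mult_mono[OF g_le[OF x] norm_ext_le[OF assms(1) x assms(2)]]) (use assms(3) R in auto)
      also have "\<dots> = 4 * \<theta> * Mt * weight \<theta> (?z x)"
        using R by simp
      finally show "g (?z x) \<bullet> ext i t (\<Phi> t x) \<le> 4 * \<theta> * Mt * weight \<theta> (?z x)" .
    qed
    then show ?thesis
      by (simp add: E_def exp_moment_def)
  qed
  have self: "\<bar>\<integral>x. g (?z x) \<bullet> V i t (\<Phi> t x) \<partial>\<mu> i\<bar>
      \<le> 3 * \<theta>\<^sup>2 * R\<^sup>2 * exp (\<theta> * R\<^sup>2 / 4) * (mass i)\<^sup>2 + 3 * \<theta>\<^sup>2 * R\<^sup>2 * far_mass i (R / 4) t * E + 3 * \<theta> * mass i * E"
  proof -
    interpret \<nu>: vorticity "\<nu> i t (Y0 i)" P by (rule vorticity_\<nu>[OF assms(1) t])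
    have supp: "AE z in \<nu> i t (Y0 i). norm z \<le> 2 * R"
      using AE_G[OF assms(1)] confined[OF assms(1) _ assms(2)] by (intro AE_\<nu>[OF t]) auto
    have "(\<integral>z. exp (\<theta> * (norm z)\<^sup>2) \<partial>\<nu> i t (Y0 i)) = E"
      by (simp add: integral_\<nu>[OF t] E_def exp_moment_def)
    moreover have "measure (\<nu> i t (Y0 i)) {z. R / 4 \<le> norm z} = far_mass i (R / 4) t"
      by (simp add: measure_\<nu>[OF t] far_mass_def)
    ultimately show ?thesis
      using \<nu>.abs_integral_exp_weight_velocity_le[OF assms(3) R supp]
        integral_inner_V[OF assms(1) t, of g "Y0 i"]
      by (simp add: g_def measure_\<nu>_UNIV[OF t])
  qed
  \<comment> \<open>the weight in the inner disc is so small that it even absorbs the second factor \<open>\<theta>\<close>\<close>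
  have absorb: "\<theta> * R\<^sup>2 * exp (\<theta> * R\<^sup>2 / 4) \<le> 2 * exp (\<theta> * R\<^sup>2)"
  proof -
    let ?y = "\<theta> * R\<^sup>2"
    have "?y \<le> 2 * exp (3 / 4 * ?y)"
    proof -
      have "0 \<le> ?y" using assms(3) by simp
      then show ?thesis
        using exp_ge_add_one_self[of "3 / 4 * ?y"] by linarith
    qed
    then have "?y * exp (?y / 4) \<le> 2 * exp (3 / 4 * ?y) * exp (?y / 4)"
      by (rule mult_right_mono) simp
    also have "\<dots> = 2 * exp ?y"
      by (simp add: mult.assoc flip: exp_add)
    finally show ?thesis .
  qed
  have "(\<integral>x. g (?z x) \<bullet> u t (\<Phi> t x) \<partial>\<mu> i) = (\<integral>x. \<sigma> i * (g (?z x) \<bullet> V i t (\<Phi> t x)) + g (?z x) \<bullet> ext i t (\<Phi> t x) \<partial>\<mu> i)"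
    unfolding u_split[OF assms(1)] by (simp add: inner_add_right)
  then have "(\<integral>x. g (?z x) \<bullet> u t (\<Phi> t x) \<partial>\<mu> i)
      = \<sigma> i * (\<integral>x. g (?z x) \<bullet> V i t (\<Phi> t x) \<partial>\<mu> i) + (\<integral>x. g (?z x) \<bullet> ext i t (\<Phi> t x) \<partial>\<mu> i)"
    using intV inte by simp
  moreover have "\<sigma> i * (\<integral>x. g (?z x) \<bullet> V i t (\<Phi> t x) \<partial>\<mu> i) \<le> \<bar>\<integral>x. g (?z x) \<bullet> V i t (\<Phi> t x) \<partial>\<mu> i\<bar>"
    using abs_ge_self[of "\<sigma> i * (\<integral>x. g (?z x) \<bullet> V i t (\<Phi> t x) \<partial>\<mu> i)"] by (simp add: abs_mult sign)
  moreover have "3 * \<theta>\<^sup>2 * R\<^sup>2 * exp (\<theta> * R\<^sup>2 / 4) * (mass i)\<^sup>2 \<le> 6 * \<theta> * Mt * (Mt * exp (\<theta> * R\<^sup>2))"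
  proof -
    have "3 * \<theta>\<^sup>2 * R\<^sup>2 * exp (\<theta> * R\<^sup>2 / 4) * (mass i)\<^sup>2 = 3 * \<theta> * (\<theta> * R\<^sup>2 * exp (\<theta> * R\<^sup>2 / 4)) * (mass i)\<^sup>2"
      by (simp add: power2_eq_square)
    also have "\<dots> \<le> 3 * \<theta> * (2 * exp (\<theta> * R\<^sup>2)) * Mt\<^sup>2"
      using assms(3) mass_le[OF assms(1)] by (intro mult_mono[OF mult_left_mono[OF absorb] power_mono]) auto
    finally show ?thesis
      by (simp add: power2_eq_square algebra_simps)
  qed
  moreover have "3 * \<theta>\<^sup>2 * R\<^sup>2 * far_mass i (R / 4) t * E \<le> 3 * \<theta> * Mt * E"
  proof -
    have "3 * \<theta>\<^sup>2 * R\<^sup>2 * far_mass i (R / 4) t * E = 3 * \<theta> * (\<theta> * R\<^sup>2 * far_mass i (R / 4) t) * E"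
      by (simp add: power2_eq_square)
    also have "\<dots> \<le> 3 * \<theta> * Mt * E"
      using bulk assms(3) E by (intro mult_right_mono mult_left_mono) auto
    finally show ?thesis .
  qed
  moreover have "3 * \<theta> * mass i * E \<le> 3 * \<theta> * Mt * E"
    using mass_le[OF assms(1)] assms(3) E by (intro mult_right_mono mult_left_mono) auto
  moreover have "0 \<le> \<theta> * Mt * (Mt * exp (\<theta> * R\<^sup>2))"
    using assms(3) Mt_nonneg by simp
  ultimately have "(\<integral>x. g (?z x) \<bullet> u t (\<Phi> t x) \<partial>\<mu> i) \<le> 10 * \<theta> * Mt * E + 10 * \<theta> * Mt * (Mt * exp (\<theta> * R\<^sup>2))"
    using self ext by linarith
  then show ?thesis
    by (simp add: g_def E_def distrib_left)
qed

text \<open>As \<open>\<theta>\<close> multiplies both the growth rate of the exponential moment and the exponent of the weight,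
  the time for which growth is outweighed by the gap between the radii \<open>9 R / 8\<close> and \<open>3 R / 2\<close>
  does not depend on \<open>\<theta>\<close>.  Therefore \<open>\<theta>\<close> may be chosen as large as the other estimates require.\<close>

lemma far_mass_le_exp:
  assumes i: "i \<in> {1..N}" and t: "t \<in> {0..T}" and \<theta>: "0 \<le> \<theta>"
    and bulk: "\<And>s. s \<in> {0..T} \<Longrightarrow> \<theta> * R\<^sup>2 * far_mass i (R / 4) s \<le> Mt"
    and init: "\<And>x. x \<in> G i \<Longrightarrow> norm (\<Phi> 0 x - Y0 i) \<le> 9 / 8 * R"
    and time: "20 * Mt * T \<le> R\<^sup>2"
  shows "far_mass i (3 / 2 * R) t \<le> 2 * Mt * exp (- \<theta> * R\<^sup>2 / 4)"
proof -
  define b where "b = Mt * exp (\<theta> * (9 / 8 * R)\<^sup>2)"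
  have b: "0 \<le> b" "Mt * exp (\<theta> * R\<^sup>2) \<le> b"
  proof -
    have "\<theta> * R\<^sup>2 \<le> \<theta> * (9 / 8 * R)\<^sup>2"
      using \<theta> R by (intro mult_left_mono power_mono) auto
    then show "Mt * exp (\<theta> * R\<^sup>2) \<le> b" "0 \<le> b"
      using Mt_nonneg by (auto simp: b_def intro: mult_left_mono)
  qed
  have growth: "exp_moment \<theta> i t + b \<le> (exp_moment \<theta> i 0 + b) * exp (10 * \<theta> * Mt * t)"
  proof (rule gronwall[OF _ _ t])
    fix s assume s: "s \<in> {0..T}"
    let ?E' = "\<integral>x. weight_grad \<theta> (\<Phi> s x - Y0 i) \<bullet> u s (\<Phi> s x) \<partial>\<mu> i"
    show "((\<lambda>s. exp_moment \<theta> i s + b) has_vector_derivative ?E') (at s within {0..T})"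
      using has_vector_derivative_add[OF exp_moment_deriv[OF i s \<theta>] has_vector_derivative_const[of b]] by simp
    have "?E' \<le> 10 * \<theta> * Mt * (exp_moment \<theta> i s + Mt * exp (\<theta> * R\<^sup>2))"
      by (rule exp_moment_deriv_le[OF i s \<theta> bulk[OF s]])
    also have "\<dots> \<le> 10 * \<theta> * Mt * (exp_moment \<theta> i s + b)"
      using b \<theta> Mt_nonneg by (intro mult_left_mono) auto
    finally show "?E' \<le> 10 * \<theta> * Mt * (exp_moment \<theta> i s + b)" .
  qed
  have E0: "exp_moment \<theta> i 0 \<le> b"
  proof -
    have "exp_moment \<theta> i 0 \<le> (\<integral>x. exp (\<theta> * (9 / 8 * R)\<^sup>2) \<partial>\<mu> i)"
      unfolding exp_moment_def
    proof (rule integral_mono_G[OF i integrable_exp_moment[OF i _ \<theta>]])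
      show "integrable (\<mu> i) (\<lambda>x. exp (\<theta> * (9 / 8 * R)\<^sup>2))"
        using finite[OF i] by (simp add: finite_measure.integrable_const)
      fix x assume "x \<in> G i"
      then have "(norm (\<Phi> 0 x - Y0 i))\<^sup>2 \<le> (9 / 8 * R)\<^sup>2"
        by (intro power_mono init) auto
      then show "weight \<theta> (\<Phi> 0 x - Y0 i) \<le> exp (\<theta> * (9 / 8 * R)\<^sup>2)"
        using \<theta> mult_left_mono exp_le_cancel_iff by blast
    qed (use T in auto)
    also have "\<dots> = mass i * exp (\<theta> * (9 / 8 * R)\<^sup>2)"
      by (simp add: mass_def)
    also have "\<dots> \<le> b"
      unfolding b_def using mass_le[OF i] by (intro mult_right_mono) auto
    finally show ?thesis .
  qed
  have t0: "0 \<le> t" using t by simp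
  have "far_mass i (3 / 2 * R) t * exp (\<theta> * (3 / 2 * R)\<^sup>2)
      = (\<integral>x. indicator {x. 3 / 2 * R \<le> norm (\<Phi> t x - Y0 i)} x * exp (\<theta> * (3 / 2 * R)\<^sup>2) \<partial>\<mu> i)"
    by (simp add: far_mass_eq_integral(1)[OF i t0])
  also have "\<dots> \<le> exp_moment \<theta> i t"
    unfolding exp_moment_def
  proof (rule integral_mono_G[OF i _ integrable_exp_moment[OF i t \<theta>]])
    show "integrable (\<mu> i) (\<lambda>x. indicator {x. 3 / 2 * R \<le> norm (\<Phi> t x - Y0 i)} x * exp (\<theta> * (3 / 2 * R)\<^sup>2))"
      by (intro integrable_mult_left far_mass_eq_integral(2)[OF i t0])
    fix x
    show "indicator {x. 3 / 2 * R \<le> norm (\<Phi> t x - Y0 i)} x * exp (\<theta> * (3 / 2 * R)\<^sup>2)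
        \<le> weight \<theta> (\<Phi> t x - Y0 i)"
    proof (cases "3 / 2 * R \<le> norm (\<Phi> t x - Y0 i)")
      case True
      then have "(3 / 2 * R)\<^sup>2 \<le> (norm (\<Phi> t x - Y0 i))\<^sup>2"
        using R by (intro power_mono) auto
      then have "exp (\<theta> * (3 / 2 * R)\<^sup>2) \<le> weight \<theta> (\<Phi> t x - Y0 i)"
        using \<theta> mult_left_mono exp_le_cancel_iff by blast
      then show ?thesis using True by simp
    qed auto
  qed
  also have "\<dots> \<le> 2 * b * exp (10 * \<theta> * Mt * t)"
  proof -
    have "exp_moment \<theta> i 0 + b \<le> 2 * b"
      using E0 by simp
    then have "(exp_moment \<theta> i 0 + b) * exp (10 * \<theta> * Mt * t) \<le> 2 * b * exp (10 * \<theta> * Mt * t)"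
      by (rule mult_right_mono) simp
    then show ?thesis
      using growth b(1) by linarith
  qed
  also have "\<dots> \<le> 2 * Mt * exp (- \<theta> * R\<^sup>2 / 4) * exp (\<theta> * (3 / 2 * R)\<^sup>2)"
  proof -
    have "10 * Mt * t \<le> R\<^sup>2 / 2"
      using time t Mt_nonneg mult_left_mono[of t T "20 * Mt"] by simp
    then have "\<theta> * (10 * Mt * t) \<le> \<theta> * (R\<^sup>2 / 2)"
      using \<theta> by (rule mult_left_mono)
    moreover have "0 \<le> \<theta> * R\<^sup>2" using \<theta> by simp
    ultimately have "\<theta> * (9 / 8 * R)\<^sup>2 + 10 * \<theta> * Mt * t \<le> - \<theta> * R\<^sup>2 / 4 + \<theta> * (3 / 2 * R)\<^sup>2"
      by (simp add: power2_eq_square algebra_simps)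
    then have "exp (\<theta> * (9 / 8 * R)\<^sup>2) * exp (10 * \<theta> * Mt * t) \<le> exp (- \<theta> * R\<^sup>2 / 4) * exp (\<theta> * (3 / 2 * R)\<^sup>2)"
      by (simp only: exp_add[symmetric] exp_le_cancel_iff)
    then show ?thesis
      unfolding b_def using mult_left_mono[OF _ Mt_nonneg] by (simp add: mult.assoc)
  qed
  finally show ?thesis
    by simp
qed

lemma norm_u_outer_le:
  assumes i: "i \<in> {1..N}" and t: "t \<in> {0..T}" and "0 < r" "0 \<le> H"
    and near: "near_potential (\<mu> i) (\<Phi> t) (\<Phi> t x) r \<le> ennreal H"
    and far: "far_mass i (3 / 2 * R) t \<le> 2 * Mt * r"
    and x: "x \<in> G i" "13 / 8 * R \<le> norm (\<Phi> t x - Y0 i)"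
  shows "norm (u t (\<Phi> t x)) \<le> 3 * Mt / R + 2 * Mt + H"
proof -
  have t0: "0 \<le> t" using t by simp
  interpret \<nu>: vorticity "\<nu> i t (Y0 i)" P by (rule vorticity_\<nu>[OF i t0])
  let ?S = "{z::plane. 3 / 2 * R \<le> norm z}"
  have "norm (\<integral>y. BS_kernel ((\<Phi> t x - Y0 i) - y) \<partial>\<nu> i t (Y0 i))
      \<le> measure (\<nu> i t (Y0 i)) UNIV / (6 * (R / 8)) + measure (\<nu> i t (Y0 i)) ?S / r + H"
  proof (rule \<nu>.norm_velocity_le_split)
    show "R / 8 \<le> norm ((\<Phi> t x - Y0 i) - y)" if "y \<notin> ?S" for y
      using norm_triangle_ineq2[of "\<Phi> t x - Y0 i" y] that x(2) by simp
    show "(\<integral>\<^sup>+ y. indicator (ball (\<Phi> t x - Y0 i) r) y * ennreal (1 / norm (\<Phi> t x - Y0 i - y)) \<partial>\<nu> i t (Y0 i)) \<le> ennreal H"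
      unfolding \<nu>_def
      by (subst nn_integral_distr[OF \<Phi>_shift_measurable[OF t0]]) (use near in \<open>auto simp: indicator_def dist_norm\<close>)
  qed (use assms R in auto)
  then have "norm (V i t (\<Phi> t x)) \<le> mass i / (6 * (R / 8)) + far_mass i (3 / 2 * R) t / r + H"
    by (simp add: velocity_\<nu>[OF t0] measure_\<nu>_UNIV[OF t0] measure_\<nu>[OF t0] far_mass_def)
  moreover have "mass i / (6 * (R / 8)) \<le> 2 * Mt / R"
    using mass_le[OF i] Mt_nonneg R by (simp add: field_simps)
  moreover have "far_mass i (3 / 2 * R) t / r \<le> 2 * Mt"
    using far \<open>0 < r\<close> by (simp add: divide_le_eq)
  moreover have "norm (u t (\<Phi> t x)) \<le> norm (V i t (\<Phi> t x)) + Mt / R"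
    unfolding u_split[OF i] using norm_ext_le[OF i x(1) t]
    by (intro order_trans[OF norm_triangle_ineq add_mono]) (auto simp: sign)
  ultimately show ?thesis
    by simp
qed

text \<open>The second moments give the hypothesis on the bulk, exponential moments then show that the mass
  outside of radius \<open>3 R / 2\<close> is at most of order \<open>r\<close>, and this bounds the speed of all particles outside of radius
  \<open>13 R / 8\<close>, which cannot travel far in a short time.\<close>

lemma trapped:
  assumes i: "i \<in> {1..N}" and x: "x \<in> G i" and t: "t \<in> {0..T}" and \<theta>: "0 \<le> \<theta>" and "0 < r" "0 \<le> H"
    and disp: "64 * \<theta> * dispersion 0 * exp (4 * Mt / R\<^sup>2 * T) \<le> Mt"
    and init: "\<And>x. x \<in> G i \<Longrightarrow> norm (\<Phi> 0 x - Y0 i) \<le> 9 / 8 * R"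
    and near: "\<And>s z. s \<in> {0..T} \<Longrightarrow>
      near_potential (\<mu> i) (\<Phi> s) z r \<le> ennreal H"
    and r: "exp (- \<theta> * R\<^sup>2 / 4) \<le> r"
    and time: "20 * Mt * T \<le> R\<^sup>2" "(3 * Mt / R + 2 * Mt + H) * T \<le> R / 8"
  shows "norm (\<Phi> t x - Y0 i) \<le> 7 / 4 * R"
proof -
  have disp0: "0 \<le> dispersion 0"
    unfolding dispersion_def by (simp add: sum_nonneg)
  have bulk: "\<theta> * R\<^sup>2 * far_mass i (R / 4) s \<le> Mt" if s: "s \<in> {0..T}" for s
  proof -
    have "dispersion s \<le> dispersion 0 * exp (4 * Mt / R\<^sup>2 * s)"
      by (rule dispersion_le[OF s])
    also have "\<dots> \<le> dispersion 0 * exp (4 * Mt / R\<^sup>2 * T)"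
      using s Mt_nonneg disp0 by (intro mult_left_mono) (auto intro!: mult_left_mono divide_right_mono)
    finally have "64 / R\<^sup>2 * dispersion s \<le> 64 / R\<^sup>2 * (dispersion 0 * exp (4 * Mt / R\<^sup>2 * T))"
      by (rule mult_left_mono) simp
    then have "far_mass i (R / 4) s \<le> 64 / R\<^sup>2 * (dispersion 0 * exp (4 * Mt / R\<^sup>2 * T))"
      using far_mass_le_dispersion[OF i s] by linarith
    then have "\<theta> * R\<^sup>2 * far_mass i (R / 4) s \<le> \<theta> * R\<^sup>2 * (64 / R\<^sup>2 * (dispersion 0 * exp (4 * Mt / R\<^sup>2 * T)))"
      using \<theta> by (intro mult_left_mono) auto
    also have "\<dots> = 64 * \<theta> * dispersion 0 * exp (4 * Mt / R\<^sup>2 * T)"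
      using R by simp
    finally show ?thesis using disp by simp
  qed
  have "norm (\<Phi> t x - Y0 i) \<le> 13 / 8 * R + (3 * Mt / R + 2 * Mt + H) * t"
  proof (rule norm_le_of_outer_speed_le)
    show "((\<lambda>s. \<Phi> s x) has_vector_derivative u s (\<Phi> s x)) (at s within {0..t})" if "s \<in> {0..t}" for s
      by (rule trajectory'[OF i x that]) auto
    show "norm (\<Phi> 0 x - Y0 i) \<le> 13 / 8 * R"
      using init[OF x] R by simp
    show "norm (u s (\<Phi> s x)) \<le> 3 * Mt / R + 2 * Mt + H"
      if s: "s \<in> {0..t}" "13 / 8 * R \<le> norm (\<Phi> s x - Y0 i)" for s
    proof (rule norm_u_outer_le[OF i _ \<open>0 < r\<close> \<open>0 \<le> H\<close> near _ x s(2)])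
      show sT: "s \<in> {0..T}" "s \<in> {0..T}" using s t by auto
      have "far_mass i (3 / 2 * R) s \<le> 2 * Mt * exp (- \<theta> * R\<^sup>2 / 4)"
        by (rule far_mass_le_exp[OF i sT(1) \<theta> bulk init time(1)])
      also have "\<dots> \<le> 2 * Mt * r"
        using r Mt_nonneg by (intro mult_left_mono) auto
      finally show "far_mass i (3 / 2 * R) s \<le> 2 * Mt * r" .
    qed
  qed (use t R Mt_nonneg \<open>0 \<le> H\<close> in auto)
  also have "(3 * Mt / R + 2 * Mt + H) * t \<le> (3 * Mt / R + 2 * Mt + H) * T"
    using t R Mt_nonneg \<open>0 \<le> H\<close> by (intro mult_left_mono) auto
  finally show ?thesis
    using time(2) by linarith
qed

end

text \<open>Confinement to the disc of radius \<open>2 R\<close> improves itself to the radius \<open>7 R / 4\<close>.  All speeds are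
  bounded by \<open>N P\<close>, so that crossing the gap takes at least a fixed time \<open>h\<close>, and confinement
  propagates in finitely many steps of length \<open>h\<close>.  Only their number depends on \<open>P\<close>.\<close>

lemma (in vortex_flow) confined_vortex_flowI:
  fixes Y0 :: "nat \<Rightarrow> plane" and Y :: "nat \<Rightarrow> real \<Rightarrow> plane"
  assumes "0 < R" "0 \<le> T" "0 \<le> \<theta>" "0 < r" "0 \<le> H"
    and separated: "\<And>i j. i \<in> {1..N} \<Longrightarrow> j \<in> {1..N} \<Longrightarrow> i \<noteq> j \<Longrightarrow> 6 * R \<le> norm (Y0 i - Y0 j)"
    and Y_near: "\<And>i t. i \<in> {1..N} \<Longrightarrow> t \<in> {0..T} \<Longrightarrow> norm (Y i t - Y0 i) \<le> R / 8"
    and Y_deriv: "\<And>i t. i \<in> {1..N} \<Longrightarrow> t \<in> {0..T} \<Longrightarrow> (Y i has_vector_derivative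
      (\<Sum>j\<in>{1..N} - {i}. (\<sigma> j * mass j) *\<^sub>R BS_kernel (Y i t - Y j t))) (at t within {0..T})"
    and total_mass: "(\<Sum>i=1..N. mass i) \<le> Mt"
    and disp: "64 * \<theta> * (\<Sum>i=1..N. \<integral>x. (norm (\<Phi> 0 x - Y i 0))\<^sup>2 \<partial>\<mu> i) * exp (4 * Mt / R\<^sup>2 * T) \<le> Mt"
    and init: "\<And>i x. i \<in> {1..N} \<Longrightarrow> x \<in> G i \<Longrightarrow> norm (\<Phi> 0 x - Y0 i) \<le> 9 / 8 * R"
    and near: "\<And>i s z. i \<in> {1..N} \<Longrightarrow> s \<in> {0..T} \<Longrightarrow>
      near_potential (\<mu> i) (\<Phi> s) z r \<le> ennreal H"
    and r: "exp (- \<theta> * R\<^sup>2 / 4) \<le> r"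
    and time: "20 * Mt * T \<le> R\<^sup>2" "(3 * Mt / R + 2 * Mt + H) * T \<le> R / 8"
  shows "confined_vortex_flow N \<mu> \<sigma> \<Phi> G P Y0 Y R T Mt"
proof -
  have Mt: "0 \<le> Mt"
    using total_mass sum_nonneg[of "{1..N}" mass] by simp
  define h where "h = R / 4 / (real N * P + 1)"
  have NP: "0 \<le> real N * P" using P_nonneg by simp
  have h: "0 < h" "real N * P * h \<le> R / 4"
    using \<open>0 < R\<close> NP by (auto simp: h_def field_simps)
  have intro: "confined_vortex_flow N \<mu> \<sigma> \<Phi> G P Y0 Y R T' Mt"
    if T': "0 \<le> T'" "T' \<le> T" and conf: "\<And>i x t. i \<in> {1..N} \<Longrightarrow> x \<in> G i \<Longrightarrow> t \<in> {0..T'} \<Longrightarrow> norm (\<Phi> t x - Y0 i) \<le> 2 * R" for T'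
  proof
    show "(Y i has_vector_derivative
      (\<Sum>j\<in>{1..N} - {i}. (\<sigma> j * mass j) *\<^sub>R BS_kernel (Y i t - Y j t))) (at t within {0..T'})"
      if "i \<in> {1..N}" "t \<in> {0..T'}" for i t
      by (rule has_vector_derivative_within_subset[OF Y_deriv]) (use that T' in auto)
  qed (use T' conf separated Y_near total_mass \<open>0 < R\<close> in auto)
  have steps: "\<forall>i\<in>{1..N}. \<forall>x\<in>G i. \<forall>t\<in>{0..min T (real n * h)}. norm (\<Phi> t x - Y0 i) \<le> 2 * R" for n
  proof (induction n)
    case 0
    show ?case
    proof (intro ballI)
      fix i x t assume "i \<in> {1..N}" "x \<in> G i" "t \<in> {0..min T (real 0 * h)}"
      moreover from this have "t = 0" by simp
      ultimately show "norm (\<Phi> t x - Y0 i) \<le> 2 * R"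
        using init[of i x] \<open>0 < R\<close> by simp
    qed
  next
    case (Suc n)
    define T' where "T' = min T (real n * h)"
    have T': "0 \<le> T'" "T' \<le> T"
      using \<open>0 \<le> T\<close> h by (auto simp: T'_def)
    interpret c: confined_vortex_flow N \<mu> \<sigma> \<Phi> G P Y0 Y R T' Mt
      using Suc by (intro intro T') (auto simp: T'_def)
    have trapped: "norm (\<Phi> t x - Y0 i) \<le> 7 / 4 * R" if "i \<in> {1..N}" "x \<in> G i" "t \<in> {0..T'}" for i x t
    proof (rule c.trapped[OF that \<open>0 \<le> \<theta>\<close> \<open>0 < r\<close> \<open>0 \<le> H\<close> _ init near r])
      have "0 \<le> c.dispersion 0"
        unfolding c.dispersion_def by (simp add: sum_nonneg)
      then have "64 * \<theta> * c.dispersion 0 * exp (4 * Mt / R\<^sup>2 * T') \<le> 64 * \<theta> * c.dispersion 0 * exp (4 * Mt / R\<^sup>2 * T)"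
        using T' Mt \<open>0 \<le> \<theta>\<close> by (intro mult_left_mono) (auto intro!: mult_left_mono divide_right_mono)
      then show "64 * \<theta> * c.dispersion 0 * exp (4 * Mt / R\<^sup>2 * T') \<le> Mt"
        using disp unfolding c.dispersion_def c.second_moment_def by linarith
      show "20 * Mt * T' \<le> R\<^sup>2"
        using time(1) mult_left_mono[OF T'(2), of "20 * Mt"] Mt by simp
      show "(3 * Mt / R + 2 * Mt + H) * T' \<le> R / 8"
        using time(2) mult_left_mono[OF T'(2), of "3 * Mt / R + 2 * Mt + H"] Mt \<open>0 < R\<close> \<open>0 \<le> H\<close> by simp
    qed (use that T' in auto)
    show ?case
    proof (intro ballI)
      fix i x t assume i: "i \<in> {1..N}" and x: "x \<in> G i" and t: "t \<in> {0..min T (real (Suc n) * h)}"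
      show "norm (\<Phi> t x - Y0 i) \<le> 2 * R"
      proof (cases "t \<le> T'")
        case True
        then show ?thesis
          using trapped[OF i x, of t] t \<open>0 < R\<close> by simp
      next
        case False
        then have "t - T' \<le> h"
          using t by (auto simp: T'_def min_def algebra_simps split: if_splits)
        then have "norm (\<Phi> t x - \<Phi> T' x) \<le> real N * P * h"
          using trajectory_lipschitz[OF i x T'(1), of t] False t T' mult_left_mono[of "t - T'" h, OF _ NP] by auto
        then show ?thesis
          using norm_triangle_ineq[of "\<Phi> t x - \<Phi> T' x" "\<Phi> T' x - Y0 i"] trapped[OF i x, of T'] T' h(2) by simp
      qed
    qed
  qed
  obtain n where "T / h \<le> real n"
    using real_arch_simple by blast
  then have "min T (real n * h) = T"
    using h(1) by (simp add: divide_le_eq min_def)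
  then show ?thesis
    using steps[of n] \<open>0 \<le> T\<close> by (intro intro) auto
qed

section \<open>The point vortex system\<close>

lemma continuous_on_nat_times:
  fixes g :: "nat \<times> 'a::topological_space \<Rightarrow> 'b::topological_space"
  assumes "\<And>i. continuous_on UNIV (\<lambda>t. g (i, t))"
  shows "continuous_on UNIV g"
  unfolding continuous_on_open_vimage[OF open_UNIV]
proof (intro allI impI)
  fix B :: "'b set" assume "open B"
  have "g -` B \<inter> UNIV = (\<Union>i. {i} \<times> ((\<lambda>t. g (i, t)) -` B))"
    by auto
  moreover have "open \<dots>"
    using continuous_on_open_vimage[THEN iffD1, OF open_UNIV assms] \<open>open B\<close>
    by (intro open_UN ballI open_Times open_discrete) auto
  ultimately show "open (g -` B \<inter> UNIV)"
    by simp
qed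

lemma complete_PiC:
  fixes X :: "'a::topological_space \<Rightarrow> 'b::complete_space set"
  assumes "\<And>x. closed (X x)"
  shows "complete (PiC UNIV X)"
  unfolding complete_def
proof (intro allI impI)
  fix f :: "nat \<Rightarrow> 'a \<Rightarrow>\<^sub>C 'b" assume f: "(\<forall>n. f n \<in> PiC UNIV X) \<and> Cauchy f"
  then obtain g where "uniform_limit UNIV f g sequentially"
    using uniformly_convergent_eq_cauchy[of "\<lambda>_. True" f]
    unfolding Cauchy_def uniform_limit_sequentially_iff
    by (metis dist_fun_lt_imp_dist_val_lt)
  from uniform_limit_bcontfunE[OF this sequentially_bot]
  obtain l where l: "f \<longlonglongrightarrow> l" by metis
  have "l x \<in> X x" for x
  proof (rule Lim_in_closed_set[OF assms _ sequentially_bot])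
    show "eventually (\<lambda>n. f n x \<in> X x) sequentially"
      using f by (auto simp: mem_PiC_iff Pi_iff)
    show "(\<lambda>n. f n x) \<longlonglongrightarrow> l x"
      using tendsto_bcontfun_uniform_limit[OF l] by (rule tendsto_uniform_limitI) simp
  qed
  then show "\<exists>l\<in>PiC UNIV X. f \<longlonglongrightarrow> l"
    using l by (auto simp: mem_PiC_iff)
qed

lemma continuous_on_BS_kernel:
  assumes "continuous_on S f" "\<And>s. s \<in> S \<Longrightarrow> f s \<noteq> 0"
  shows "continuous_on S (\<lambda>s. BS_kernel (f s))"
  unfolding BS_kernel_def using assms
  by (intro continuous_intros bounded_linear.continuous_on[OF bounded_linear_perp]) auto

lemma norm_sum_BS_kernel_le:
  assumes "0 < d" "\<And>j. j \<in> J \<Longrightarrow> d / 2 \<le> norm (z j)" "finite J"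
  shows "norm (\<Sum>j\<in>J. a j *\<^sub>R BS_kernel (z j)) \<le> (\<Sum>j\<in>J. \<bar>a j\<bar>) / d"
proof -
  have "norm (\<Sum>j\<in>J. a j *\<^sub>R BS_kernel (z j)) \<le> (\<Sum>j\<in>J. \<bar>a j\<bar> * (1 / d))"
  proof (intro order_trans[OF norm_sum sum_mono])
    fix j assume "j \<in> J"
    then have "norm (BS_kernel (z j)) \<le> 1 / (6 * (d / 2))"
      using assms by (intro norm_BS_kernel_le) auto
    also have "\<dots> \<le> 1 / d"
      using assms(1) by (intro frac_le) auto
    finally show "norm (a j *\<^sub>R BS_kernel (z j)) \<le> \<bar>a j\<bar> * (1 / d)"
      by (simp only: norm_scaleR) (rule mult_left_mono, auto)
  qed
  then show ?thesis
    by (simp add: sum_divide_distrib)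
qed

lemma norm_diff_ge_of_near:
  fixes y z :: "nat \<Rightarrow> 'a::real_normed_vector"
  assumes "d \<le> norm (z i - z j)" "norm (y i - z i) \<le> \<eta>" "norm (y j - z j) \<le> \<eta>" "4 * \<eta> \<le> d"
  shows "d / 2 \<le> norm (y i - y j)"
proof -
  have "z i - z j = (y i - y j) + (y j - z j) - (y i - z i)"
    by simp
  then have "norm (z i - z j) \<le> norm (y i - y j) + norm (y j - z j) + norm (y i - z i)"
    by (metis norm_add_diff_le)
  then show ?thesis
    using assms by linarith
qed

text \<open>The distance to the initial position would have to pass through \<open>3 \<eta> / 4\<close> before it reaches
  \<open>\<eta>\<close> for the first time, but up to that time the speeds are bounded by \<open>A / d\<close>.\<close>

lemma point_vortex_solution_near:
  fixes Y0 :: "nat \<Rightarrow> plane"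
  assumes sol: "point_vortex_solution N a Y0 T Y" and d: "0 < d"
    and dist: "\<And>i j. i \<in> {1..N} \<Longrightarrow> j \<in> {1..N} \<Longrightarrow> i \<noteq> j \<Longrightarrow> d \<le> norm (Y0 i - Y0 j)"
    and \<eta>: "0 < \<eta>" "4 * \<eta> \<le> d" and A: "(\<Sum>i=1..N. \<bar>a i\<bar>) \<le> A" and time: "A / d * T \<le> \<eta> / 2"
    and i: "i \<in> {1..N}" and t: "t \<in> {0..T}"
  shows "norm (Y i t - Y0 i) \<le> \<eta>"
proof (rule ccontr)
  assume far: "\<not> norm (Y i t - Y0 i) \<le> \<eta>"
  let ?g = "\<lambda>i s. norm (Y i s - Y0 i)"
  have Y0: "Y i 0 = Y0 i" if "i \<in> {1..N}" for i
    using sol that by (auto simp: point_vortex_solution_def)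
  have deriv: "(Y i has_vector_derivative (\<Sum>j\<in>{1..N} - {i}. a j *\<^sub>R BS_kernel (Y i s - Y j s))) (at s within {0..T})"
    if "i \<in> {1..N}" "s \<in> {0..T}" for i s
    using sol that by (auto simp: point_vortex_solution_def)
  have cont: "continuous_on {0..T} (?g i)" if "i \<in> {1..N}" for i
    by (intro continuous_intros continuous_on_vector_derivative[OF deriv[OF that]])
  have A0: "0 \<le> A"
    by (rule order_trans[OF sum_nonneg A]) auto
  have A_others: "(\<Sum>j\<in>{1..N} - {i}. \<bar>a j\<bar>) \<le> A" for i
    by (rule order_trans[OF sum_mono2 A]) auto
  have small: "?g i s \<le> \<eta> / 2" if s: "s \<in> {0..T}" and near: "\<And>j r. j \<in> {1..N} \<Longrightarrow> r \<in> {0..s} \<Longrightarrow> ?g j r \<le> \<eta>"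
    and i: "i \<in> {1..N}" for i s
  proof -
    have "norm (Y i s - Y i 0) \<le> A / d * \<bar>s - 0\<bar>"
    proof (rule norm_diff_le_of_vector_derivative_le[of "{0..s}"])
      fix r assume r: "r \<in> {0..s}"
      show "(Y i has_vector_derivative (\<Sum>j\<in>{1..N} - {i}. a j *\<^sub>R BS_kernel (Y i r - Y j r))) (at r within {0..s})"
        by (rule has_vector_derivative_within_subset[OF deriv[OF i]]) (use r s in auto)
      have "d / 2 \<le> norm (Y i r - Y j r)" if "j \<in> {1..N} - {i}" for j
        using norm_diff_ge_of_near[of d Y0 i j "\<lambda>i. Y i r" \<eta>] dist[of i j] near[of i r] near[of j r] \<eta>(2) i r that
        by auto
      then have "norm (\<Sum>j\<in>{1..N} - {i}. a j *\<^sub>R BS_kernel (Y i r - Y j r)) \<le> (\<Sum>j\<in>{1..N} - {i}. \<bar>a j\<bar>) / d"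
        using d by (intro norm_sum_BS_kernel_le) auto
      also have "\<dots> \<le> A / d"
        using A_others d by (intro divide_right_mono) auto
      finally show "norm (\<Sum>j\<in>{1..N} - {i}. a j *\<^sub>R BS_kernel (Y i r - Y j r)) \<le> A / d" .
    qed (use s in auto)
    also have "\<dots> \<le> A / d * T"
      using s A0 d by (intro mult_left_mono) auto
    also note time
    finally show ?thesis
      using Y0[OF i] by simp
  qed
  define S where "S = (\<Union>j\<in>{1..N}. {0..T} \<inter> ?g j -` {\<eta>..})"
  have "compact S"
    unfolding S_def
  proof (intro compact_UN ballI)
    fix j assume j: "j \<in> {1..N}"
    have "closed ({0..T} \<inter> ?g j -` {\<eta>..})"
      by (intro continuous_closed_preimage cont j) auto
    then show "compact ({0..T} \<inter> ?g j -` {\<eta>..})"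
      using bounded_subset[of "{0..T}" "{0..T} \<inter> ?g j -` {\<eta>..}"] by (auto simp: compact_eq_bounded_closed)
  qed simp
  moreover have "S \<noteq> {}"
    using far i t by (force simp: S_def)
  ultimately obtain s where s: "s \<in> S" "\<And>r. r \<in> S \<Longrightarrow> s \<le> r"
    using compact_attains_inf by metis
  then obtain j where j: "j \<in> {1..N}" and sT: "s \<in> {0..T}" and gs: "\<eta> \<le> ?g j s"
    by (auto simp: S_def)
  have "\<exists>r\<ge>0. r \<le> s \<and> ?g j r = 3 / 4 * \<eta>"
    using Y0[OF j] \<eta> gs sT continuous_on_subset[OF cont[OF j], of "{0..s}"] by (intro IVT') auto
  then obtain r where r: "0 \<le> r" "r \<le> s" "?g j r = 3 / 4 * \<eta>"
    by blast
  then have "r < s"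
    using gs \<eta> by (cases "r = s") auto
  have "?g j r \<le> \<eta> / 2"
  proof (rule small[OF _ _ j])
    show "?g k q \<le> \<eta>" if "k \<in> {1..N}" "q \<in> {0..r}" for k q
    proof (rule ccontr)
      assume "\<not> ?g k q \<le> \<eta>"
      then have "q \<in> S"
        unfolding S_def using that r sT by (intro UN_I[of k]) auto
      then show False
        using s(2)[of q] that \<open>r < s\<close> by simp
    qed
  qed (use r sT in auto)
  then show False
    using r \<eta> by simp
qed

text \<open>Existence by the contraction principle, in the space of bounded continuous functions of index
  and time; as the index is discrete, this is just a family of continuous curves.\<close>

lemma point_vortex_solution_exists:
  fixes Y0 :: "nat \<Rightarrow> plane"
  assumes d: "0 < d" and T: "0 \<le> T"
    and dist: "\<And>i j. i \<in> {1..N} \<Longrightarrow> j \<in> {1..N} \<Longrightarrow> i \<noteq> j \<Longrightarrow> d \<le> norm (Y0 i - Y0 j)"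
    and \<eta>: "0 < \<eta>" "4 * \<eta> \<le> d" and A: "(\<Sum>i=1..N. \<bar>a i\<bar>) \<le> A"
    and time: "A / d * T \<le> \<eta>" "16 * A * T \<le> d\<^sup>2"
  shows "\<exists>Y. point_vortex_solution N a Y0 T Y"
proof -
  define cl where "cl = (\<lambda>t. max 0 (min T t))"
  have cl: "cl t \<in> {0..T}" for t using T by (auto simp: cl_def)
  have cl_cont: "continuous_on UNIV cl"
    unfolding cl_def by (intro continuous_intros)
  have A0: "0 \<le> A"
    by (rule order_trans[OF sum_nonneg A]) auto
  have A_others: "(\<Sum>j\<in>{1..N} - {i}. \<bar>a j\<bar>) \<le> A" for i
    by (rule order_trans[OF sum_mono2 A]) auto
  define X where "X = (\<lambda>(i, t::real). if i \<in> {1..N} then cball (Y0 i) \<eta> else {0::plane})"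
  define S where "S = PiC UNIV X"
  define w :: "((nat \<times> real) \<Rightarrow>\<^sub>C plane) \<Rightarrow> nat \<Rightarrow> real \<Rightarrow> plane" where
    "w = (\<lambda>f i s. \<Sum>j\<in>{1..N} - {i}. a j *\<^sub>R BS_kernel (apply_bcontfun f (i, s) - apply_bcontfun f (j, s)))"
  define F where "F = (\<lambda>f (i, t). if i \<in> {1..N} then Y0 i + integral {0..cl t} (w f i) else 0)"
  have near: "norm (apply_bcontfun f (i, s) - Y0 i) \<le> \<eta>" if "f \<in> S" "i \<in> {1..N}" for f i s
  proof -
    have "apply_bcontfun f (i, s) \<in> X (i, s)"
      using that(1) by (auto simp: S_def mem_PiC_iff)
    then show ?thesis
      using that(2) by (simp add: X_def dist_norm norm_minus_commute)
  qed
  have apart: "d / 2 \<le> norm (apply_bcontfun f (i, s) - apply_bcontfun f (j, s))" if "f \<in> S" "i \<in> {1..N}" "j \<in> {1..N} - {i}" for f i j s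
    using norm_diff_ge_of_near[of d Y0 i j "\<lambda>i. f (i, s)" \<eta>] near[OF that(1)] dist[of i j] \<eta> that by auto
  have f_cont: "continuous_on B (\<lambda>s. apply_bcontfun f (i, s))" for f :: "(nat \<times> real) \<Rightarrow>\<^sub>C plane" and i B
    by (rule continuous_on_compose2[of UNIV "apply_bcontfun f"]) (auto intro!: continuous_intros)
  have w_cont: "continuous_on B (w f i)" if "f \<in> S" "i \<in> {1..N}" for f i B
    unfolding w_def
  proof (intro continuous_on_sum continuous_on_scaleR continuous_on_const continuous_on_BS_kernel continuous_on_diff f_cont)
    show "f (i, s) - f (j, s) \<noteq> 0" if "j \<in> {1..N} - {i}" for s j
      using apart[OF \<open>f \<in> S\<close> \<open>i \<in> {1..N}\<close> that, of s] d by auto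
  qed
  have w_le: "norm (w f i s) \<le> A / d" if "f \<in> S" "i \<in> {1..N}" for f i s
  proof -
    have "norm (w f i s) \<le> (\<Sum>j\<in>{1..N} - {i}. \<bar>a j\<bar>) / d"
      unfolding w_def using apart[OF that] d by (intro norm_sum_BS_kernel_le) auto
    also have "\<dots> \<le> A / d"
      using A_others d by (intro divide_right_mono) auto
    finally show ?thesis .
  qed
  have int_le: "norm (integral {0..cl t} (w f i)) \<le> \<eta>" if "f \<in> S" "i \<in> {1..N}" for f i t
  proof -
    have "norm (integral {0..cl t} (w f i)) \<le> A / d * (cl t - 0)"
      using cl[of t] w_cont[OF that] w_le[OF that] by (intro integral_bound) auto
    also have "\<dots> \<le> A / d * T"
      using cl[of t] A0 d by (intro mult_left_mono) auto
    finally show ?thesis using time(1) by simp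
  qed
  have F_near: "F f (i, t) \<in> X (i, t)" if "f \<in> S" for f i t
    using int_le[OF that, of i t] by (simp add: F_def X_def dist_norm)
  have F_bcont: "F f \<in> bcontfun" if "f \<in> S" for f
  proof -
    have "continuous_on UNIV (\<lambda>t. F f (i, t))" for i
    proof (cases "i \<in> {1..N}")
      case True
      have "continuous_on {0..T} (\<lambda>t. integral {0..t} (w f i))"
        using w_cont[OF that True] by (intro indefinite_integral_continuous_1 integrable_continuous_real)
      then have "continuous_on UNIV (\<lambda>t. integral {0..cl t} (w f i))"
        by (rule continuous_on_compose2[OF _ cl_cont]) (use cl in auto)
      then show ?thesis
        using True by (simp add: F_def continuous_on_add)
    qed (auto simp: F_def)
    then have "continuous_on UNIV (F f)"
      by (rule continuous_on_nat_times)
    moreover have "bounded (range (F f))"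
    proof -
      have "range (F f) \<subseteq> insert 0 (\<Union>i\<in>{1..N}. cball (Y0 i) \<eta>)"
        using F_near[OF that] by (force simp: X_def split: if_splits)
      then show ?thesis
        by (rule bounded_subset[rotated]) (intro bounded_insert[THEN iffD2] bounded_UN ballI, auto)
    qed
    ultimately show ?thesis
      by (simp add: bcontfun_def)
  qed
  define \<F> where "\<F> = (\<lambda>f. Bcontfun (F f))"
  have apply_\<F>: "apply_bcontfun (\<F> f) = F f" if "f \<in> S" for f
    unfolding \<F>_def by (rule Bcontfun_inverse[OF F_bcont[OF that]])
  have lip: "dist (\<F> f) (\<F> g) \<le> 1 / 2 * dist f g" if fg: "f \<in> S" "g \<in> S" for f g
  proof (rule dist_bound)
    fix x :: "nat \<times> real"
    obtain i t where x: "x = (i, t)" by (cases x)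
    show "dist (\<F> f x) (\<F> g x) \<le> 1 / 2 * dist f g"
    proof (cases "i \<in> {1..N}")
      case i: True
      let ?D = "dist f g"
      have "norm (w f i s - w g i s) \<le> 8 * A / d\<^sup>2 * ?D" for s
      proof -
        have "norm (w f i s - w g i s) \<le> (\<Sum>j\<in>{1..N} - {i}. \<bar>a j\<bar> * (8 / d\<^sup>2 * ?D))"
          unfolding w_def sum_subtractf[symmetric]
        proof (intro order_trans[OF norm_sum sum_mono])
          fix j assume j: "j \<in> {1..N} - {i}"
          have "norm (BS_kernel (f (i, s) - f (j, s)) - BS_kernel (g (i, s) - g (j, s)))
              \<le> norm ((f (i, s) - f (j, s)) - (g (i, s) - g (j, s))) / (d / 2)\<^sup>2"
            using apart[OF fg(1) i j, of s] apart[OF fg(2) i j, of s] d by (intro norm_BS_kernel_diff_le) auto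
          also have "norm ((f (i, s) - f (j, s)) - (g (i, s) - g (j, s))) \<le> ?D + ?D"
          proof -
            have "norm ((f (i, s) - f (j, s)) - (g (i, s) - g (j, s)))
                \<le> norm (f (i, s) - g (i, s)) + norm (f (j, s) - g (j, s))"
              using norm_triangle_ineq4[of "f (i, s) - g (i, s)" "f (j, s) - g (j, s)"] by (simp add: algebra_simps)
            then show ?thesis
              using dist_bounded[of f "(i, s)" g] dist_bounded[of f "(j, s)" g] by (simp add: dist_norm)
          qed
          finally have "norm (BS_kernel (f (i, s) - f (j, s)) - BS_kernel (g (i, s) - g (j, s))) \<le> 8 / d\<^sup>2 * ?D"
            using d by (simp add: power_divide divide_right_mono mult.commute)
          then show "norm (a j *\<^sub>R BS_kernel (f (i, s) - f (j, s)) - a j *\<^sub>R BS_kernel (g (i, s) - g (j, s)))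
              \<le> \<bar>a j\<bar> * (8 / d\<^sup>2 * ?D)"
            unfolding scaleR_diff_right[symmetric] norm_scaleR by (intro mult_left_mono) auto
        qed
        also have "\<dots> = (\<Sum>j\<in>{1..N} - {i}. \<bar>a j\<bar>) * (8 / d\<^sup>2 * ?D)"
          by (simp only: sum_distrib_right)
        also have "\<dots> \<le> A * (8 / d\<^sup>2 * ?D)"
          using A_others by (intro mult_right_mono) auto
        finally show ?thesis by (simp add: mult_ac)
      qed
      then have "norm (integral {0..cl t} (\<lambda>s. w f i s - w g i s)) \<le> (8 * A / d\<^sup>2 * ?D) * (cl t - 0)"
        using cl[of t] w_cont[OF fg(1) i] w_cont[OF fg(2) i]
        by (intro integral_bound continuous_on_diff) auto
      also have "\<dots> \<le> (8 * A / d\<^sup>2 * ?D) * T"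
        using cl[of t] A0 by (intro mult_left_mono) auto
      also have "\<dots> = (16 * A * T / d\<^sup>2) * (1 / 2 * ?D)"
        by simp
      also have "\<dots> \<le> 1 * (1 / 2 * ?D)"
        using time(2) d by (intro mult_right_mono) auto
      finally have "norm (integral {0..cl t} (\<lambda>s. w f i s - w g i s)) \<le> 1 / 2 * ?D"
        by simp
      moreover have "integral {0..cl t} (\<lambda>s. w f i s - w g i s) = integral {0..cl t} (w f i) - integral {0..cl t} (w g i)"
        using w_cont[OF fg(1) i] w_cont[OF fg(2) i]
        by (intro Henstock_Kurzweil_Integration.integral_diff integrable_continuous_real)
      ultimately show ?thesis
        using i by (simp add: x apply_\<F> fg F_def dist_norm)
    qed (auto simp: x apply_\<F> fg F_def)
  qed
  have "\<exists>!f\<in>S. \<F> f = f"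
  proof (rule Banach_fix[where c = "1 / 2"])
    show "complete S"
      unfolding S_def by (rule complete_PiC) (auto simp: X_def)
    have "continuous_on UNIV (\<lambda>(i, t::real). if i \<in> {1..N} then Y0 i else 0)"
      by (rule continuous_on_nat_times) simp
    moreover have "bounded (range (\<lambda>(i, t::real). if i \<in> {1..N} then Y0 i else 0))"
    proof (rule bounded_subset)
      show "bounded (insert 0 (Y0 ` {1..N}))"
        by (intro finite_imp_bounded) auto
    qed auto
    ultimately have "(\<lambda>(i, t::real). if i \<in> {1..N} then Y0 i else 0) \<in> bcontfun"
      by (simp add: bcontfun_def)
    then obtain f :: "(nat \<times> real) \<Rightarrow>\<^sub>C plane" where "(\<lambda>(i, t::real). if i \<in> {1..N} then Y0 i else 0) = apply_bcontfun f"
      by (rule bcontfunE)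
    then have "f \<in> S"
      using \<eta> unfolding S_def mem_PiC_iff by (simp only: eq_commute[of _ "apply_bcontfun f"]) (auto simp: X_def)
    then show "S \<noteq> {}" by auto
    show "\<F> ` S \<subseteq> S"
    proof safe
      fix f assume f: "f \<in> S"
      have "\<F> f x \<in> X x" for x
        unfolding apply_\<F>[OF f] using F_near[OF f] by (cases x) simp
      then show "\<F> f \<in> S"
        unfolding S_def mem_PiC_iff by simp
    qed
    show "dist (\<F> f) (\<F> g) \<le> 1 / 2 * dist f g" if "f \<in> S" "g \<in> S" for f g
      by (rule lip[OF that])
  qed auto
  then obtain f where f: "f \<in> S" "\<F> f = f" by blast
  then have fix_eq: "f (i, t) = F f (i, t)" for i t
    using apply_\<F>[OF f(1)] by simp
  have cl_id: "cl t = t" if "t \<in> {0..T}" for t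
    using that by (simp add: cl_def)
  have "point_vortex_solution N a Y0 T (\<lambda>i t. f (i, t))"
    unfolding point_vortex_solution_def
  proof (intro conjI ballI)
    fix i assume i: "i \<in> {1..N}"
    have "f (i, 0) = Y0 i + integral {0..cl 0} (w f i)"
      using fix_eq[of i 0] i by (simp add: F_def)
    then show "f (i, 0) = Y0 i"
      using cl_id[of 0] T by simp
  next
    fix t assume "t \<in> {0..T}"
    show "inj_on (\<lambda>i. f (i, t)) {1..N}"
      using apart[OF f(1), of _ _ t] d by (force intro!: inj_onI)
  next
    fix i t assume i: "i \<in> {1..N}" and t: "t \<in> {0..T}"
    have "((\<lambda>t. Y0 i + integral {0..t} (w f i)) has_vector_derivative 0 + w f i t) (at t within {0..T})"
      by (intro has_vector_derivative_add has_vector_derivative_const integral_has_vector_derivative w_cont f i t)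
    then have "((\<lambda>t. f (i, t)) has_vector_derivative 0 + w f i t) (at t within {0..T})"
      by (rule has_vector_derivative_transform[rotated 2])
        (use t i fix_eq[of i] cl_id in \<open>auto simp: F_def\<close>)
    then show "((\<lambda>t. f (i, t)) has_vector_derivative
        (\<Sum>j\<in>{1..N} - {i}. a j *\<^sub>R BS_kernel (f (i, t) - f (j, t)))) (at t within {0..T})"
      by (simp add: w_def)
  qed
  then show ?thesis by blast
qed

section \<open>Lagrangian solutions with \<open>L\<^sup>p\<close> vorticity\<close>

text \<open>By the Lindelof property, countably many of the open balls on which \<open>f\<close> vanishes almost everywhere
  cover the complement of the support.\<close>

lemma AE_mem_spt: "AE x in lborel. f x \<noteq> 0 \<longrightarrow> x \<in> spt f"
proof -
  define F where "F = {B. \<exists>x r. B = ball x r \<and> (AE y in lborel. y \<in> B \<longrightarrow> f y = 0)}"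
  obtain F' where F': "F' \<subseteq> F" "countable F'" "\<Union>F' = \<Union>F"
    using Lindelof[of F] unfolding F_def by blast
  have "AE y in lborel. \<forall>B\<in>F'. y \<in> B \<longrightarrow> f y = 0"
    using F' by (subst AE_ball_countable) (auto simp: F_def)
  then show ?thesis
  proof eventually_elim
    case (elim y)
    show ?case
    proof (intro impI, rule ccontr)
      assume "f y \<noteq> 0" "y \<notin> spt f"
      then obtain r where "r > 0" "AE z in lborel. z \<in> ball y r \<longrightarrow> f z = 0"
        by (auto simp: spt_def)
      then have "ball y r \<in> F" "y \<in> ball y r"
        by (auto simp: F_def)
      then have "y \<in> \<Union>F'"
        using F'(3) by blast
      then show False
        using elim \<open>f y \<noteq> 0\<close> by blast
    qed
  qed
qed

lemma at_within_nonneg_eq: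
  fixes t :: real
  assumes "0 \<le> t"
  shows "at t within {0..} = at t within {0..t + 1}"
  by (rule at_within_nhd[of t "{..<t + 1}"]) auto

text \<open>Removing the singularity within distance \<open>r\<close> makes the kernel continuous and bounded, as required
  for dominated convergence.\<close>

definition truncated_kernel :: "real \<Rightarrow> plane \<Rightarrow> plane" where
  "truncated_kernel r z = (1 / (2 * pi * (max r (norm z))\<^sup>2)) *\<^sub>R perp z"

lemma truncated_kernel_eq: "r \<le> norm z \<Longrightarrow> truncated_kernel r z = BS_kernel z"
  by (simp add: truncated_kernel_def BS_kernel_def max_def inverse_eq_divide)

lemma continuous_on_truncated_kernel:
  assumes "0 < r"
  shows "continuous_on UNIV (truncated_kernel r)"
  unfolding truncated_kernel_def using assms
  by (intro continuous_intros bounded_linear.continuous_on[OF bounded_linear_perp])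
    (auto simp: max_def)

lemma norm_truncated_kernel_le:
  assumes "0 < r"
  shows "norm (truncated_kernel r z) \<le> 1 / r"
proof -
  let ?m = "max r (norm z)"
  have m: "r \<le> ?m" "norm z \<le> ?m" "0 < ?m" using assms by auto
  have "norm (truncated_kernel r z) = norm z / (2 * pi * ?m\<^sup>2)"
    by (simp add: truncated_kernel_def)
  also have "\<dots> \<le> ?m / (1 * ?m\<^sup>2)"
    using m pi_gt3 by (intro frac_le mult_right_mono) auto
  also have "\<dots> = 1 / ?m"
    using m(3) by (simp add: power2_eq_square)
  also have "\<dots> \<le> 1 / r"
    using m assms by (intro frac_le) auto
  finally show ?thesis .
qed

lemma norm_truncated_kernel_diff_le:
  assumes "0 < r"
  shows "norm (BS_kernel z - truncated_kernel r z) \<le> indicator (ball 0 r) z * (1 / norm z)"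
proof (cases "norm z < r")
  case True
  show ?thesis
  proof (cases "z = 0")
    case False
    then have z: "0 < norm z" by simp
    have "BS_kernel z - truncated_kernel r z = (1 / (2 * pi) * (1 / (norm z)\<^sup>2 - 1 / r\<^sup>2)) *\<^sub>R perp z"
      using True by (simp add: truncated_kernel_def BS_kernel_def max_def algebra_simps inverse_eq_divide)
    then have "norm (BS_kernel z - truncated_kernel r z) = 1 / (2 * pi) * \<bar>1 / (norm z)\<^sup>2 - 1 / r\<^sup>2\<bar> * norm z"
      by (simp add: abs_mult)
    also have "\<dots> \<le> 1 / (2 * pi) * (1 / (norm z)\<^sup>2) * norm z"
    proof -
      have "1 / r\<^sup>2 \<le> 1 / (norm z)\<^sup>2"
        using True z by (intro frac_le power_mono) auto
      then have "\<bar>1 / (norm z)\<^sup>2 - 1 / r\<^sup>2\<bar> \<le> 1 / (norm z)\<^sup>2"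
        by (simp add: abs_le_iff)
      then show ?thesis
        by (intro mult_right_mono mult_left_mono) auto
    qed
    also have "1 / (2 * pi) * (1 / (norm z)\<^sup>2) * norm z = 1 / (2 * pi) * (1 / norm z)"
      using z by (simp add: power2_eq_square)
    also have "\<dots> \<le> 1 * (1 / norm z)"
      using pi_gt3 by (intro mult_right_mono) auto
    finally show ?thesis
      using True z by simp
  qed (simp add: truncated_kernel_def BS_kernel_def perp_zero)
qed (auto simp: truncated_kernel_eq)

text \<open>Passage from the flow of an \<open>L\<^sup>p\<close> vorticity to \<^locale>\<open>vortex_flow\<close>.  Since \<open>\<Phi> t\<close> preserves Lebesgue
  measure, the velocity is an integral over the labels of the particles.  The sets \<open>A i\<close> carry
  the initial vorticities.\<close>

locale lagrangian_vortices =
  fixes N :: nat and p :: real and w :: "nat \<Rightarrow> plane \<Rightarrow> real" and \<sigma> :: "nat \<Rightarrow> real"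
    and u :: "real \<Rightarrow> plane \<Rightarrow> plane" and \<Phi> :: "real \<Rightarrow> plane \<Rightarrow> plane" and A :: "nat \<Rightarrow> plane set"
  assumes p: "2 < p"
    and w_integrable: "i \<in> {1..N} \<Longrightarrow> integrable lborel (w i)"
    and w_Lp: "i \<in> {1..N} \<Longrightarrow> integrable lborel (\<lambda>x. \<bar>w i x\<bar> powr p)"
    and w_sign: "i \<in> {1..N} \<Longrightarrow> AE x in lborel. w i x = \<sigma> i * \<bar>w i x\<bar>"
    and sign: "\<bar>\<sigma> i\<bar> = 1"
    and flow: "lagrangian_flow u \<Phi>"
    and u_eq: "0 \<le> t \<Longrightarrow> u t z = (\<integral>y. (\<Sum>j=1..N. w j y) *\<^sub>R BS_kernel (z - \<Phi> t y) \<partial>lborel)"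
    and AE_A: "i \<in> {1..N} \<Longrightarrow> AE x in lborel. w i x \<noteq> 0 \<longrightarrow> x \<in> A i"
begin

definition \<mu> :: "nat \<Rightarrow> plane measure" where
  "\<mu> i = density lborel (\<lambda>x. ennreal \<bar>w i x\<bar>)"

definition good :: "plane set" where
  "good = {x. \<forall>t\<ge>0. set_integrable lborel {0..t} (\<lambda>s. u s (\<Phi> s x)) \<and>
    \<Phi> t x = x + (LINT s:{0..t}|lborel. u s (\<Phi> s x))}"

definition q :: real where "q = p / (p - 1)"

definition Lp_mass :: "nat \<Rightarrow> real" where
  "Lp_mass i = (\<integral>x. \<bar>w i x\<bar> powr p \<partial>lborel)"

lemma q: "1 < q" "q < 2"
  using p by (simp_all add: q_def field_simps)

lemma Lp_mass_nonneg: "0 \<le> Lp_mass i"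
  by (simp add: Lp_mass_def)

lemma sets_\<mu> [measurable_cong, simp]: "sets (\<mu> i) = sets borel"
  by (simp add: \<mu>_def)

lemma space_\<mu> [simp]: "space (\<mu> i) = UNIV"
  by (simp add: \<mu>_def)

lemma w_measurable [measurable]: "i \<in> {1..N} \<Longrightarrow> w i \<in> borel_measurable borel"
  using w_integrable[THEN borel_measurable_integrable] by simp

lemma \<Phi>_measurable [measurable]: "0 \<le> t \<Longrightarrow> \<Phi> t \<in> borel_measurable borel"
  using flow by (auto simp: lagrangian_flow_def)

lemma AE_good: "AE x in lborel. x \<in> good"
  using flow by (auto simp: lagrangian_flow_def good_def)

lemma AE_\<mu>:
  assumes "i \<in> {1..N}" "AE x in lborel. w i x \<noteq> 0 \<longrightarrow> Q x"
  shows "AE x in \<mu> i. Q x"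
  unfolding \<mu>_def using assms by (subst AE_density) auto

lemma finite_\<mu>:
  assumes "i \<in> {1..N}"
  shows "finite_measure (\<mu> i)"
proof
  have "emeasure (\<mu> i) UNIV = (\<integral>\<^sup>+ x. ennreal \<bar>w i x\<bar> \<partial>lborel)"
    unfolding \<mu>_def using assms by (subst emeasure_density) auto
  also have "\<dots> < \<infinity>"
    using w_integrable[OF assms] by (simp add: integrable_iff_bounded)
  finally show "emeasure (\<mu> i) (space (\<mu> i)) \<noteq> \<infinity>"
    by simp
qed

lemma integral_\<mu>:
  fixes f :: "plane \<Rightarrow> 'b::{banach, second_countable_topology}"
  assumes "i \<in> {1..N}" and [measurable]: "f \<in> borel_measurable borel"
  shows "(\<integral>x. w i x *\<^sub>R f x \<partial>lborel) = \<sigma> i *\<^sub>R (\<integral>x. f x \<partial>\<mu> i)"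
proof -
  have [measurable]: "w i \<in> borel_measurable borel" by (rule w_measurable[OF assms(1)])
  have "(\<integral>x. w i x *\<^sub>R f x \<partial>lborel) = (\<integral>x. \<sigma> i *\<^sub>R (\<bar>w i x\<bar> *\<^sub>R f x) \<partial>lborel)"
  proof (rule integral_cong_AE)
    show "AE x in lborel. w i x *\<^sub>R f x = \<sigma> i *\<^sub>R (\<bar>w i x\<bar> *\<^sub>R f x)"
      using w_sign[OF assms(1)] by eventually_elim simp
  qed measurable
  also have "\<dots> = \<sigma> i *\<^sub>R (\<integral>x. \<bar>w i x\<bar> *\<^sub>R f x \<partial>lborel)"
    by (rule integral_scaleR_right)
  also have "(\<integral>x. \<bar>w i x\<bar> *\<^sub>R f x \<partial>lborel) = (\<integral>x. f x \<partial>\<mu> i)"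
    unfolding \<mu>_def by (intro integral_density[symmetric]) auto
  finally show ?thesis .
qed

lemma near_potential_le:
  assumes "i \<in> {1..N}" "0 \<le> t" "0 < \<kappa>" "0 < r"
  shows "near_potential (\<mu> i) (\<Phi> t) z r
    \<le> ennreal (riesz_const q * \<kappa> powr - q * r powr (2 - q) + \<kappa> powr p * Lp_mass i)"
proof -
  have [measurable]: "w i \<in> borel_measurable borel" "\<Phi> t \<in> borel_measurable borel"
    using assms by auto
  have "near_potential (\<mu> i) (\<Phi> t) z r
      = (\<integral>\<^sup>+ y. ennreal \<bar>w i y\<bar> * (indicator (ball z r) (\<Phi> t y) * ennreal (1 / norm (z - \<Phi> t y))) \<partial>lborel)"
    unfolding \<mu>_def by (rule nn_integral_density) auto
  also have "\<dots> \<le> ennreal (riesz_const q * \<kappa> powr - q * r powr (2 - q)) + ennreal (\<kappa> powr p) * ennreal (Lp_mass i)"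
  proof (rule nn_integral_near_potential[OF p q_def assms(3,4)])
    show "\<Phi> t \<in> lborel \<rightarrow>\<^sub>M lborel" "distr lborel lborel (\<Phi> t) = lborel"
      using flow assms(2) by (auto simp: lagrangian_flow_def)
    show "(\<integral>\<^sup>+ y. ennreal (\<bar>w i y\<bar> powr p) \<partial>lborel) \<le> ennreal (Lp_mass i)"
      unfolding Lp_mass_def using w_Lp[OF assms(1)] by (subst nn_integral_eq_integral) auto
  qed simp
  also have "\<dots> = ennreal (riesz_const q * \<kappa> powr - q * r powr (2 - q) + \<kappa> powr p * Lp_mass i)"
    using riesz_const_nonneg[OF q(2)] Lp_mass_nonneg by (simp add: ennreal_mult ennreal_plus)
  finally show ?thesis .
qed

lemma potential_le:
  assumes "i \<in> {1..N}" "0 \<le> t"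
  shows "(\<integral>\<^sup>+ y. ennreal (1 / norm (z - \<Phi> t y)) \<partial>\<mu> i)
    \<le> ennreal (riesz_const q + Lp_mass i + measure (\<mu> i) UNIV)"
proof -
  interpret finite_measure "\<mu> i" by (rule finite_\<mu>[OF assms(1)])
  have [measurable]: "\<Phi> t \<in> borel_measurable borel"
    using assms by auto
  have "(\<integral>\<^sup>+ y. ennreal (1 / norm (z - \<Phi> t y)) \<partial>\<mu> i)
      \<le> (\<integral>\<^sup>+ y. indicator (ball z 1) (\<Phi> t y) * ennreal (1 / norm (z - \<Phi> t y)) + 1 \<partial>\<mu> i)"
  proof (rule nn_integral_mono)
    fix y
    show "ennreal (1 / norm (z - \<Phi> t y)) \<le> indicator (ball z 1) (\<Phi> t y) * ennreal (1 / norm (z - \<Phi> t y)) + 1"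
      by (cases "\<Phi> t y \<in> ball z 1") (auto simp: dist_norm ennreal_le_1 add_increasing2 divide_le_eq not_less)
  qed
  also have "\<dots> = near_potential (\<mu> i) (\<Phi> t) z 1
      + ennreal (measure (\<mu> i) UNIV)"
    by (subst nn_integral_add) (auto simp: emeasure_eq_measure)
  also have "\<dots> \<le> ennreal (riesz_const q + Lp_mass i) + ennreal (measure (\<mu> i) UNIV)"
    using near_potential_le[OF assms, of 1 1 z] by (intro add_right_mono) simp
  also have "\<dots> = ennreal (riesz_const q + Lp_mass i + measure (\<mu> i) UNIV)"
    using riesz_const_nonneg[OF q(2)] Lp_mass_nonneg by (simp add: ennreal_plus)
  finally show ?thesis .
qed

text \<open>First \<open>\<kappa>\<close> is chosen to make the vorticity part small, then \<open>r\<close> for the kernel part.\<close>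

lemma near_potential_small:
  assumes "i \<in> {1..N}" "0 < e"
  obtains r where "0 < r" "\<And>t z. 0 \<le> t \<Longrightarrow>
    near_potential (\<mu> i) (\<Phi> t) z r \<le> ennreal e"
proof -
  define \<kappa> where "\<kappa> = (e / (2 * (Lp_mass i + 1))) powr (1 / p)"
  have L: "0 < Lp_mass i + 1" using Lp_mass_nonneg[of i] by simp
  have \<kappa>: "0 < \<kappa>" using assms L by (simp add: \<kappa>_def)
  have "\<kappa> powr p = e / (2 * (Lp_mass i + 1))"
    using p assms L by (simp add: \<kappa>_def powr_powr)
  then have "\<kappa> powr p * (Lp_mass i + 1) = e / 2"
    using L by (simp add: nonzero_divide_eq_eq algebra_simps)
  then have far: "\<kappa> powr p * Lp_mass i \<le> e / 2"
    using mult_left_mono[of "Lp_mass i" "Lp_mass i + 1" "\<kappa> powr p"] by simp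
  define c where "c = riesz_const q * \<kappa> powr - q + 1"
  have c: "0 < c" using riesz_const_nonneg[OF q(2)] by (simp add: c_def add_nonneg_pos)
  define r where "r = (e / (2 * c)) powr (1 / (2 - q))"
  have r: "0 < r" using c assms by (simp add: r_def)
  have rq: "r powr (2 - q) = e / (2 * c)"
    using q c assms by (simp add: r_def powr_powr)
  have "riesz_const q * \<kappa> powr - q * r powr (2 - q) \<le> c * r powr (2 - q)"
    by (intro mult_right_mono) (auto simp: c_def)
  also have "\<dots> = e / 2"
    using c by (simp add: rq)
  finally have "riesz_const q * \<kappa> powr - q * r powr (2 - q) + \<kappa> powr p * Lp_mass i \<le> e"
    using far by simp
  then show ?thesis
    by (intro that[OF r] order_trans[OF near_potential_le[OF assms(1) _ \<kappa> r] ennreal_leI])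
qed

lemma integrable_kernel:
  assumes "i \<in> {1..N}" "0 \<le> t"
  shows "integrable (\<mu> i) (\<lambda>y. BS_kernel (z - \<Phi> t y))"
proof (rule integrableI_bounded)
  have [measurable]: "\<Phi> t \<in> borel_measurable borel" using assms by simp
  show "(\<lambda>y. BS_kernel (z - \<Phi> t y)) \<in> borel_measurable (\<mu> i)"
    by measurable
  have "(\<integral>\<^sup>+ y. ennreal (norm (BS_kernel (z - \<Phi> t y))) \<partial>\<mu> i) \<le> (\<integral>\<^sup>+ y. ennreal (1 / norm (z - \<Phi> t y)) \<partial>\<mu> i)"
    by (intro nn_integral_mono ennreal_leI norm_BS_kernel_le_inverse)
  also have "\<dots> < \<infinity>"
    using le_less_trans[OF potential_le[OF assms, of z] ennreal_less_top] by simp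
  finally show "(\<integral>\<^sup>+ y. ennreal (norm (BS_kernel (z - \<Phi> t y))) \<partial>\<mu> i) < \<infinity>" .
qed

lemma integrable_weighted_kernel:
  assumes "i \<in> {1..N}" "0 \<le> t"
  shows "integrable lborel (\<lambda>y. w i y *\<^sub>R BS_kernel (z - \<Phi> t y))"
proof -
  have [measurable]: "w i \<in> borel_measurable borel" "\<Phi> t \<in> borel_measurable borel"
    using assms by auto
  have "integrable lborel (\<lambda>y. \<bar>w i y\<bar> *\<^sub>R BS_kernel (z - \<Phi> t y))"
    using integrable_kernel[OF assms, of z] unfolding \<mu>_def by (subst (asm) integrable_density) auto
  then show ?thesis
    by (rule Bochner_Integration.integrable_bound) auto
qed

lemma path_continuous:
  assumes "x \<in> good"
  shows "continuous_on {0..} (\<lambda>t. \<Phi> t x)"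
  unfolding continuous_on_eq_continuous_within
proof
  fix t :: real assume "t \<in> {0..}"
  then have t: "0 \<le> t" by simp
  let ?g = "\<lambda>s. u s (\<Phi> s x)"
  have eq: "\<Phi> s x = x + integral {0..s} ?g" if "0 \<le> s" for s
    using assms that by (auto simp: good_def set_borel_integral_eq_integral)
  have "?g integrable_on {0..t + 1}"
    using assms t by (intro set_borel_integral_eq_integral(1)) (auto simp: good_def)
  then have "continuous_on {0..t + 1} (\<lambda>s. x + integral {0..s} ?g)"
    by (intro continuous_intros indefinite_integral_continuous_1)
  then have "continuous_on {0..t + 1} (\<lambda>s. \<Phi> s x)"
    by (rule continuous_on_eq) (simp add: eq)
  then show "continuous (at t within {0..}) (\<lambda>s. \<Phi> s x)"
    using t by (simp add: at_within_nonneg_eq continuous_on_eq_continuous_within)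
qed

text \<open>The velocity is continuous along every continuous path: it is the uniform limit of the
  velocities that belong to the truncated kernels, and these are continuous since the paths of the
  particles are.\<close>

lemma velocity_continuous:
  assumes i: "i \<in> {1..N}" and \<zeta>: "continuous_on {0..} \<zeta>"
  shows "continuous_on {0..} (\<lambda>t. \<integral>y. BS_kernel (\<zeta> t - \<Phi> t y) \<partial>\<mu> i)"
proof -
  interpret finite_measure "\<mu> i" by (rule finite_\<mu>[OF i])
  have ex: "\<forall>n. \<exists>r>0. \<forall>t\<ge>0. \<forall>z. near_potential (\<mu> i) (\<Phi> t) z r
      \<le> ennreal (1 / Suc n)"
  proof
    fix n
    have "0 < 1 / real (Suc n)" by simp
    then obtain r where "0 < r" "\<And>t z. 0 \<le> t \<Longrightarrow>
        near_potential (\<mu> i) (\<Phi> t) z r \<le> ennreal (1 / Suc n)"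
      by (rule near_potential_small[OF i]) blast
    then show "\<exists>r>0. \<forall>t\<ge>0. \<forall>z. near_potential (\<mu> i) (\<Phi> t) z r
      \<le> ennreal (1 / Suc n)"
      by blast
  qed
  obtain r where r': "\<forall>n. 0 < r n \<and> (\<forall>t\<ge>0. \<forall>z.
      near_potential (\<mu> i) (\<Phi> t) z (r n) \<le> ennreal (1 / Suc n))"
    using choice[OF ex] by (elim exE)
  then have r: "\<And>n. 0 < r n" and near: "\<And>n t z. 0 \<le> t \<Longrightarrow>
      near_potential (\<mu> i) (\<Phi> t) z (r n) \<le> ennreal (1 / Suc n)"
    by simp_all
  have [measurable]: "truncated_kernel (r n) \<in> borel_measurable borel" for n
    by (intro borel_measurable_continuous_onI continuous_on_truncated_kernel r)
  have intT: "integrable (\<mu> i) (\<lambda>y. truncated_kernel (r n) (z - \<Phi> t y))" if "0 \<le> t" for n z t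
    using that \<Phi>_measurable[OF that] norm_truncated_kernel_le[OF r[of n]]
    by (intro integrable_const_bound[where B = "1 / r n"]) auto
  have cont: "continuous_on {0..} (\<lambda>t. \<integral>y. truncated_kernel (r n) (\<zeta> t - \<Phi> t y) \<partial>\<mu> i)" for n
    unfolding continuous_on_sequentially o_def
  proof (intro ballI allI impI)
    fix X :: "nat \<Rightarrow> real" and t :: real
    assume t: "t \<in> {0..}" and "(\<forall>k. X k \<in> {0..}) \<and> X \<longlonglongrightarrow> t"
    then have X: "\<And>k. 0 \<le> X k" "X \<longlonglongrightarrow> t" by auto
    have \<Phi>X [measurable]: "\<Phi> (X k) \<in> borel_measurable borel" "\<Phi> t \<in> borel_measurable borel" for k
      using X t by auto
    show "(\<lambda>k. \<integral>y. truncated_kernel (r n) (\<zeta> (X k) - \<Phi> (X k) y) \<partial>\<mu> i)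
        \<longlonglongrightarrow> (\<integral>y. truncated_kernel (r n) (\<zeta> t - \<Phi> t y) \<partial>\<mu> i)"
    proof (rule integral_dominated_convergence[where w = "\<lambda>_. 1 / r n"])
      have "AE y in \<mu> i. y \<in> good"
        by (rule AE_\<mu>[OF i]) (use AE_good in auto)
      then show "AE y in \<mu> i. (\<lambda>k. truncated_kernel (r n) (\<zeta> (X k) - \<Phi> (X k) y))
          \<longlonglongrightarrow> truncated_kernel (r n) (\<zeta> t - \<Phi> t y)"
      proof eventually_elim
        case (elim y)
        have "continuous_on {0..} (\<lambda>t. \<zeta> t - \<Phi> t y)"
          by (intro continuous_intros \<zeta> path_continuous elim)
        then have "continuous_on {0..} (\<lambda>t. truncated_kernel (r n) (\<zeta> t - \<Phi> t y))"
          by (rule continuous_on_compose2[OF continuous_on_truncated_kernel[OF r]]) auto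
        then show ?case
          using X t unfolding continuous_on_sequentially o_def by auto
      qed
      show "AE y in \<mu> i. norm (truncated_kernel (r n) (\<zeta> (X k) - \<Phi> (X k) y)) \<le> 1 / r n" for k
        using norm_truncated_kernel_le[OF r[of n]] by simp
    qed (auto intro: integrable_const)
  qed
  have "uniform_limit {0..} (\<lambda>n t. \<integral>y. truncated_kernel (r n) (\<zeta> t - \<Phi> t y) \<partial>\<mu> i)
      (\<lambda>t. \<integral>y. BS_kernel (\<zeta> t - \<Phi> t y) \<partial>\<mu> i) sequentially"
  proof (rule uniform_limitI)
    fix e :: real assume "0 < e"
    have diff: "dist (\<integral>y. truncated_kernel (r n) (\<zeta> t - \<Phi> t y) \<partial>\<mu> i) (\<integral>y. BS_kernel (\<zeta> t - \<Phi> t y) \<partial>\<mu> i)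
        \<le> 1 / Suc n" if t: "t \<in> {0..}" for n t
    proof -
      have t0: "0 \<le> t" using t by simp
      let ?d = "\<lambda>y. BS_kernel (\<zeta> t - \<Phi> t y) - truncated_kernel (r n) (\<zeta> t - \<Phi> t y)"
      have int: "integrable (\<mu> i) ?d"
        by (intro Bochner_Integration.integrable_diff integrable_kernel[OF i] intT t0)
      have "ennreal (norm (\<integral>y. ?d y \<partial>\<mu> i)) \<le> (\<integral>\<^sup>+ y. ennreal (norm (?d y)) \<partial>\<mu> i)"
        by (rule integral_norm_bound_ennreal[OF int])
      also have "\<dots> \<le> near_potential (\<mu> i) (\<Phi> t) (\<zeta> t) (r n)"
      proof (rule nn_integral_mono)
        fix y
        have "ennreal (norm (?d y)) \<le> ennreal (indicator (ball 0 (r n)) (\<zeta> t - \<Phi> t y) * (1 / norm (\<zeta> t - \<Phi> t y)))"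
          by (intro ennreal_leI norm_truncated_kernel_diff_le r)
        also have "\<dots> = indicator (ball (\<zeta> t) (r n)) (\<Phi> t y) * ennreal (1 / norm (\<zeta> t - \<Phi> t y))"
          by (auto simp: indicator_def dist_norm norm_minus_commute)
        finally show "ennreal (norm (?d y)) \<le> indicator (ball (\<zeta> t) (r n)) (\<Phi> t y) * ennreal (1 / norm (\<zeta> t - \<Phi> t y))" .
      qed
      also have "\<dots> \<le> ennreal (1 / Suc n)"
        by (rule near[OF t0])
      finally have "norm (\<integral>y. ?d y \<partial>\<mu> i) \<le> 1 / Suc n"
        by (subst (asm) ennreal_le_iff) auto
      then show ?thesis
        using integrable_kernel[OF i t0, of "\<zeta> t"] intT[OF t0, of n "\<zeta> t"] by (simp add: dist_norm norm_minus_commute)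
    qed
    obtain m where m: "1 / Suc m < e"
      using \<open>0 < e\<close> nat_approx_posE by metis
    show "\<forall>\<^sub>F n in sequentially. \<forall>t\<in>{0..}. dist (\<integral>y. truncated_kernel (r n) (\<zeta> t - \<Phi> t y) \<partial>\<mu> i)
        (\<integral>y. BS_kernel (\<zeta> t - \<Phi> t y) \<partial>\<mu> i) < e"
      unfolding eventually_sequentially
    proof (intro exI[of _ m] allI impI ballI)
      fix n and t :: real assume "m \<le> n" and t: "t \<in> {0..}"
      have "1 / real (Suc n) \<le> 1 / real (Suc m)"
        using \<open>m \<le> n\<close> by (intro frac_le) auto
      then show "dist (\<integral>y. truncated_kernel (r n) (\<zeta> t - \<Phi> t y) \<partial>\<mu> i)
          (\<integral>y. BS_kernel (\<zeta> t - \<Phi> t y) \<partial>\<mu> i) < e"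
        using diff[OF t, of n] m by linarith
    qed
  qed
  then show ?thesis
    by (rule uniform_limit_theorem[rotated]) (use cont in auto)
qed

lemma u_eq_\<mu>:
  assumes "0 \<le> t"
  shows "u t z = (\<Sum>j=1..N. \<sigma> j *\<^sub>R (\<integral>y. BS_kernel (z - \<Phi> t y) \<partial>\<mu> j))"
proof -
  have [measurable]: "\<Phi> t \<in> borel_measurable borel" using assms by simp
  show ?thesis
    unfolding u_eq[OF assms] scaleR_sum_left
    using integrable_weighted_kernel[OF _ assms]
    by (subst Bochner_Integration.integral_sum) (auto intro!: sum.cong integral_\<mu>)
qed

text \<open>As the velocity is continuous along trajectories, the integral equation for the trajectories can be
  differentiated at every time.\<close>

lemma vortex_flow: "\<exists>P. vortex_flow N \<mu> \<sigma> \<Phi> (\<lambda>i. A i \<inter> good) P"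
proof -
  define P where "P = (\<Sum>i=1..N. riesz_const q + Lp_mass i + measure (\<mu> i) UNIV)"
  have nonneg: "0 \<le> riesz_const q + Lp_mass i + measure (\<mu> i) UNIV" for i
    using riesz_const_nonneg[OF q(2)] Lp_mass_nonneg by simp
  have "vortex_flow N \<mu> \<sigma> \<Phi> (\<lambda>i. A i \<inter> good) P"
  proof (rule vortex_flow.intro)
    show "finite_measure (\<mu> i)" if "i \<in> {1..N}" for i
      by (rule finite_\<mu>[OF that])
    show "sets (\<mu> i) = sets borel" "\<bar>\<sigma> i\<bar> = 1" for i
      by (simp_all add: sign)
    show "\<Phi> t \<in> borel_measurable borel" if "0 \<le> t" for t
      by (rule \<Phi>_measurable[OF that])
    show "0 \<le> P"
      unfolding P_def by (intro sum_nonneg nonneg)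
    show "(\<integral>\<^sup>+ y. ennreal (1 / norm (z - \<Phi> t y)) \<partial>\<mu> i) \<le> ennreal P" if "i \<in> {1..N}" "0 \<le> t" for i t z
    proof -
      have "riesz_const q + Lp_mass i + measure (\<mu> i) UNIV \<le> P"
        unfolding P_def using that nonneg by (intro member_le_sum) auto
      then show ?thesis
        using potential_le[OF that, of z] by (meson ennreal_leI order_trans)
    qed
    show "AE x in \<mu> i. x \<in> A i \<inter> good" if "i \<in> {1..N}" for i
      by (rule AE_\<mu>[OF that]) (use AE_A[OF that] AE_good in eventually_elim, auto)
    fix i x t assume x: "x \<in> A i \<inter> good" and t: "(0::real) \<le> t"
    let ?g = "\<lambda>s. u s (\<Phi> s x)"
    have cont: "continuous_on {0..} ?g"
    proof (rule continuous_on_eq)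
      show "continuous_on {0..} (\<lambda>s. \<Sum>j=1..N. \<sigma> j *\<^sub>R (\<integral>y. BS_kernel (\<Phi> s x - \<Phi> s y) \<partial>\<mu> j))"
        using x by (intro continuous_intros velocity_continuous path_continuous) auto
    qed (simp add: u_eq_\<mu>)
    have eq: "\<Phi> s x = x + integral {0..s} ?g" if "0 \<le> s" for s
      using x that by (auto simp: good_def set_borel_integral_eq_integral)
    have "((\<lambda>s. x + integral {0..s} ?g) has_vector_derivative 0 + ?g t) (at t within {0..t + 1})"
      using t by (intro has_vector_derivative_add has_vector_derivative_const integral_has_vector_derivative
          continuous_on_subset[OF cont]) auto
    then have "((\<lambda>s. \<Phi> s x) has_vector_derivative 0 + ?g t) (at t within {0..t + 1})"
      by (rule has_vector_derivative_transform[rotated 2]) (use t eq in auto)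
    then show "((\<lambda>t. \<Phi> t x) has_vector_derivative
        (\<Sum>j=1..N. \<sigma> j *\<^sub>R (\<integral>y. BS_kernel (\<Phi> t x - \<Phi> t y) \<partial>\<mu> j))) (at t within {0..})"
      using t by (simp add: at_within_nonneg_eq u_eq_\<mu>)
  qed
  then show ?thesis by blast
qed

end

section \<open>Admissible solutions\<close>

lemma (in vortex_flow) has_vector_derivative_integral_position:
  assumes i: "i \<in> {1..N}" and init: "\<And>x. x \<in> G i \<Longrightarrow> norm (\<Phi> 0 x) \<le> B" and t: "0 \<le> t"
  shows "((\<lambda>t. \<integral>x. \<Phi> t x \<partial>\<mu> i) has_vector_derivative (\<integral>x. u t (\<Phi> t x) \<partial>\<mu> i)) (at t within {0..})"
proof (rule has_vector_derivative_integral[OF finite[OF i]])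
  fix s :: real assume s: "s \<in> {0..}"
  show "integrable (\<mu> i) (\<Phi> s)"
  proof (rule integrable_bounded[OF i, where B = "B + real N * P * s"])
    fix x assume x: "x \<in> G i"
    show "norm (\<Phi> s x) \<le> B + real N * P * s"
      using norm_triangle_ineq[of "\<Phi> s x - \<Phi> 0 x" "\<Phi> 0 x"] trajectory_lipschitz[OF i x, of 0 s] init[OF x] s
      by simp
  qed (use s in auto)
next
  have [measurable]: "\<Phi> t \<in> borel_measurable (\<mu> i)" "u t \<in> borel_measurable borel"
    using t by auto
  show "(\<lambda>x. u t (\<Phi> t x)) \<in> borel_measurable (\<mu> i)"
    by measurable
  show "AE x in \<mu> i. \<forall>s\<in>{0..}. ((\<lambda>s. \<Phi> s x) has_vector_derivative u s (\<Phi> s x)) (at s within {0..})"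
    using AE_G[OF i] by eventually_elim (auto intro: trajectory' i)
  show "AE x in \<mu> i. \<forall>s\<in>{0..}. norm (u s (\<Phi> s x)) \<le> real N * P"
    by (auto intro!: norm_u_le)
qed (use t in auto)

text \<open>The flow of an admissible solution.  Transport by the measure preserving map \<open>\<Phi> t\<close> expresses the
  velocity and the vorticity centers by the initial data.\<close>

locale admissible_flow =
  fixes N :: nat and p \<gamma> \<Lambda> \<delta> R :: real and a :: "nat \<Rightarrow> real" and Y0 :: "nat \<Rightarrow> plane" and \<epsilon> :: real
    and \<omega> :: "real \<Rightarrow> plane \<Rightarrow> real" and \<omega>i :: "nat \<Rightarrow> real \<Rightarrow> plane \<Rightarrow> real"
    and \<omega>0 :: "nat \<Rightarrow> plane \<Rightarrow> real" and \<Phi> :: "real \<Rightarrow> plane \<Rightarrow> plane"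
  assumes p: "2 < p" and \<gamma>: "0 < \<gamma>" and \<Lambda>: "0 < \<Lambda>" and R: "0 < R" and R_le: "16 * R \<le> \<delta>"
    and a: "i \<in> {1..N} \<Longrightarrow> a i \<noteq> 0" and \<epsilon>: "0 < \<epsilon>" "\<epsilon> \<le> 1" "8 * \<epsilon> \<le> R"
    and data: "admissible_initial_data N p \<gamma> \<Lambda> \<delta> R a Y0 \<epsilon> \<omega>0"
    and \<omega>_Lp: "Lp_continuous p \<omega>" and \<omega>i_Lp: "i \<in> {1..N} \<Longrightarrow> Lp_continuous p (\<omega>i i)"
    and lagrangian: "lagrangian_flow (BS_velocity \<omega>) \<Phi>"
    and transported: "transported_by \<Phi> \<omega> (\<lambda>x. \<Sum>i=1..N. \<omega>0 i x)"
      "i \<in> {1..N} \<Longrightarrow> transported_by \<Phi> (\<omega>i i) (\<omega>0 i)"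
begin

definition \<sigma> :: "nat \<Rightarrow> real" where
  "\<sigma> i = (if 0 < a i then 1 else - 1)"

definition A :: "nat \<Rightarrow> plane set" where
  "A i = ball (center (a i) (\<omega>0 i)) R"

lemma \<sigma>_a: "\<sigma> i * a i = \<bar>a i\<bar>"
  by (simp add: \<sigma>_def)

lemma integral_\<omega>0: "i \<in> {1..N} \<Longrightarrow> (\<integral>x. \<omega>0 i x \<partial>lborel) = a i"
  using data by (auto simp: admissible_initial_data_def)

lemma spt_subset: "i \<in> {1..N} \<Longrightarrow> spt (\<omega>0 i) \<subseteq> A i"
  using data by (auto simp: admissible_initial_data_def A_def)

lemma spt_setdist: "i \<in> {1..N} \<Longrightarrow> j \<in> {1..N} \<Longrightarrow> i \<noteq> j \<Longrightarrow> \<delta> \<le> setdist (spt (\<omega>0 i)) (spt (\<omega>0 j))"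
  using data by (auto simp: admissible_initial_data_def)

lemma integral_transported:
  fixes f :: "plane \<Rightarrow> 'b::{banach, second_countable_topology}"
  assumes "0 \<le> t" and g: "g t \<in> borel_measurable lborel" and tr: "transported_by \<Phi> g g0"
    and g0: "g0 \<in> borel_measurable lborel" and f: "f \<in> borel_measurable borel"
  shows "(\<integral>y. g t y *\<^sub>R f y \<partial>lborel) = (\<integral>y. g0 y *\<^sub>R f (\<Phi> t y) \<partial>lborel)"
proof -
  have \<Phi>: "\<Phi> t \<in> measurable lborel lborel" "distr lborel lborel (\<Phi> t) = lborel"
    using lagrangian assms(1) by (auto simp: lagrangian_flow_def)
  have [measurable]: "\<Phi> t \<in> borel_measurable borel" "g t \<in> borel_measurable borel"
    "g0 \<in> borel_measurable borel" "f \<in> borel_measurable borel"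
    using \<Phi>(1) g g0 f by auto
  have "(\<integral>y. g t y *\<^sub>R f y \<partial>lborel) = (\<integral>y. g t y *\<^sub>R f y \<partial>distr lborel lborel (\<Phi> t))"
    by (simp add: \<Phi>(2))
  also have "\<dots> = (\<integral>y. g t (\<Phi> t y) *\<^sub>R f (\<Phi> t y) \<partial>lborel)"
    by (rule integral_distr[OF \<Phi>(1)]) auto
  also have "\<dots> = (\<integral>y. g0 y *\<^sub>R f (\<Phi> t y) \<partial>lborel)"
    using tr assms(1) by (intro integral_cong_AE) (auto simp: transported_by_def)
  finally show ?thesis .
qed

lemma \<omega>0_integrable: "i \<in> {1..N} \<Longrightarrow> integrable lborel (\<omega>0 i)"
  using integral_\<omega>0[of i] a[of i] not_integrable_integral_eq by fastforce

lemma \<omega>0_sign: "i \<in> {1..N} \<Longrightarrow> AE x in lborel. \<omega>0 i x = \<sigma> i * \<bar>\<omega>0 i x\<bar>"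
proof -
  assume i: "i \<in> {1..N}"
  then have "(AE x in lborel. 0 \<le> \<omega>0 i x) \<or> (AE x in lborel. \<omega>0 i x \<le> 0)"
    using data by (auto simp: admissible_initial_data_def)
  then show ?thesis
  proof
    assume pos: "AE x in lborel. 0 \<le> \<omega>0 i x"
    have "0 \<le> a i"
      using integral_nonneg_AE[OF pos] integral_\<omega>0[OF i] by simp
    then have "\<sigma> i = 1" using a[OF i] by (simp add: \<sigma>_def)
    then show ?thesis using pos by auto
  next
    assume neg: "AE x in lborel. \<omega>0 i x \<le> 0"
    have "0 \<le> (\<integral>x. - \<omega>0 i x \<partial>lborel)"
      using neg by (intro integral_nonneg_AE) auto
    then have "a i \<le> 0"
      using integral_\<omega>0[OF i] by simp
    then have "\<sigma> i = - 1" by (simp add: \<sigma>_def)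
    then show ?thesis using neg by auto
  qed
qed

lemma AE_\<omega>0_A: "i \<in> {1..N} \<Longrightarrow> AE x in lborel. \<omega>0 i x \<noteq> 0 \<longrightarrow> x \<in> A i"
  using AE_mem_spt[of "\<omega>0 i"] spt_subset[of i] by (auto elim: eventually_mono)

sublocale lagrangian_vortices N p \<omega>0 \<sigma> "BS_velocity \<omega>" \<Phi> A
proof
  fix i assume i: "i \<in> {1..N}"
  show "integrable lborel (\<omega>0 i)"
    by (rule \<omega>0_integrable[OF i])
  show "integrable lborel (\<lambda>x. \<bar>\<omega>0 i x\<bar> powr p)"
    using data i by (auto simp: admissible_initial_data_def Lp_space_def)
  show "AE x in lborel. \<omega>0 i x = \<sigma> i * \<bar>\<omega>0 i x\<bar>"
    by (rule \<omega>0_sign[OF i])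
  show "AE x in lborel. \<omega>0 i x \<noteq> 0 \<longrightarrow> x \<in> A i"
    by (rule AE_\<omega>0_A[OF i])
next
  fix t :: real and z :: plane assume t: "0 \<le> t"
  show "BS_velocity \<omega> t z = (\<integral>y. (\<Sum>j=1..N. \<omega>0 j y) *\<^sub>R BS_kernel (z - \<Phi> t y) \<partial>lborel)"
    unfolding BS_velocity_def
  proof (rule integral_transported[OF t _ transported(1)])
    show "\<omega> t \<in> borel_measurable lborel"
      using \<omega>_Lp t by (auto simp: Lp_continuous_def Lp_space_def)
    show "(\<lambda>x. \<Sum>i=1..N. \<omega>0 i x) \<in> borel_measurable lborel"
      using \<omega>0_integrable by (intro borel_measurable_sum) auto
  qed measurable
qed (use p lagrangian in \<open>auto simp: \<sigma>_def\<close>)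

lemma measure_\<mu>: "i \<in> {1..N} \<Longrightarrow> measure (\<mu> i) UNIV = \<bar>a i\<bar>"
proof -
  assume i: "i \<in> {1..N}"
  have "a i = \<sigma> i * measure (\<mu> i) UNIV"
    using integral_\<mu>[OF i, of "\<lambda>_. 1 :: real"] integral_\<omega>0[OF i] by simp
  then show ?thesis
    using \<sigma>_a[of i] sign[of i] by (metis abs_mult abs_of_nonneg measure_nonneg mult_1)
qed

lemma AE_\<mu>_A: "i \<in> {1..N} \<Longrightarrow> AE x in \<mu> i. x \<in> A i"
  by (rule AE_\<mu>[OF _ AE_\<omega>0_A])

lemma integrable_\<mu>_bounded_on_A:
  fixes f :: "plane \<Rightarrow> 'b::{banach, second_countable_topology}"
  assumes i: "i \<in> {1..N}" and "f \<in> borel_measurable borel" and "\<And>x. x \<in> A i \<Longrightarrow> norm (f x) \<le> B"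
  shows "integrable (\<mu> i) f"
  using AE_\<mu>_A[OF i] assms
  by (intro finite_measure_integrable_bound[OF finite_\<mu>[OF i], where B = B]) (auto elim: eventually_mono)

lemma norm_diff_center_le:
  assumes "x \<in> A i"
  shows "norm (x - y) \<le> R + norm (center (a i) (\<omega>0 i) - y)"
  using norm_triangle_ineq[of "x - center (a i) (\<omega>0 i)" "center (a i) (\<omega>0 i) - y"] assms
  by (simp add: A_def dist_norm norm_minus_commute)

lemma integrable_powers:
  assumes "i \<in> {1..N}"
  shows "integrable (\<mu> i) (\<lambda>x. x - y)" "integrable (\<mu> i) (\<lambda>x. norm (x - y))" "integrable (\<mu> i) (\<lambda>x. (norm (x - y))\<^sup>2)"
proof -
  show 1: "integrable (\<mu> i) (\<lambda>x. x - y)"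
    by (rule integrable_\<mu>_bounded_on_A[OF assms _ norm_diff_center_le]) auto
  then show "integrable (\<mu> i) (\<lambda>x. norm (x - y))"
    by (rule integrable_norm)
  show "integrable (\<mu> i) (\<lambda>x. (norm (x - y))\<^sup>2)"
    using power_mono[OF norm_diff_center_le norm_ge_zero, of _ i y 2]
    by (intro integrable_\<mu>_bounded_on_A[OF assms, where B = "(R + norm (center (a i) (\<omega>0 i) - y))\<^sup>2"]) auto
qed

lemma initial_second_moment_le:
  assumes i: "i \<in> {1..N}"
  shows "(\<integral>x. (norm (x - Y0 i))\<^sup>2 \<partial>\<mu> i) \<le> \<bar>a i\<bar> * \<epsilon>\<^sup>2"
proof -
  let ?S = "\<integral>x. (norm (x - Y0 i))\<^sup>2 \<partial>\<mu> i"
  have "(\<integral>x. (norm (x - Y0 i))\<^sup>2 * \<omega>0 i x \<partial>lborel) = \<sigma> i * ?S"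
    using integral_\<mu>[OF i, of "\<lambda>x. (norm (x - Y0 i))\<^sup>2"] by (simp add: mult.commute)
  then have "W2_atom (\<omega>0 i) (Y0 i) = sqrt (1 / a i * (\<sigma> i * ?S))"
    by (simp add: W2_atom_def integral_\<omega>0[OF i])
  also have "1 / a i * (\<sigma> i * ?S) = ?S / \<bar>a i\<bar>"
    using a[OF i] by (auto simp: \<sigma>_def)
  finally have W2: "W2_atom (\<omega>0 i) (Y0 i) = sqrt (?S / \<bar>a i\<bar>)" .
  have "W2_atom (\<omega>0 i) (Y0 i) \<le> \<epsilon>"
    using data i by (auto simp: admissible_initial_data_def)
  then have "sqrt (?S / \<bar>a i\<bar>) \<le> \<epsilon>"
    by (simp only: W2)
  then have "?S / \<bar>a i\<bar> \<le> \<epsilon>\<^sup>2"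
    using \<epsilon>(1) by (intro sqrt_le_D) auto
  then show ?thesis
    using a[OF i] by (simp add: divide_le_eq mult.commute)
qed

text \<open>The \<open>W\<^sub>2\<close> bound controls the second moment about \<open>Y0 i\<close>, and thereby the first one.\<close>

lemma center_near:
  assumes i: "i \<in> {1..N}"
  shows "norm (center (a i) (\<omega>0 i) - Y0 i) \<le> \<epsilon>"
proof -
  interpret finite_measure "\<mu> i" by (rule finite_\<mu>[OF i])
  let ?B = "\<integral>x. norm (x - Y0 i) \<partial>\<mu> i"
  have "integrable (\<mu> i) (\<lambda>x. x)"
    using integrable_powers(1)[OF i, of 0] by simp
  then have "(\<integral>x. x - Y0 i \<partial>\<mu> i) = (\<integral>x. x \<partial>\<mu> i) - \<bar>a i\<bar> *\<^sub>R Y0 i"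
    by (simp add: measure_\<mu>[OF i])
  also have "\<dots> = \<bar>a i\<bar> *\<^sub>R (center (a i) (\<omega>0 i) - Y0 i)"
    using a[OF i] integral_\<mu>[OF i, of "\<lambda>x. x"] by (auto simp: center_def \<sigma>_def scaleR_diff_right)
  finally have "\<bar>a i\<bar> * norm (center (a i) (\<omega>0 i) - Y0 i) = norm (\<integral>x. x - Y0 i \<partial>\<mu> i)"
    by simp
  also have "\<dots> \<le> ?B"
    by (rule integral_norm_bound)
  also have "?B \<le> \<bar>a i\<bar> * \<epsilon>"
  proof (rule power2_le_imp_le)
    have "?B\<^sup>2 \<le> \<bar>a i\<bar> * (\<integral>x. (norm (x - Y0 i))\<^sup>2 \<partial>\<mu> i)"
      using integral_square_le[OF integrable_powers(2,3)[OF i]] by (simp add: measure_\<mu>[OF i])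
    also have "\<dots> \<le> \<bar>a i\<bar> * (\<bar>a i\<bar> * \<epsilon>\<^sup>2)"
      by (intro mult_left_mono initial_second_moment_le[OF i]) auto
    finally show "?B\<^sup>2 \<le> (\<bar>a i\<bar> * \<epsilon>)\<^sup>2"
      by (simp add: power2_eq_square algebra_simps)
  qed (use \<epsilon> in auto)
  finally show ?thesis
    using a[OF i] by (simp add: mult_le_cancel_left)
qed

lemma flow_at_0: "x \<in> good \<Longrightarrow> \<Phi> 0 x = x"
proof -
  assume "x \<in> good"
  then have "\<Phi> 0 x = x + (LINT s:{0..0}|lborel. BS_velocity \<omega> s (\<Phi> s x))"
    unfolding good_def by blast
  also have "(LINT s:{0..0::real}|lborel. BS_velocity \<omega> s (\<Phi> s x)) = 0"
    unfolding set_lebesgue_integral_def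
  proof (rule integral_eq_zero_AE)
    show "AE s in lborel. indicator {0..0::real} s *\<^sub>R BS_velocity \<omega> s (\<Phi> s x) = 0"
      using AE_lborel_singleton[of "0::real"] by eventually_elim simp
  qed
  finally show ?thesis by simp
qed

lemma initially_near:
  assumes i: "i \<in> {1..N}" and "x \<in> A i \<inter> good"
  shows "norm (\<Phi> 0 x - Y0 i) \<le> 9 / 8 * R"
  using norm_diff_center_le[of x i "Y0 i"] center_near[OF i] assms \<epsilon> flow_at_0[of x] by simp

lemma spt_nonempty: "i \<in> {1..N} \<Longrightarrow> spt (\<omega>0 i) \<noteq> {}"
proof
  assume i: "i \<in> {1..N}" and "spt (\<omega>0 i) = {}"
  then have "AE x in lborel. \<omega>0 i x = 0"
    using AE_mem_spt[of "\<omega>0 i"] by simp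
  then have "(\<integral>x. \<omega>0 i x \<partial>lborel) = (\<integral>x. 0 \<partial>(lborel :: plane measure))"
    using \<omega>0_integrable[OF i] by (intro integral_cong_AE) auto
  then show False
    using integral_\<omega>0[OF i] a[OF i] by simp
qed

text \<open>The separation of the initial supports passes to the initial point vortices, since each support
  lies in a disc of radius \<open>R\<close> whose center is within \<open>\<epsilon>\<close> of the point vortex.\<close>

lemma Y0_separated:
  assumes ij: "i \<in> {1..N}" "j \<in> {1..N}" "i \<noteq> j"
  shows "6 * R \<le> norm (Y0 i - Y0 j)"
proof -
  obtain x y where xy: "x \<in> spt (\<omega>0 i)" "y \<in> spt (\<omega>0 j)"
    using spt_nonempty ij by blast
  have "16 * R \<le> dist x y"
    using R_le spt_setdist[OF ij] setdist_le_dist[OF xy] by linarith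
  moreover have "x \<in> A i" "y \<in> A j"
    using xy spt_subset ij by auto
  then have "norm (x - Y0 i) \<le> R + \<epsilon>" "norm (y - Y0 j) \<le> R + \<epsilon>"
    using norm_diff_center_le center_near ij by (meson add_left_mono order_trans)+
  moreover have "x - y = (x - Y0 i) + (Y0 i - Y0 j) - (y - Y0 j)"
    by simp
  then have "norm (x - y) \<le> norm (x - Y0 i) + norm (Y0 i - Y0 j) + norm (y - Y0 j)"
    by (metis norm_add_diff_le)
  ultimately show ?thesis
    using \<epsilon> R by (simp add: dist_norm)
qed

text \<open>As the initial supports are disjoint, the bound on the total vorticity is inherited by each
  vortex.\<close>

lemma Lp_mass_le:
  assumes i: "i \<in> {1..N}"
  shows "Lp_mass i \<le> (\<Lambda> * \<epsilon> powr - \<gamma>) powr p"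
proof -
  let ?s = "\<lambda>x. \<Sum>j=1..N. \<omega>0 j x"
  have "AE x in lborel. \<forall>j\<in>{1..N}. \<omega>0 j x \<noteq> 0 \<longrightarrow> x \<in> spt (\<omega>0 j)"
    by (intro AE_finite_allI) (use AE_mem_spt in auto)
  then have "AE x in lborel. \<bar>?s x\<bar> powr p = (\<Sum>j=1..N. \<bar>\<omega>0 j x\<bar> powr p)"
  proof eventually_elim
    case (elim x)
    show ?case
    proof (cases "\<exists>k\<in>{1..N}. \<omega>0 k x \<noteq> 0")
      case True
      then obtain k where k: "k \<in> {1..N}" "\<omega>0 k x \<noteq> 0" by blast
      have zero: "\<omega>0 j x = 0" if "j \<in> {1..N} - {k}" for j
      proof (rule ccontr)
        assume "\<omega>0 j x \<noteq> 0"
        then have "x \<in> spt (\<omega>0 j)" "x \<in> spt (\<omega>0 k)"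
          using elim k that by auto
        then have "setdist (spt (\<omega>0 j)) (spt (\<omega>0 k)) \<le> 0"
          using setdist_le_dist by fastforce
        then show False
          using spt_setdist[of j k] that k R R_le by auto
      qed
      have "?s x = \<omega>0 k x"
        using zero by (subst sum.remove[OF _ k(1)]) auto
      moreover have "(\<Sum>j=1..N. \<bar>\<omega>0 j x\<bar> powr p) = \<bar>\<omega>0 k x\<bar> powr p"
        using zero by (subst sum.remove[OF _ k(1)]) auto
      ultimately show ?thesis by simp
    qed (use p in auto)
  qed
  moreover have "?s \<in> borel_measurable lborel"
    using \<omega>0_integrable by (intro borel_measurable_sum) auto
  ultimately have "(\<integral>x. \<bar>?s x\<bar> powr p \<partial>lborel) = (\<integral>x. (\<Sum>j=1..N. \<bar>\<omega>0 j x\<bar> powr p) \<partial>lborel)"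
    using w_Lp by (intro integral_cong_AE) (auto intro!: borel_measurable_sum)
  also have "\<dots> = (\<Sum>j=1..N. Lp_mass j)"
    unfolding Lp_mass_def using w_Lp by (intro Bochner_Integration.integral_sum) auto
  finally have "Lp_norm p ?s = (\<Sum>j=1..N. Lp_mass j) powr (1 / p)"
    by (simp add: Lp_norm_def)
  then have "(\<Sum>j=1..N. Lp_mass j) powr (1 / p) \<le> \<Lambda> * \<epsilon> powr - \<gamma>"
    using data by (auto simp: admissible_initial_data_def)
  then have "((\<Sum>j=1..N. Lp_mass j) powr (1 / p)) powr p \<le> (\<Lambda> * \<epsilon> powr - \<gamma>) powr p"
    using p by (intro powr_mono2) auto
  then have "(\<Sum>j=1..N. Lp_mass j) \<le> (\<Lambda> * \<epsilon> powr - \<gamma>) powr p"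
    using p Lp_mass_nonneg by (simp add: powr_powr sum_nonneg)
  moreover have "Lp_mass i \<le> (\<Sum>j=1..N. Lp_mass j)"
    using i Lp_mass_nonneg by (intro member_le_sum) auto
  ultimately show ?thesis by linarith
qed

lemma center_eq:
  assumes i: "i \<in> {1..N}" and t: "0 \<le> t"
  shows "center (a i) (\<omega>i i t) = (1 / \<bar>a i\<bar>) *\<^sub>R (\<integral>x. \<Phi> t x \<partial>\<mu> i)"
proof -
  have "(\<integral>x. \<omega>i i t x *\<^sub>R x \<partial>lborel) = (\<integral>x. \<omega>0 i x *\<^sub>R \<Phi> t x \<partial>lborel)"
  proof (rule integral_transported[OF t _ transported(2)[OF i]])
    show "\<omega>i i t \<in> borel_measurable lborel"
      using \<omega>i_Lp[OF i] t by (auto simp: Lp_continuous_def Lp_space_def)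
    show "\<omega>0 i \<in> borel_measurable lborel"
      using \<omega>0_integrable[OF i] by auto
  qed simp
  also have "\<dots> = \<sigma> i *\<^sub>R (\<integral>x. \<Phi> t x \<partial>\<mu> i)"
    by (rule integral_\<mu>[OF i \<Phi>_measurable[OF t]])
  finally show ?thesis
    using a[OF i] by (auto simp: center_def \<sigma>_def)
qed

text \<open>The radius \<open>\<epsilon> powr k\<close> at which the self-interaction is split is chosen such that the part from
  close particles stays bounded by the \<open>L\<^sup>p\<close> estimate.\<close>

lemma near_potential_bounded:
  assumes i: "i \<in> {1..N}" and t: "0 \<le> t"
  defines "k \<equiv> \<gamma> * q / (2 - q)"
  shows "near_potential (\<mu> i) (\<Phi> t) z (\<epsilon> powr k)
    \<le> ennreal (riesz_const q + \<Lambda> powr p)"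
proof (rule order_trans[OF near_potential_le[OF i t, where \<kappa> = "\<epsilon> powr \<gamma>"] ennreal_leI])
  have "k * (2 - q) = \<gamma> * q"
    using q by (simp add: k_def)
  then have "(\<epsilon> powr \<gamma>) powr - q * (\<epsilon> powr k) powr (2 - q) = 1"
    using \<epsilon> by (simp add: powr_powr powr_add[symmetric])
  then have "riesz_const q * (\<epsilon> powr \<gamma>) powr - q * (\<epsilon> powr k) powr (2 - q) = riesz_const q"
    by (simp add: mult.assoc)
  moreover have "(\<epsilon> powr \<gamma>) powr p * Lp_mass i \<le> \<Lambda> powr p"
  proof -
    have "(\<epsilon> powr \<gamma>) powr p * Lp_mass i \<le> (\<epsilon> powr \<gamma>) powr p * (\<Lambda> * \<epsilon> powr - \<gamma>) powr p"
      by (intro mult_left_mono Lp_mass_le[OF i]) auto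
    also have "\<dots> = (\<epsilon> powr \<gamma> * (\<Lambda> * \<epsilon> powr - \<gamma>)) powr p"
      using \<Lambda> by (subst powr_mult) auto
    also have "\<epsilon> powr \<gamma> * (\<Lambda> * \<epsilon> powr - \<gamma>) = \<Lambda>"
      using \<epsilon> by (simp add: powr_minus)
    finally show ?thesis .
  qed
  ultimately show "riesz_const q * (\<epsilon> powr \<gamma>) powr - q * (\<epsilon> powr k) powr (2 - q) + (\<epsilon> powr \<gamma>) powr p * Lp_mass i
      \<le> riesz_const q + \<Lambda> powr p"
    by linarith
qed (use \<epsilon> in auto)

text \<open>The exponent \<open>\<theta>\<close> of the weight is a multiple of \<open>ln (1 / \<epsilon>)\<close>: then the mass that is far from the
  point vortex is at most of order \<open>\<epsilon> powr k\<close>, the splitting radius for the self-interaction, while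
  \<open>\<theta>\<close> times the second moments of order \<open>\<epsilon>\<^sup>2\<close> still tends to zero.\<close>

lemma estimates:
  fixes T Mt m0 :: real
  defines "k \<equiv> \<gamma> * q / (2 - q)" and "H \<equiv> riesz_const q + \<Lambda> powr p"
  assumes T: "0 < T" "20 * Mt * T \<le> R\<^sup>2" "(3 * Mt / R + 2 * Mt + H) * T \<le> R / 8"
    and Mt: "(\<Sum>i=1..N. \<bar>a i\<bar>) \<le> Mt" and m0: "0 < m0" "\<And>i. i \<in> {1..N} \<Longrightarrow> m0 \<le> \<bar>a i\<bar>"
    and small: "768 * k * \<epsilon> \<le> R\<^sup>2"
    and Y: "point_vortex_solution N a Y0 T Y" and Y_near: "\<And>i t. i \<in> {1..N} \<Longrightarrow> t \<in> {0..T} \<Longrightarrow> norm (Y i t - Y0 i) \<le> R / 8"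
    and i: "i \<in> {1..N}" and t: "t \<in> {0..T}"
  defines "X \<equiv> \<lambda>s. center (a i) (\<omega>i i s)"
  shows "norm (X t - Y i t) \<le> 2 * Mt / m0 * \<epsilon>"
    and "X differentiable (at t within {0..})"
    and "norm (vector_derivative X (at t within {0..}) - vector_derivative (Y i) (at t within {0..T}))
      \<le> 2 * Mt\<^sup>2 * (real N + 1) / (m0 * R\<^sup>2) * \<epsilon>"
proof -
  have k: "0 < k" using \<gamma> q by (simp add: k_def)
  have H: "0 \<le> H" using riesz_const_nonneg[OF q(2)] by (simp add: H_def)
  have Mt0: "0 \<le> Mt" by (rule order_trans[OF sum_nonneg Mt]) auto
  obtain P where "vortex_flow N \<mu> \<sigma> \<Phi> (\<lambda>i. A i \<inter> good) P"
    using vortex_flow by blast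
  then interpret v: vortex_flow N \<mu> \<sigma> \<Phi> "\<lambda>i. A i \<inter> good" P .
  have mass: "v.mass i = \<bar>a i\<bar>" if "i \<in> {1..N}" for i
    using that by (simp add: v.mass_def measure_\<mu>)
  have \<sigma>_mass: "\<sigma> i * v.mass i = a i" if "i \<in> {1..N}" for i
    using mass[OF that] by (simp add: \<sigma>_def)
  define \<theta> where "\<theta> = 4 * k * ln (1 / \<epsilon>) / R\<^sup>2"
  have ln: "0 \<le> ln (1 / \<epsilon>)" "\<epsilon> * ln (1 / \<epsilon>) \<le> 1"
  proof -
    show "0 \<le> ln (1 / \<epsilon>)" using \<epsilon> by simp
    have "ln (1 / \<epsilon>) \<le> 1 / \<epsilon>"
      using ln_le_minus_one[of "1 / \<epsilon>"] \<epsilon> by simp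
    then show "\<epsilon> * ln (1 / \<epsilon>) \<le> 1"
      using \<epsilon>(1) mult_left_mono[of "ln (1 / \<epsilon>)" "1 / \<epsilon>" \<epsilon>] by simp
  qed
  have \<theta>: "0 \<le> \<theta>" using ln k by (simp add: \<theta>_def)
  have exp3: "exp (4 * Mt / R\<^sup>2 * s) \<le> 3" if "s \<le> T" for s
  proof -
    have "4 * Mt * s \<le> 4 * Mt * T"
      using that Mt0 by (intro mult_left_mono) auto
    also have "\<dots> \<le> R\<^sup>2"
      using T(2) Mt0 T(1) mult_nonneg_nonneg[of Mt T] by linarith
    finally have "4 * Mt / R\<^sup>2 * s \<le> 1"
      using R by (simp add: divide_le_eq)
    then have "exp (4 * Mt / R\<^sup>2 * s) \<le> exp 1"
      by simp
    then show ?thesis using exp_le by linarith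
  qed
  have Y_init: "Y j 0 = Y0 j" if "j \<in> {1..N}" for j
    using Y that by (auto simp: point_vortex_solution_def)
  have D0: "(\<Sum>j=1..N. \<integral>x. (norm (\<Phi> 0 x - Y j 0))\<^sup>2 \<partial>\<mu> j) \<le> Mt * \<epsilon>\<^sup>2"
  proof -
    have "(\<integral>x. (norm (\<Phi> 0 x - Y j 0))\<^sup>2 \<partial>\<mu> j) \<le> \<bar>a j\<bar> * \<epsilon>\<^sup>2" if j: "j \<in> {1..N}" for j
    proof -
      have [measurable]: "\<Phi> 0 \<in> borel_measurable borel" by simp
      have "(\<integral>x. (norm (\<Phi> 0 x - Y j 0))\<^sup>2 \<partial>\<mu> j) = (\<integral>x. (norm (x - Y0 j))\<^sup>2 \<partial>\<mu> j)"
      proof (rule integral_cong_AE)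
        show "AE x in \<mu> j. (norm (\<Phi> 0 x - Y j 0))\<^sup>2 = (norm (x - Y0 j))\<^sup>2"
          using v.AE_G[OF j] by eventually_elim (simp add: flow_at_0 Y_init[OF j])
      qed measurable
      then show ?thesis
        using initial_second_moment_le[OF j] by simp
    qed
    then have "(\<Sum>j=1..N. \<integral>x. (norm (\<Phi> 0 x - Y j 0))\<^sup>2 \<partial>\<mu> j) \<le> (\<Sum>j=1..N. \<bar>a j\<bar> * \<epsilon>\<^sup>2)"
      by (rule sum_mono)
    also have "\<dots> \<le> Mt * \<epsilon>\<^sup>2"
      unfolding sum_distrib_right[symmetric] using Mt by (rule mult_right_mono) simp
    finally show ?thesis .
  qed
  interpret c: confined_vortex_flow N \<mu> \<sigma> \<Phi> "\<lambda>i. A i \<inter> good" P Y0 Y R T Mt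
  proof (rule v.confined_vortex_flowI[OF R _ \<theta> _ H])
    show "0 \<le> T" using T by simp
    show "0 < \<epsilon> powr k" using \<epsilon> by simp
    show "6 * R \<le> norm (Y0 i - Y0 j)" if "i \<in> {1..N}" "j \<in> {1..N}" "i \<noteq> j" for i j
      by (rule Y0_separated[OF that])
    show "(Y i has_vector_derivative (\<Sum>j\<in>{1..N} - {i}. (\<sigma> j * v.mass j) *\<^sub>R BS_kernel (Y i t - Y j t))) (at t within {0..T})"
      if "i \<in> {1..N}" "t \<in> {0..T}" for i t
      using Y that by (auto simp: point_vortex_solution_def \<sigma>_mass)
    show "(\<Sum>i=1..N. v.mass i) \<le> Mt"
      using Mt by (simp add: mass)
    show "norm (\<Phi> 0 x - Y0 i) \<le> 9 / 8 * R" if "i \<in> {1..N}" "x \<in> A i \<inter> good" for i x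
      by (rule initially_near[OF that])
    show "near_potential (\<mu> i) (\<Phi> s) z (\<epsilon> powr k) \<le> ennreal H"
      if "i \<in> {1..N}" "s \<in> {0..T}" for i s z
      unfolding k_def H_def using that by (intro near_potential_bounded) auto
    show "exp (- \<theta> * R\<^sup>2 / 4) \<le> \<epsilon> powr k"
      using R \<epsilon> by (simp add: \<theta>_def powr_def ln_div)
    show "64 * \<theta> * (\<Sum>i=1..N. \<integral>x. (norm (\<Phi> 0 x - Y i 0))\<^sup>2 \<partial>\<mu> i) * exp (4 * Mt / R\<^sup>2 * T) \<le> Mt"
    proof -
      have "64 * \<theta> * (\<Sum>i=1..N. \<integral>x. (norm (\<Phi> 0 x - Y i 0))\<^sup>2 \<partial>\<mu> i) * exp (4 * Mt / R\<^sup>2 * T)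
          \<le> 64 * \<theta> * (Mt * \<epsilon>\<^sup>2) * 3"
        using D0 exp3[of T] \<theta> Mt0 by (intro mult_mono mult_left_mono) auto
      also have "\<dots> = (768 * k * \<epsilon>) * (\<epsilon> * ln (1 / \<epsilon>)) * (Mt / R\<^sup>2)"
        by (simp add: \<theta>_def power2_eq_square)
      also have "\<dots> \<le> R\<^sup>2 * 1 * (Mt / R\<^sup>2)"
        using small ln k \<epsilon> Mt0 by (intro mult_right_mono mult_mono) auto
      also have "\<dots> = Mt"
        using R by simp
      finally show ?thesis .
    qed
  qed (use T Y_near in auto)
  have disp: "c.dispersion t \<le> 3 * Mt * \<epsilon>\<^sup>2"
  proof -
    have "c.dispersion t \<le> c.dispersion 0 * exp (4 * Mt / R\<^sup>2 * t)"
      by (rule c.dispersion_le[OF t])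
    also have "\<dots> \<le> (Mt * \<epsilon>\<^sup>2) * 3"
      using D0 exp3[of t] t Mt0 by (intro mult_mono) (auto simp: c.dispersion_def c.second_moment_def)
    finally show ?thesis by simp
  qed
  have fm: "c.first_moment j t \<le> 2 * Mt * \<epsilon>" if "j \<in> {1..N}" for j
  proof -
    have "c.first_moment j t \<le> sqrt (Mt * c.dispersion t)"
      by (rule c.first_moment_le[OF that t])
    also have "\<dots> \<le> sqrt ((2 * Mt * \<epsilon>)\<^sup>2)"
    proof (rule real_sqrt_le_mono)
      have "Mt * c.dispersion t \<le> Mt * (3 * Mt * \<epsilon>\<^sup>2)"
        using disp Mt0 by (rule mult_left_mono)
      also have "\<dots> \<le> (2 * Mt * \<epsilon>)\<^sup>2"
        using Mt0 \<epsilon> by (simp add: power_mult_distrib power2_eq_square)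
      finally show "Mt * c.dispersion t \<le> (2 * Mt * \<epsilon>)\<^sup>2" .
    qed
    also have "\<dots> = 2 * Mt * \<epsilon>"
      using Mt0 \<epsilon> by simp
    finally show ?thesis .
  qed
  have t0: "0 \<le> t" using t by simp
  have ai: "0 < \<bar>a i\<bar>" using a[OF i] by simp
  have X: "X s = (1 / \<bar>a i\<bar>) *\<^sub>R (\<integral>x. \<Phi> s x \<partial>\<mu> i)" if "0 \<le> s" for s
    unfolding X_def by (rule center_eq[OF i that])
  show "norm (X t - Y i t) \<le> 2 * Mt / m0 * \<epsilon>"
  proof -
    have "X t - Y i t = (1 / \<bar>a i\<bar>) *\<^sub>R ((\<integral>x. \<Phi> t x \<partial>\<mu> i) - v.mass i *\<^sub>R Y i t)"
      using ai by (simp add: X[OF t0] mass[OF i] scaleR_diff_right)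
    then have "norm (X t - Y i t) = norm ((\<integral>x. \<Phi> t x \<partial>\<mu> i) - v.mass i *\<^sub>R Y i t) / \<bar>a i\<bar>"
      by simp
    also have "\<dots> \<le> (2 * Mt * \<epsilon>) / m0"
      using c.norm_integral_position_le[OF i t] fm[OF i] m0 i Mt0 \<epsilon> by (intro frac_le) auto
    finally show ?thesis by simp
  qed
  let ?U = "\<integral>x. v.u t (\<Phi> t x) \<partial>\<mu> i"
  have deriv: "(X has_vector_derivative (1 / \<bar>a i\<bar>) *\<^sub>R ?U) (at t within {0..})"
  proof -
    have "((\<lambda>t. \<integral>x. \<Phi> t x \<partial>\<mu> i) has_vector_derivative ?U) (at t within {0..})"
    proof (rule v.has_vector_derivative_integral_position[OF i _ t0])
      show "norm (\<Phi> 0 x) \<le> 9 / 8 * R + norm (Y0 i)" if "x \<in> A i \<inter> good" for x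
        using initially_near[OF i that] norm_triangle_ineq[of "\<Phi> 0 x - Y0 i" "Y0 i"] by simp
    qed
    then have "((\<lambda>s. (1 / \<bar>a i\<bar>) *\<^sub>R (\<integral>x. \<Phi> s x \<partial>\<mu> i)) has_vector_derivative (1 / \<bar>a i\<bar>) *\<^sub>R ?U) (at t within {0..})"
      by (rule bounded_linear.has_vector_derivative[OF bounded_linear_scaleR_right])
    then show ?thesis
      by (rule has_vector_derivative_transform[rotated 2]) (use t0 X in auto)
  qed
  then show "X differentiable (at t within {0..})"
    by (rule differentiableI_vector)
  have X': "vector_derivative X (at t within {0..}) = (1 / \<bar>a i\<bar>) *\<^sub>R ?U"
    using deriv t0 unfolding at_within_nonneg_eq[OF t0]
    by (intro vector_derivative_within_closed_interval) auto
  have Y': "vector_derivative (Y i) (at t within {0..T}) = c.Y' i t"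
    unfolding c.Y'_def using T t by (intro vector_derivative_within_closed_interval c.Y_deriv i) auto
  show "norm (vector_derivative X (at t within {0..}) - vector_derivative (Y i) (at t within {0..T}))
      \<le> 2 * Mt\<^sup>2 * (real N + 1) / (m0 * R\<^sup>2) * \<epsilon>"
  proof -
    have "(1 / \<bar>a i\<bar>) *\<^sub>R ?U - c.Y' i t = (1 / \<bar>a i\<bar>) *\<^sub>R (?U - v.mass i *\<^sub>R c.Y' i t)"
      using ai by (simp add: mass[OF i] scaleR_diff_right)
    then have "norm ((1 / \<bar>a i\<bar>) *\<^sub>R ?U - c.Y' i t) = norm (?U - v.mass i *\<^sub>R c.Y' i t) / \<bar>a i\<bar>"
      by simp
    also have "\<dots> \<le> (((Mt + real N * Mt) * (2 * Mt * \<epsilon>)) / R\<^sup>2) / m0"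
    proof (intro frac_le)
      have "norm (?U - v.mass i *\<^sub>R c.Y' i t)
          \<le> (\<Sum>j=1..N. v.mass j * c.first_moment i t + v.mass i * c.first_moment j t) / R\<^sup>2"
        by (rule c.norm_integral_velocity_le[OF i t])
      also have "\<dots> \<le> (\<Sum>j=1..N. v.mass j * (2 * Mt * \<epsilon>) + Mt * (2 * Mt * \<epsilon>)) / R\<^sup>2"
        using fm i c.mass_le[OF i] Mt0 by (intro divide_right_mono sum_mono add_mono mult_left_mono mult_mono) auto
      also have "\<dots> = (((\<Sum>j=1..N. v.mass j) + real N * Mt) * (2 * Mt * \<epsilon>)) / R\<^sup>2"
        by (simp add: sum.distrib sum_distrib_right distrib_right)
      also have "\<dots> \<le> ((Mt + real N * Mt) * (2 * Mt * \<epsilon>)) / R\<^sup>2"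
        using c.total_mass Mt0 \<epsilon> by (intro divide_right_mono mult_right_mono) auto
      finally show "norm (?U - v.mass i *\<^sub>R c.Y' i t) \<le> ((Mt + real N * Mt) * (2 * Mt * \<epsilon>)) / R\<^sup>2" .
    qed (use m0 i Mt0 \<epsilon> in auto)
    also have "\<dots> = 2 * Mt\<^sup>2 * (real N + 1) / (m0 * R\<^sup>2) * \<epsilon>"
      by (simp add: power2_eq_square algebra_simps add_divide_distrib)
    finally show ?thesis
      unfolding X' Y' .
  qed
qed

end

lemma finite_lower_bound:
  fixes S :: "real set"
  assumes "finite S" "\<And>x. x \<in> S \<Longrightarrow> 0 < x"
  shows "\<exists>m>0. \<forall>x\<in>S. m \<le> x"
  by (rule exI[of _ "Min (insert 1 S)"]) (use assms in auto)

theorem theorem2: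
  shows "\<exists>c0::real. 0 < c0 \<and> c0 < 1 \<and>
    (\<forall>(N::nat) (p::real) (\<gamma>::real) (\<Lambda>::real) (\<delta>::real) (R::real) (a::nat \<Rightarrow> real) (Y0::nat \<Rightarrow> real^2).
       2 < p \<longrightarrow> 0 < \<gamma> \<longrightarrow> 0 < \<Lambda> \<longrightarrow> 0 < R \<longrightarrow> R < \<delta> \<longrightarrow>
       (\<forall>i\<in>{1..N}. a i \<noteq> 0) \<longrightarrow> inj_on Y0 {1..N} \<longrightarrow>
       R \<le> c0 * \<delta> \<longrightarrow>
       (\<exists>\<epsilon>0 T C::real. 0 < \<epsilon>0 \<and> \<epsilon>0 \<le> 1 \<and> 0 < T \<and> 0 < C \<and>
          (\<exists>Y. point_vortex_solution N a Y0 T Y) \<and>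
          (\<forall>Y. point_vortex_solution N a Y0 T Y \<longrightarrow>
             (\<forall>\<epsilon> \<omega> \<omega>i. 0 < \<epsilon> \<and> \<epsilon> \<le> \<epsilon>0 \<and> admissible_solution N p \<gamma> \<Lambda> \<delta> R a Y0 \<epsilon> \<omega> \<omega>i \<longrightarrow>
                (\<forall>i\<in>{1..N}. \<forall>t\<in>{0..T}.
                   let X = (\<lambda>s. center (a i) (\<omega>i i s)) in
                     norm (X t - Y i t) \<le> C * exp (C * t) * \<epsilon> \<and>
                     X differentiable (at t within {0..}) \<and>
                     norm (vector_derivative X (at t within {0..})
                           - vector_derivative (Y i) (at t within {0..T}))
                       \<le> C * exp (C * t) * \<epsilon>)))))"
proof (rule exI[of _ "1 / 16 :: real"], intro conjI allI impI)
  fix N :: nat and p \<gamma> \<Lambda> \<delta> R :: real and a :: "nat \<Rightarrow> real" and Y0 :: "nat \<Rightarrow> plane"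
  assume p: "2 < p" and \<gamma>: "0 < \<gamma>" and \<Lambda>: "0 < \<Lambda>" and R: "0 < R" and "R < \<delta>"
    and a: "\<forall>i\<in>{1..N}. a i \<noteq> 0" and inj: "inj_on Y0 {1..N}" and "R \<le> 1 / 16 * \<delta>"
  then have R_le: "16 * R \<le> \<delta>" by simp
  define A where "A = 1 + (\<Sum>i=1..N. \<bar>a i\<bar>)"
  have A: "1 \<le> A" "(\<Sum>i=1..N. \<bar>a i\<bar>) \<le> A"
    by (auto simp: A_def intro: sum_nonneg)
  have "\<exists>m>0. \<forall>x\<in>(\<lambda>i. \<bar>a i\<bar>) ` {1..N}. m \<le> x"
    using a by (intro finite_lower_bound) auto
  then obtain m where m: "0 < m" "\<And>i. i \<in> {1..N} \<Longrightarrow> m \<le> \<bar>a i\<bar>"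
    by blast
  let ?D = "(\<lambda>(i, j). norm (Y0 i - Y0 j)) ` {(i, j) \<in> {1..N} \<times> {1..N}. i \<noteq> j}"
  have "finite ?D"
    by (rule finite_imageI, rule finite_subset[of _ "{1..N} \<times> {1..N}"]) auto
  moreover have "0 < x" if x: "x \<in> ?D" for x
  proof -
    obtain i j where "i \<in> {1..N}" "j \<in> {1..N}" "i \<noteq> j" "x = norm (Y0 i - Y0 j)"
      using x by auto
    then show ?thesis
      using inj_onD[OF inj, of i j] by auto
  qed
  ultimately have "\<exists>d>0. \<forall>x\<in>?D. d \<le> x"
    by (intro finite_lower_bound)
  then obtain d where d: "0 < d" "\<forall>x\<in>?D. d \<le> x"
    by blast
  have dist: "d \<le> norm (Y0 i - Y0 j)" if "i \<in> {1..N}" "j \<in> {1..N}" "i \<noteq> j" for i j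
    using that by (intro bspec[OF d(2)] image_eqI[of _ _ "(i, j)"]) auto
  define p' where "p' = p / (p - 1)"
  have p': "1 < p'" "p' < 2" using p by (simp_all add: p'_def field_simps)
  define k where "k = \<gamma> * p' / (2 - p')"
  have k: "0 < k" using \<gamma> p' by (simp add: k_def)
  define H where "H = riesz_const p' + \<Lambda> powr p"
  have H: "0 \<le> H" using riesz_const_nonneg[OF p'(2)] by (simp add: H_def)
  define S where "S = 3 * A / R + 2 * A + H"
  have S: "0 < S" using A R H by (simp add: S_def add_pos_nonneg)
  define \<eta> where "\<eta> = min (d / 4) (R / 8)"
  have \<eta>: "0 < \<eta>" "4 * \<eta> \<le> d" "\<eta> \<le> R / 8"
    using d R by (auto simp: \<eta>_def)
  \<comment> \<open>in this order: the point vortices stay near, the fixed point map is a contraction, the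
      exponential moments are outweighed, fast particles do not cross the gap\<close>
  define T where "T = min (min (\<eta> / 2 * d / A) (d\<^sup>2 / (16 * A))) (min (R\<^sup>2 / (20 * A)) (R / 8 / S))"
  have T: "0 < T"
    using \<eta> d A R S by (simp add: T_def)
  have time: "A / d * T \<le> \<eta> / 2" "16 * A * T \<le> d\<^sup>2" "20 * A * T \<le> R\<^sup>2" "S * T \<le> R / 8"
  proof -
    have "T \<le> \<eta> / 2 * d / A" "T \<le> d\<^sup>2 / (16 * A)" "T \<le> R\<^sup>2 / (20 * A)" "T \<le> R / 8 / S"
      by (auto simp: T_def)
    then show "A / d * T \<le> \<eta> / 2" "16 * A * T \<le> d\<^sup>2" "20 * A * T \<le> R\<^sup>2" "S * T \<le> R / 8"
      using A d S by (simp_all add: pos_le_divide_eq pos_divide_le_eq mult_ac)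
  qed
  \<comment> \<open>the last entry makes the second moments small even after multiplication by \<open>ln (1 / \<epsilon>)\<close>\<close>
  define \<epsilon>0 where "\<epsilon>0 = min 1 (min (R / 8) (R\<^sup>2 / (768 * k)))"
  have \<epsilon>0: "0 < \<epsilon>0" "\<epsilon>0 \<le> 1" "\<epsilon>0 \<le> R / 8" "\<epsilon>0 \<le> R\<^sup>2 / (768 * k)"
    using R k by (auto simp: \<epsilon>0_def)
  define C1 C2 where "C1 = 2 * A / m" and "C2 = 2 * A\<^sup>2 * (real N + 1) / (m * R\<^sup>2)"
  define C where "C = C1 + C2"
  have C: "0 < C1" "0 \<le> C2" "0 < C" "C1 \<le> C" "C2 \<le> C"
    using A m R by (auto simp: C_def C1_def C2_def add_pos_nonneg)
  show "\<exists>\<epsilon>0 T C::real. 0 < \<epsilon>0 \<and> \<epsilon>0 \<le> 1 \<and> 0 < T \<and> 0 < C \<and>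
          (\<exists>Y. point_vortex_solution N a Y0 T Y) \<and>
          (\<forall>Y. point_vortex_solution N a Y0 T Y \<longrightarrow>
             (\<forall>\<epsilon> \<omega> \<omega>i. 0 < \<epsilon> \<and> \<epsilon> \<le> \<epsilon>0 \<and> admissible_solution N p \<gamma> \<Lambda> \<delta> R a Y0 \<epsilon> \<omega> \<omega>i \<longrightarrow>
                (\<forall>i\<in>{1..N}. \<forall>t\<in>{0..T}.
                   let X = (\<lambda>s. center (a i) (\<omega>i i s)) in
                     norm (X t - Y i t) \<le> C * exp (C * t) * \<epsilon> \<and>
                     X differentiable (at t within {0..}) \<and>
                     norm (vector_derivative X (at t within {0..})
                           - vector_derivative (Y i) (at t within {0..T}))
                       \<le> C * exp (C * t) * \<epsilon>)))"
  proof (rule exI[of _ \<epsilon>0], rule exI[of _ T], rule exI[of _ C], intro conjI allI impI ballI)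
    have "A / d * T \<le> \<eta>"
      using time(1) \<eta>(1) by linarith
    then show "\<exists>Y. point_vortex_solution N a Y0 T Y"
      using time(2) T by (intro point_vortex_solution_exists[OF d(1) _ dist \<eta>(1,2) A(2)]) auto
    fix Y \<epsilon> \<omega> \<omega>i i t
    assume Y: "point_vortex_solution N a Y0 T Y"
      and adm: "0 < \<epsilon> \<and> \<epsilon> \<le> \<epsilon>0 \<and> admissible_solution N p \<gamma> \<Lambda> \<delta> R a Y0 \<epsilon> \<omega> \<omega>i"
      and i: "i \<in> {1..N}" and t: "t \<in> {0..T}"
    have Y_near: "norm (Y j s - Y0 j) \<le> R / 8" if "j \<in> {1..N}" "s \<in> {0..T}" for j s
      using point_vortex_solution_near[OF Y d(1) dist \<eta>(1,2) A(2) time(1) that] \<eta>(3) by simp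
    from adm obtain \<omega>0 where data: "admissible_initial_data N p \<gamma> \<Lambda> \<delta> R a Y0 \<epsilon> \<omega>0"
      and euler: "euler_solution N p a \<omega>0 \<omega> \<omega>i"
      by (auto simp: admissible_solution_def)
    from euler obtain \<Phi> where \<Phi>: "lagrangian_flow (BS_velocity \<omega>) \<Phi>"
      "transported_by \<Phi> \<omega> (\<lambda>x. \<Sum>i=1..N. \<omega>0 i x)" "\<forall>i\<in>{1..N}. transported_by \<Phi> (\<omega>i i) (\<omega>0 i)"
      by (auto simp: euler_solution_def Let_def)
    have Lp: "Lp_continuous p \<omega>" "\<forall>i\<in>{1..N}. Lp_continuous p (\<omega>i i)"
      using euler by (auto simp: euler_solution_def Let_def)
    have small: "0 < \<epsilon>" "\<epsilon> \<le> 1" "8 * \<epsilon> \<le> R" "768 * k * \<epsilon> \<le> R\<^sup>2"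
    proof -
      have "\<epsilon> \<le> R\<^sup>2 / (768 * k)" using adm \<epsilon>0 by linarith
      then show "768 * k * \<epsilon> \<le> R\<^sup>2" using k by (simp add: pos_le_divide_eq mult_ac)
    qed (use adm \<epsilon>0 in auto)
    interpret admissible_flow N p \<gamma> \<Lambda> \<delta> R a Y0 \<epsilon> \<omega> \<omega>i \<omega>0 \<Phi>
      using p \<gamma> \<Lambda> R R_le a small data \<Phi> Lp by unfold_locales auto
    have q_eq: "lagrangian_vortices.q p = p'"
      by (simp only: q_def p'_def)
    note est = estimates[of T A m Y i t, unfolded q_eq, folded k_def H_def, folded S_def,
        OF T time(3,4) A(2) m small(4) Y Y_near i t]
    have grow: "c * \<epsilon> \<le> C * exp (C * t) * \<epsilon>" if "c \<le> C" for c
    proof -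
      have "1 \<le> exp (C * t)" using C t by simp
      then have "C * 1 \<le> C * exp (C * t)" using C by (intro mult_left_mono) auto
      then show ?thesis using that small(1) by (intro mult_right_mono) auto
    qed
    show "let X = (\<lambda>s. center (a i) (\<omega>i i s)) in
            norm (X t - Y i t) \<le> C * exp (C * t) * \<epsilon> \<and>
            X differentiable (at t within {0..}) \<and>
            norm (vector_derivative X (at t within {0..})
                  - vector_derivative (Y i) (at t within {0..T}))
              \<le> C * exp (C * t) * \<epsilon>"
      unfolding Let_def
      using est order_trans[OF _ grow[OF C(4)]] order_trans[OF _ grow[OF C(5)]]
      unfolding C1_def C2_def by blast
  qed (use T \<epsilon>0 C in auto)
qed auto

end
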